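(* Let $T:\operatorname{Mat}_{n\times n}(\mathbb{C})\to\operatorname{Mat}_{m\times m}(\mathbb{C})$ be a completely positive map, and let $P=\operatorname{diag}(p_1,\dots,p_n)$, $Q=\operatorname{diag}(q_1,\dots,q_m)$ with $\mathbf p,\mathbf q$ nonincreasing sequences of nonnegative reals and $\operatorname{Tr}P=\operatorname{Tr}Q$. The following are equivalent: (1) $T_{g,h}$ is $(P,Q)$-rank-nondecreasing for generic $(g^\dagger,h)\in\operatorname{GL}_m(\mathbb{C})\times\operatorname{GL}_n(\mathbb{C})$; (2) $\operatorname{cap}(T_{g,h},P,Q)>0$ for generic $(g^\dagger,h)\in\operatorname{GL}_m(\mathbb{C})\times\operatorname{GL}_n(\mathbb{C})$; (3) $T$ is approximately $\operatorname{GL}_m(\mathbb{C})\times\operatorname{GL}_n(\mathbb{C})$-scalable to $(I_n\to Q,\ I_m\to P)$.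
   Context: $T(X)=\sum_{i=1}^r A_iXA_i^\dagger$ with $A_i\in\operatorname{Mat}_{m\times n}(\mathbb{C})$, $T^*(Y)=\sum_iA_i^\dagger YA_i$, and $T_{g,h}(X)=g^\dagger T(hXh^\dagger)g$. A property holds for generic $x$ in a set $S\subset\mathbb{C}^d$ if there is an affine variety $V$ (common zero set of polynomials) not containing $S$ such that the property holds for all $x\in S\setminus V$. $T$ is approximately $G\times H$-scalable to $(A\to B,C\to D)$ if for every $\epsilon>0$ there is $(g,h)\in G\times H$ with $\|T_{g,h}(A)-B\|\le\epsilon$ and $\|T^*_{g,h}(C)-D\|\le\epsilon$ (Frobenius norm). $E_i\subset\mathbb{C}^m$, $F_j\subset\mathbb{C}^n$ are spans of the first $i$, $j$ standard basis vectors; $\operatorname{GL}(F_\bullet)$ is the group of invertible upper-triangular $n\times n$ matrices. $\Delta a_i=a_i-a_{i+1}$ with $a_{k+1}=0$; $\eta_j=[I_j\ 0]$ ($j\times k$). $\det(A,X)=\prod_{j=1}^k(\det\eta_jX\eta_j^\dagger)^{\Delta a_j}$ for $A=\operatorname{diag}(\mathbf a)$, with $0^0=1$. $\operatorname{cap}(T,P,Q)=\inf_{h\in\operatorname{GL}(F_\bullet)}\det(Q,T(hPh^\dagger))/\det(P,h^\dagger h)$. $(L\subset\mathbb{C}^m,R\subset\mathbb{C}^n)$ is $T$-independent if $L\subset(A_iR)^\perp$ for all $i$; $T$ is $(P,Q)$-rank-nondecreasing if every $T$-independent pair satisfies $\sum_{i=1}^m\Delta q_i\dim(E_i\cap L)+\sum_{j=1}^n\Delta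 p_j\dim(F_j\cap R)\le\operatorname{Tr}P$. *)

theory Defs
  imports
    "Jordan_Normal_Form.Schur_Decomposition"
    "Jordan_Normal_Form.VS_Connect"
    "HOL-Library.Poly_Mapping"
    "HOL-Library.FuncSet"
begin

text \<open>Polynomials over the complex numbers in variables of type \<open>'v\<close>, as finitely supported
  families of coefficients indexed by finitely supported exponent vectors.\<close>

type_synonym 'v cpoly = "('v \<Rightarrow>\<^sub>0 nat) \<Rightarrow>\<^sub>0 complex"

definition cpoly_vars :: "'v cpoly \<Rightarrow> 'v set" where
  "cpoly_vars f = (\<Union>\<mu>\<in>Poly_Mapping.keys f. Poly_Mapping.keys \<mu>)"

definition cpoly_eval :: "'v cpoly \<Rightarrow> ('v \<Rightarrow> complex) \<Rightarrow> complex" where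
  "cpoly_eval f x = (\<Sum>\<mu>\<in>Poly_Mapping.keys f.
     Poly_Mapping.lookup f \<mu> * (\<Prod>v\<in>Poly_Mapping.keys \<mu>. x v ^ Poly_Mapping.lookup \<mu> v))"

text \<open>The affine space with coordinates \<open>I\<close> is the set of extensional functions
  \<open>I \<rightarrow>\<^sub>E UNIV\<close>.\<close>

definition affine_variety :: "'v set \<Rightarrow> ('v \<Rightarrow> complex) set \<Rightarrow> bool" where
  "affine_variety I V \<longleftrightarrow>
     (\<exists>\<F>. (\<forall>f\<in>\<F>. cpoly_vars f \<subseteq> I) \<and> V = {x \<in> I \<rightarrow>\<^sub>E UNIV. \<forall>f\<in>\<F>. cpoly_eval f x = 0})"

text \<open>\<open>c\<close> lists the coordinates of the points of \<open>S\<close>, that is, it embeds \<open>S\<close> into the affine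
  space with coordinates \<open>I\<close>.\<close>

definition holds_generically ::
  "'v set \<Rightarrow> ('a \<Rightarrow> 'v \<Rightarrow> complex) \<Rightarrow> 'a set \<Rightarrow> ('a \<Rightarrow> bool) \<Rightarrow> bool" where
  "holds_generically I c S \<phi> \<longleftrightarrow>
     (\<exists>V. affine_variety I V \<and> \<not> c ` S \<subseteq> V \<and> (\<forall>x\<in>S. c x \<notin> V \<longrightarrow> \<phi> x))"

definition pair_index :: "nat \<Rightarrow> nat \<Rightarrow> (nat \<times> nat + nat \<times> nat) set" where
  "pair_index m n = ({..<m} \<times> {..<m}) <+> ({..<n} \<times> {..<n})"

definition pair_coords ::
  "nat \<Rightarrow> nat \<Rightarrow> complex mat \<times> complex mat \<Rightarrow> nat \<times> nat + nat \<times> nat \<Rightarrow> complex" where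
  "pair_coords m n = (\<lambda>(M, N). \<lambda>k\<in>pair_index m n. case_sum (($$) M) (($$) N) k)"

definition GL :: "nat \<Rightarrow> complex mat set" where
  "GL k = {M \<in> carrier_mat k k. invertible_mat M}"

definition GL_flag :: "nat \<Rightarrow> complex mat set" where
  "GL_flag k = {M \<in> GL k. upper_triangular M}"

definition frobenius_norm :: "complex mat \<Rightarrow> real" where
  "frobenius_norm M = sqrt (\<Sum>i<dim_row M. \<Sum>j<dim_col M. (cmod (M $$ (i, j)))\<^sup>2)"

text \<open>A completely positive map \<open>T\<close> is given by the list \<open>As\<close> of its Kraus operators
  \<open>A\<^sub>1, \<dots>, A\<^sub>r\<close>, which are \<open>m \<times> n\<close> matrices: the notion of \<open>T\<close>-independence refers to them.\<close>

definition cp_map :: "nat \<Rightarrow> complex mat list \<Rightarrow> complex mat \<Rightarrow> complex mat" where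
  "cp_map m As X = foldr (\<lambda>A S. A * X * mat_adjoint A + S) As (0\<^sub>m m m)"

definition cp_dual :: "nat \<Rightarrow> complex mat list \<Rightarrow> complex mat \<Rightarrow> complex mat" where
  "cp_dual n As Y = foldr (\<lambda>A S. mat_adjoint A * Y * A + S) As (0\<^sub>m n n)"

text \<open>Kraus operators of \<open>T\<^bsub>g,h\<^esub>\<close>; the lemmas \<open>cp_map_scale\<close> and \<open>cp_dual_scale\<close> below show that
  \<open>T\<^bsub>g,h\<^esub>(X) = g\<^sup>\<dagger> T(h X h\<^sup>\<dagger>) g\<close> and that the dual is \<open>Y \<mapsto> h\<^sup>\<dagger> T\<^sup>*(g Y g\<^sup>\<dagger>) h\<close>.\<close>

definition cp_scale :: "complex mat \<Rightarrow> complex mat \<Rightarrow> complex mat list \<Rightarrow> complex mat list" where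
  "cp_scale g h As = map (\<lambda>A. mat_adjoint g * A * h) As"

lemma mat_adjoint_carrier [simp]:
  "M \<in> carrier_mat a b \<Longrightarrow> mat_adjoint M \<in> carrier_mat b a"
  unfolding mat_adjoint_def by (metis carrier_matD length_map cols_length mat_of_rows_carrier(1))

lemma mat_adjoint_dim [simp]:
  "dim_row (mat_adjoint M) = dim_col M" "dim_col (mat_adjoint M) = dim_row M"
  by (auto simp: mat_adjoint_def)

lemma mat_adjoint_index [simp]:
  fixes M :: "complex mat"
  assumes "i < dim_col M" "j < dim_row M"
  shows "mat_adjoint M $$ (i, j) = cnj (M $$ (j, i))"
  using assms by (simp add: mat_adjoint_def mat_of_rows_def)

lemma mat_adjoint_mult:
  fixes M N :: "complex mat"
  assumes "dim_col M = dim_row N"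
  shows "mat_adjoint (M * N) = mat_adjoint N * mat_adjoint M"
proof (rule eq_matI)
  fix i j
  assume "i < dim_row (mat_adjoint N * mat_adjoint M)" "j < dim_col (mat_adjoint N * mat_adjoint M)"
  then show "mat_adjoint (M * N) $$ (i, j) = (mat_adjoint N * mat_adjoint M) $$ (i, j)"
    using assms by (auto simp: scalar_prod_def mult.commute intro!: sum.cong)
qed (simp_all add: mat_adjoint_def)

lemma mult_mat_assoc:
  fixes U V W :: "complex mat"
  assumes "dim_col U = dim_row V" "dim_col V = dim_row W"
  shows "U * V * W = U * (V * W)"
proof (rule assoc_mult_mat)
  show "U \<in> carrier_mat (dim_row U) (dim_row V)"
    using assms(1) by (rule carrier_matI[OF refl])
  show "V \<in> carrier_mat (dim_row V) (dim_row W)"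
    using assms(2) by (rule carrier_matI[OF refl])
  show "W \<in> carrier_mat (dim_row W) (dim_col W)"
    by (rule carrier_matI[OF refl refl])
qed

lemma mat_adjoint_adjoint [simp]:
  fixes M :: "complex mat"
  shows "mat_adjoint (mat_adjoint M) = M"
  by (rule eq_matI) auto

lemma cp_map_carrier:
  assumes "set As \<subseteq> carrier_mat m n"
  shows "cp_map m As X \<in> carrier_mat m m"
proof -
  have "dim_row (cp_map m As X) = m \<and> dim_col (cp_map m As X) = m"
    using assms by (induction As) (simp_all add: cp_map_def)
  then show ?thesis by blast
qed

lemma cp_dual_carrier:
  assumes "set As \<subseteq> carrier_mat m n"
  shows "cp_dual n As Y \<in> carrier_mat n n"
proof -
  have "dim_row (cp_dual n As Y) = n \<and> dim_col (cp_dual n As Y) = n"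
    using assms by (induction As) (simp_all add: cp_dual_def)
  then show ?thesis by blast
qed

lemma sandwich_distrib:
  fixes U :: "complex mat"
  assumes "U \<in> carrier_mat a b" "W \<in> carrier_mat b a" "M \<in> carrier_mat b b" "N \<in> carrier_mat b b"
  shows "U * (M + N) * W = U * M * W + U * N * W"
proof -
  have "U * (M + N) = U * M + U * N"
    by (rule mult_add_distrib_mat[OF assms(1,3,4)])
  moreover have "(U * M + U * N) * W = U * M * W + U * N * W"
    by (rule add_mult_distrib_mat[of _ a b]) (use assms in auto)
  ultimately show ?thesis by simp
qed

lemma cp_map_scale:
  assumes "set As \<subseteq> carrier_mat m n" "g \<in> carrier_mat m m" "h \<in> carrier_mat n n"
    and "X \<in> carrier_mat n n"
  shows "cp_map m (cp_scale g h As) X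
    = mat_adjoint g * cp_map m As (h * X * mat_adjoint h) * g"
  using assms(1)
proof (induction As)
  case Nil
  then show ?case using assms(2) by (simp add: cp_map_def cp_scale_def)
next
  case (Cons A As)
  have A: "A \<in> carrier_mat m n" using Cons.prems by simp
  let ?X = "h * X * mat_adjoint h" and ?g = "mat_adjoint g"
  note gh = A assms(2-4) mat_adjoint_carrier[OF A] mat_adjoint_carrier[OF assms(2)]
    mat_adjoint_carrier[OF assms(3)]
  have dims: "dim_row A = m" "dim_col A = n" "dim_row g = m" "dim_col g = m" "dim_row h = n"
    "dim_col h = n" "dim_row X = n" "dim_col X = n"
    using A assms(2-4) by auto
  have "?g * A * h * X * mat_adjoint (?g * A * h) = ?g * (A * ?X * mat_adjoint A) * g"
    using dims by (simp add: mat_adjoint_mult mult_mat_assoc)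
  then have "cp_map m (cp_scale g h (A # As)) X
      = ?g * (A * ?X * mat_adjoint A) * g + cp_map m (cp_scale g h As) X"
    by (simp only: cp_map_def cp_scale_def list.map foldr.simps o_apply)
  also have "\<dots> = ?g * (A * ?X * mat_adjoint A) * g + ?g * cp_map m As ?X * g"
    using Cons by (simp only: list.set insert_subset)
  also have "\<dots> = ?g * (A * ?X * mat_adjoint A + cp_map m As ?X) * g"
  proof (rule sandwich_distrib[symmetric, of _ m m])
    show "A * ?X * mat_adjoint A \<in> carrier_mat m m"
      using dims by (auto intro!: carrier_matI)
    show "cp_map m As ?X \<in> carrier_mat m m"
      using Cons.prems by (intro cp_map_carrier) auto
  qed (use gh in auto)
  also have "\<dots> = ?g * cp_map m (A # As) ?X * g"
    by (simp only: cp_map_def foldr.simps o_apply)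
  finally show ?case .
qed

lemma cp_dual_scale:
  assumes "set As \<subseteq> carrier_mat m n" "g \<in> carrier_mat m m" "h \<in> carrier_mat n n"
    and "Y \<in> carrier_mat m m"
  shows "cp_dual n (cp_scale g h As) Y
    = mat_adjoint h * cp_dual n As (g * Y * mat_adjoint g) * h"
  using assms(1)
proof (induction As)
  case Nil
  then show ?case using assms(3) by (simp add: cp_dual_def cp_scale_def)
next
  case (Cons A As)
  have A: "A \<in> carrier_mat m n" using Cons.prems by simp
  let ?Y = "g * Y * mat_adjoint g" and ?g = "mat_adjoint g" and ?h = "mat_adjoint h"
  note gh = A assms(2-4) mat_adjoint_carrier[OF A] mat_adjoint_carrier[OF assms(2)]
    mat_adjoint_carrier[OF assms(3)]
  have dims: "dim_row A = m" "dim_col A = n" "dim_row g = m" "dim_col g = m" "dim_row h = n"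
    "dim_col h = n" "dim_row Y = m" "dim_col Y = m"
    using A assms(2-4) by auto
  have "mat_adjoint (?g * A * h) * Y * (?g * A * h) = ?h * (mat_adjoint A * ?Y * A) * h"
    using dims by (simp add: mat_adjoint_mult mult_mat_assoc)
  then have "cp_dual n (cp_scale g h (A # As)) Y
      = ?h * (mat_adjoint A * ?Y * A) * h + cp_dual n (cp_scale g h As) Y"
    by (simp only: cp_dual_def cp_scale_def list.map foldr.simps o_apply)
  also have "\<dots> = ?h * (mat_adjoint A * ?Y * A) * h + ?h * cp_dual n As ?Y * h"
    using Cons by (simp only: list.set insert_subset)
  also have "\<dots> = ?h * (mat_adjoint A * ?Y * A + cp_dual n As ?Y) * h"
  proof (rule sandwich_distrib[symmetric, of _ n n])
    show "mat_adjoint A * ?Y * A \<in> carrier_mat n n"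
      using dims by (auto intro!: carrier_matI)
    show "cp_dual n As ?Y \<in> carrier_mat n n"
      using Cons.prems by (intro cp_dual_carrier) auto
  qed (use gh in auto)
  also have "\<dots> = ?h * cp_dual n (A # As) ?Y * h"
    by (simp only: cp_dual_def foldr.simps o_apply)
  finally show ?case .
qed

definition approx_scalable ::
  "nat \<Rightarrow> nat \<Rightarrow> complex mat set \<Rightarrow> complex mat set \<Rightarrow> complex mat list \<Rightarrow>
   complex mat \<Rightarrow> complex mat \<Rightarrow> complex mat \<Rightarrow> complex mat \<Rightarrow> bool" where
  "approx_scalable m n G H As A B C D \<longleftrightarrow>
     (\<forall>\<epsilon>>0. \<exists>g\<in>G. \<exists>h\<in>H.
        frobenius_norm (cp_map m (cp_scale g h As) A - B) \<le> \<epsilon> \<and>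
        frobenius_norm (cp_dual n (cp_scale g h As) C - D) \<le> \<epsilon>)"

text \<open>A sequence \<open>a\<^sub>1, \<dots>, a\<^sub>k\<close> is a function whose values at \<open>1, \<dots>, k\<close> are relevant; matrix indices
  start from 0.\<close>

definition diag_of :: "nat \<Rightarrow> (nat \<Rightarrow> real) \<Rightarrow> complex mat" where
  "diag_of k a = mat_diag k (\<lambda>i. complex_of_real (a (Suc i)))"

definition \<Delta> :: "nat \<Rightarrow> (nat \<Rightarrow> real) \<Rightarrow> nat \<Rightarrow> real" where
  "\<Delta> k a i = a i - (if i = k then 0 else a (Suc i))"

definition \<eta> :: "nat \<Rightarrow> nat \<Rightarrow> complex mat" where
  "\<eta> k j = mat j k (\<lambda>(a, b). if a = b then 1 else 0)"

text \<open>\<open>powr\<close> with the convention \<open>0\<^sup>0 = 1\<close> (in the library, \<open>0 powr 0 = 0\<close>).\<close>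

definition rpow :: "real \<Rightarrow> real \<Rightarrow> real" where
  "rpow x s = (if s = 0 then 1 else x powr s)"

text \<open>\<open>det(A, X)\<close> for \<open>A = diag(a\<^sub>1, \<dots>, a\<^sub>k)\<close>. It is only used for positive semidefinite \<open>X\<close>, whose
  leading principal minors are nonnegative reals.\<close>

definition rel_det :: "nat \<Rightarrow> (nat \<Rightarrow> real) \<Rightarrow> complex mat \<Rightarrow> real" where
  "rel_det k a X = (\<Prod>j=1..k. rpow (Re (det (\<eta> k j * X * mat_adjoint (\<eta> k j)))) (\<Delta> k a j))"

definition capacity ::
  "nat \<Rightarrow> nat \<Rightarrow> complex mat list \<Rightarrow> (nat \<Rightarrow> real) \<Rightarrow> (nat \<Rightarrow> real) \<Rightarrow> real" where
  "capacity m n As p q = (INF h\<in>GL_flag n.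
     rel_det m q (cp_map m As (h * diag_of n p * mat_adjoint h))
       / rel_det n p (mat_adjoint h * h))"

abbreviation cvec_space :: "nat \<Rightarrow> (complex, complex vec) module" where
  "cvec_space k \<equiv> module_vec TYPE(complex) k"

definition subspace_dim :: "nat \<Rightarrow> complex vec set \<Rightarrow> nat" where
  "subspace_dim k W = vectorspace.dim class_ring (cvec_space k\<lparr>carrier := W\<rparr>)"

definition std_flag :: "nat \<Rightarrow> nat \<Rightarrow> complex vec set" where
  "std_flag k i = LinearCombinations.module.span class_ring (cvec_space k) (unit_vec k ` {..<i})"

text \<open>Orthogonality is meant with respect to the Hermitian inner product, whereas the library's
  \<open>orthogonal_complement\<close> uses the bilinear product.\<close>

definition hermitian_complement :: "nat \<Rightarrow> complex vec set \<Rightarrow> complex vec set" where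
  "hermitian_complement k W = {x \<in> carrier_vec k. \<forall>y\<in>W. x \<bullet>c y = 0}"

definition cp_independent ::
  "nat \<Rightarrow> nat \<Rightarrow> complex mat list \<Rightarrow> complex vec set \<Rightarrow> complex vec set \<Rightarrow> bool" where
  "cp_independent m n As L R \<longleftrightarrow>
     VectorSpace.subspace class_ring L (cvec_space m) \<and>
     VectorSpace.subspace class_ring R (cvec_space n) \<and>
     (\<forall>A\<in>set As. L \<subseteq> hermitian_complement m ((\<lambda>v. A *\<^sub>v v) ` R))"

definition rank_nondecreasing ::
  "nat \<Rightarrow> nat \<Rightarrow> complex mat list \<Rightarrow> (nat \<Rightarrow> real) \<Rightarrow> (nat \<Rightarrow> real) \<Rightarrow> bool" where
  "rank_nondecreasing m n As p q \<longleftrightarrow>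
     (\<forall>L R. cp_independent m n As L R \<longrightarrow>
        (\<Sum>i=1..m. \<Delta> m q i * real (subspace_dim m (std_flag m i \<inter> L))) +
        (\<Sum>j=1..n. \<Delta> n p j * real (subspace_dim n (std_flag n j \<inter> R)))
        \<le> (\<Sum>j=1..n. p j))"

text \<open>The property \<open>\<phi>\<close> of \<open>(g, h)\<close> holds for generic \<open>(g\<^sup>\<dagger>, h)\<close> in \<open>GL\<^sub>m \<times> GL\<^sub>n\<close>; the point of
  affine space is \<open>(M, h)\<close> with \<open>M = g\<^sup>\<dagger>\<close>, so that \<open>g = M\<^sup>\<dagger>\<close>.\<close>

definition for_generic_adjoint_pair ::
  "nat \<Rightarrow> nat \<Rightarrow> (complex mat \<Rightarrow> complex mat \<Rightarrow> bool) \<Rightarrow> bool" where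
  "for_generic_adjoint_pair m n \<phi> \<longleftrightarrow>
     holds_generically (pair_index m n) (pair_coords m n) (GL m \<times> GL n)
       (\<lambda>(M, h). \<phi> (mat_adjoint M) h)"

end

(* The triangular functional F(g, h) = Tr T_{g,h}(I) - 2 sum_i q_i ln |g_ii| - 2 sum_j p_j ln |h_jj|
   governs everything. If cap > 0, then F is bounded below and coercive on pairs of invertible
   upper triangular matrices, and its gradient consists of the upper triangular parts
   of T_{g,h}(I) - Q and S(I) - P, with S the dual of T_{g,h}; as these matrices are Hermitian,
   near-minimizers of F are approximate scalings.

   If T is rank-nondecreasing, write h P h^+ = sum_b (Delta p_b) X_b, where X_b is positive definite
   on F_b, and diagonalize every X_b and every leading block of T(h P h^+). Hall's condition for the
   bipartite graph of overlaps of the two families of eigenvectors is exactly rank-nondecreasingness;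
   a layer-cake integration then bounds det(Q, T(h P h^+)) below by a multiple of the product of
   the powers of the eigenvalues, and compactness makes the constant uniform in h.

   If T_{g,h}(I) and S(I) are close enough to Q and P, then T_{g,h} is rank-nondecreasing,
   because the dimensions take finitely many values; so this holds on a Euclidean open set of pairs
   (g^+, h). Rank-nondecreasingness fails iff finitely many echelon families solve a system of
   polynomial equations, so by Chevalley's theorem (projections of constructible sets are
   constructible) it is constant on the complement of some hypersurface, which meets every nonempty
   Euclidean open set. *)

theory Submission
  imports Defs "HOL-Analysis.Henstock_Kurzweil_Integration"
    "HOL-Computational_Algebra.Fundamental_Theorem_Algebra"
begin

hide_type (open) Finite_Cartesian_Product.vec
hide_const (open) Finite_Cartesian_Product.mat Finite_Cartesian_Product.row Finite_Cartesian_Product.vec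
  Finite_Cartesian_Product.transpose
no_notation Finite_Cartesian_Product.vec_nth (infixl "$" 90)
no_notation Inner_Product.real_inner_class.inner (infix "\<bullet>" 70)

section \<open>Projections of constructible sets\<close>

text \<open>The infimum of F need not be attained, as the triangular groups are not compact. No
  limit of pairs is taken: a pair within s^2 of the infimum is tested against elementary matrices of
  step size s, and the quadratic error terms then force every entry of the gradient to be of order
  s. Coercivity keeps the constants bounded.

  No matching is extracted from Hall's condition. Only the dual inequality between weighted sums of
  logarithms is wanted, and integrating over thresholds gives it directly for real weights. Overlaps
  can be nonzero yet arbitrarily small as h varies, so an edge requires an overlap of at least a
  fixed delta; the compactness behind delta concerns the eigenvector families, which stay bounded,
  and not h itself.

  Genericity refers to g^+ because the Kraus operators M A h are polynomial in (M, h), while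
  conjugation is not. Subspaces are replaced by pivot sets with echelon vectors, which turns a
  violation into one of finitely many existential statements about entries. One pair of positive
  capacity suffices for (3), and one approximate scaling of small enough error suffices for
  (1).\<close>

inductive polyfun :: "'v set \<Rightarrow> (('v \<Rightarrow> complex) \<Rightarrow> complex) \<Rightarrow> bool" for I where
  polyfun_const: "polyfun I (\<lambda>x. c)"
| polyfun_var: "v \<in> I \<Longrightarrow> polyfun I (\<lambda>x. x v)"
| polyfun_add: "polyfun I f \<Longrightarrow> polyfun I g \<Longrightarrow> polyfun I (\<lambda>x. f x + g x)"
| polyfun_mult: "polyfun I f \<Longrightarrow> polyfun I g \<Longrightarrow> polyfun I (\<lambda>x. f x * g x)"

text \<open>Polynomials are kept as functions and sets as predicates, so that projecting a set along
  a coordinate is literally an existential quantifier. The syntactic \<open>cpoly\<close> enters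
  only when a variety has to be exhibited.\<close>

inductive constructible :: "'v set \<Rightarrow> (('v \<Rightarrow> complex) \<Rightarrow> bool) \<Rightarrow> bool" for I where
  constructible_zero: "polyfun I f \<Longrightarrow> constructible I (\<lambda>x. f x = 0)"
| constructible_not: "constructible I P \<Longrightarrow> constructible I (\<lambda>x. \<not> P x)"
| constructible_conj: "constructible I P \<Longrightarrow> constructible I Q \<Longrightarrow> constructible I (\<lambda>x. P x \<and> Q x)"

lemma polyfun_diff: "polyfun I f \<Longrightarrow> polyfun I g \<Longrightarrow> polyfun I (\<lambda>x. f x - g x)"
  using polyfun_add[of I f "\<lambda>x. (-1) * g x"] polyfun_mult[OF polyfun_const, of I g "-1"] by simp

lemma polyfun_sum: "(\<And>s. s \<in> S \<Longrightarrow> polyfun I (f s)) \<Longrightarrow> polyfun I (\<lambda>x. \<Sum>s\<in>S. f s x)"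
  by (induction S rule: infinite_finite_induct) (auto intro: polyfun_const polyfun_add)

lemma polyfun_prod: "(\<And>s. s \<in> S \<Longrightarrow> polyfun I (f s)) \<Longrightarrow> polyfun I (\<lambda>x. \<Prod>s\<in>S. f s x)"
  by (induction S rule: infinite_finite_induct) (auto intro: polyfun_const polyfun_mult)

lemma polyfun_cong: "polyfun I f \<Longrightarrow> (\<And>v. v \<in> I \<Longrightarrow> x v = y v) \<Longrightarrow> f x = f y"
  by (induction rule: polyfun.induct) auto

lemma constructible_disj: "constructible I P \<Longrightarrow> constructible I Q \<Longrightarrow> constructible I (\<lambda>x. P x \<or> Q x)"
  using constructible_not[OF constructible_conj[OF constructible_not constructible_not, of I P Q]] by simp

lemma constructible_True: "constructible I (\<lambda>x. True)"
  using constructible_zero[OF polyfun_const[of I 0]] by simp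

lemma constructible_nonzero: "polyfun I f \<Longrightarrow> constructible I (\<lambda>x. f x \<noteq> 0)"
  by (intro constructible_not constructible_zero)

lemma constructible_False: "constructible I (\<lambda>x. False)"
  using constructible_not[OF constructible_True] by simp

lemma constructible_ball:
  "finite S \<Longrightarrow> (\<And>s. s \<in> S \<Longrightarrow> constructible I (P s)) \<Longrightarrow> constructible I (\<lambda>x. \<forall>s\<in>S. P s x)"
  by (induction S rule: finite_induct) (auto intro: constructible_True constructible_conj)

lemma constructible_bex:
  "finite S \<Longrightarrow> (\<And>s. s \<in> S \<Longrightarrow> constructible I (P s)) \<Longrightarrow> constructible I (\<lambda>x. \<exists>s\<in>S. P s x)"
  by (induction S rule: finite_induct) (auto intro: constructible_False constructible_disj)

lemma fun_conj_cong: "(\<And>x. A x \<Longrightarrow> P x = Q x) \<Longrightarrow> (\<lambda>x. A x \<and> P x) = (\<lambda>x. A x \<and> Q x)"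
  by auto

text \<open>The elimination below branches on the vanishing of a formal leading coefficient; the
  region \<open>A\<close> records the branches taken so far.\<close>

lemma constructible_cases:
  assumes "constructible I (\<lambda>x. (A x \<and> f x = 0) \<and> Q x)" "constructible I (\<lambda>x. (A x \<and> f x \<noteq> 0) \<and> Q x)"
  shows "constructible I (\<lambda>x. A x \<and> Q x)"
proof -
  have "(\<lambda>x. A x \<and> Q x) = (\<lambda>x. ((A x \<and> f x = 0) \<and> Q x) \<or> ((A x \<and> f x \<noteq> 0) \<and> Q x))" by auto
  then show ?thesis using constructible_disj[OF assms] by simp
qed

section \<open>Families of univariate polynomials and pseudo-division\<close>

definition polycoeffs :: "'v set \<Rightarrow> (('v \<Rightarrow> complex) \<Rightarrow> complex poly) \<Rightarrow> bool" where
  "polycoeffs I F \<longleftrightarrow> (\<forall>k. polyfun I (\<lambda>x. coeff (F x) k))"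

text \<open>A formal degree bound, uniform over the region \<open>A\<close>: the true degree varies
  with \<open>x\<close>, while the inductions below need one number for all
  \<open>x\<close>.\<close>

definition degree_below :: "('x \<Rightarrow> bool) \<Rightarrow> nat \<Rightarrow> ('x \<Rightarrow> complex poly) \<Rightarrow> bool" where
  "degree_below A N F \<longleftrightarrow> (\<forall>x. A x \<longrightarrow> (\<forall>k\<ge>N. coeff (F x) k = 0))"

lemma degree_below_cases:
  "degree_below A (Suc d) F \<Longrightarrow> degree_below (\<lambda>x. A x \<and> coeff (F x) d = 0) d F"
  unfolding degree_below_def by (metis Suc_leI le_neq_implies_less)

lemma degree_below_mono: "degree_below A N F \<Longrightarrow> (\<And>x. B x \<Longrightarrow> A x) \<Longrightarrow> degree_below B N F"
  by (auto simp: degree_below_def)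

lemma polycoeffs_mult: "polycoeffs I F \<Longrightarrow> polycoeffs I G \<Longrightarrow> polycoeffs I (\<lambda>x. F x * G x)"
  by (auto simp: polycoeffs_def coeff_mult intro!: polyfun_sum polyfun_mult)

lemma polycoeffs_power: "polycoeffs I F \<Longrightarrow> polycoeffs I (\<lambda>x. F x ^ n)"
proof (induction n)
  case 0
  then show ?case by (auto simp: polycoeffs_def intro: polyfun_const)
next
  case (Suc n)
  then show ?case by (simp add: polycoeffs_mult)
qed

text \<open>The pseudo-remainder combination: multiplying crosswise by coefficients avoids division,
  so the new coefficients are again polynomial in \<open>x\<close>.\<close>

lemma polycoeffs_cross:
  assumes "polycoeffs I F" "polycoeffs I G"
  shows "polycoeffs I (\<lambda>x. smult (coeff (F x) i) (G x) - smult (coeff (G x) j) (monom 1 n * F x))"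
  unfolding polycoeffs_def
proof
  fix k
  have "polyfun I (\<lambda>x. coeff (F x) i * coeff (G x) k
      - coeff (G x) j * (if n \<le> k then coeff (F x) (k - n) else 0))"
    using assms by (cases "n \<le> k")
      (auto simp: polycoeffs_def intro!: polyfun_diff polyfun_mult polyfun_const)
  then show "polyfun I (\<lambda>x. coeff (smult (coeff (F x) i) (G x) - smult (coeff (G x) j) (monom 1 n * F x)) k)"
    by (simp add: coeff_monom_mult if_distrib cong: if_cong)
qed

lemma coeff_cross_zero:
  fixes f g :: "complex poly"
  assumes "\<forall>k\<ge>Suc d. coeff f k = 0" "\<forall>k\<ge>Suc e. coeff g k = 0" "d \<le> e" "e \<le> k"
  shows "coeff (smult (coeff f d) g - smult (coeff g e) (monom 1 (e - d) * f)) k = 0"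
  using assms by (cases "k = e") (auto simp: coeff_monom_mult)

text \<open>Pseudo-division by \<open>F\<close>: its leading coefficient is nonzero on
  \<open>A\<close>, so replacing \<open>G\<close> by the cross combination keeps divisibility and
  lowers the formal degree. Below the degree of \<open>F\<close> only the zero polynomial is
  divisible.\<close>

lemma constructible_dvd:
  assumes F: "polycoeffs I F" and A: "constructible I A" and d: "degree_below A (Suc d) F"
    and lead: "\<And>x. A x \<Longrightarrow> coeff (F x) d \<noteq> 0"
    and G: "polycoeffs I G" "degree_below A N G"
  shows "constructible I (\<lambda>x. A x \<and> F x dvd G x)"
  using G
proof (induction N arbitrary: G)
  case 0
  then have "G x = 0" if "A x" for x using that by (intro poly_eqI) (auto simp: degree_below_def)
  then have "(\<lambda>x. A x \<and> F x dvd G x) = A" by auto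
  then show ?case using A by simp
next
  case (Suc e)
  show ?case
  proof (cases "d \<le> e")
    case True
    define G' where "G' x = smult (coeff (F x) d) (G x) - smult (coeff (G x) e) (monom 1 (e - d) * F x)" for x
    have "constructible I (\<lambda>x. A x \<and> F x dvd G' x)"
    proof (rule Suc.IH)
      show "polycoeffs I G'" unfolding G'_def by (rule polycoeffs_cross) fact+
      show "degree_below A e G'"
        using d Suc.prems True unfolding degree_below_def G'_def by (meson coeff_cross_zero)
    qed
    moreover have "F x dvd G' x \<longleftrightarrow> F x dvd G x" if "A x" for x
    proof -
      have "F x dvd smult (coeff (G x) e) (monom 1 (e - d) * F x)"
        by (simp add: dvd_smult)
      then have "F x dvd G' x \<longleftrightarrow> F x dvd smult (coeff (F x) d) (G x)"
        unfolding G'_def by (simp add: dvd_diff_left_iff)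
      then show ?thesis using lead[OF that] by (simp add: dvd_smult_iff)
    qed
    ultimately show ?thesis by (simp cong: conj_cong)
  next
    case False
    have "(F x dvd G x) \<longleftrightarrow> (\<forall>k\<in>{..<Suc e}. coeff (G x) k = 0)" if "A x" for x
    proof
      assume dvd: "F x dvd G x"
      have "G x = 0"
      proof (rule ccontr)
        assume "G x \<noteq> 0"
        then have "degree (F x) \<le> degree (G x)" using dvd by (rule dvd_imp_degree_le[rotated])
        moreover have "d \<le> degree (F x)" using lead[OF that] by (rule le_degree)
        moreover have "degree (G x) < Suc e"
          using \<open>G x \<noteq> 0\<close> Suc.prems(2) that unfolding degree_below_def
          by (metis leading_coeff_0_iff not_less)
        ultimately show False using False by simp
      qed
      then show "\<forall>k\<in>{..<Suc e}. coeff (G x) k = 0" by simp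
    next
      assume "\<forall>k\<in>{..<Suc e}. coeff (G x) k = 0"
      then have "coeff (G x) k = 0" for k
        using Suc.prems(2) that by (cases "k < Suc e") (auto simp: degree_below_def)
      then have "G x = 0" by (intro poly_eqI) simp
      then show "F x dvd G x" by simp
    qed
    then have "(\<lambda>x. A x \<and> F x dvd G x) = (\<lambda>x. A x \<and> (\<forall>k\<in>{..<Suc e}. coeff (G x) k = 0))"
      by (rule fun_conj_cong)
    then show ?thesis
      using A Suc.prems(1)
      by (auto simp: polycoeffs_def intro!: constructible_conj constructible_ball constructible_zero)
  qed
qed

lemma degree_below_power:
  assumes "degree_below A N G"
  shows "\<exists>M. degree_below A M (\<lambda>x. G x ^ n)"
proof -
  have "coeff (G x ^ n) k = 0" if "A x" "k \<ge> Suc (N * n)" for x k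
  proof (rule coeff_eq_0)
    have "degree (G x) \<le> N" using assms that(1) by (intro degree_le) (auto simp: degree_below_def)
    then have "degree (G x) * n \<le> N * n" by simp
    then show "degree (G x ^ n) < k" using degree_power_le[of "G x" n] that(2) by linarith
  qed
  then show ?thesis unfolding degree_below_def by blast
qed

definition solvable :: "('x \<Rightarrow> complex poly) list \<Rightarrow> ('x \<Rightarrow> complex poly) \<Rightarrow> 'x \<Rightarrow> bool" where
  "solvable Fs G x \<longleftrightarrow> (\<exists>y. (\<forall>F\<in>set Fs. poly (F x) y = 0) \<and> poly (G x) y \<noteq> 0)"

lemma solvable_drop_zero:
  assumes "degree_below A 0 F"
  shows "(\<lambda>x. A x \<and> solvable (F # Fs) G x) = (\<lambda>x. A x \<and> solvable Fs G x)"
proof -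
  have "F x = 0" if "A x" for x using assms that by (intro poly_eqI) (auto simp: degree_below_def)
  then show ?thesis by (auto simp: solvable_def fun_eq_iff)
qed

text \<open>If \<open>F\<close> has exact degree \<open>d\<close>, there is no solution iff all
  roots of \<open>F\<close> are roots of \<open>G\<close>, that is, iff \<open>F\<close> divides the
  \<open>d\<close>-th power of \<open>G\<close> (univariate Nullstellensatz). Where the leading
  coefficient vanishes, the formal degree drops; the case without equations is passed in as
  \<open>nil\<close>.\<close>

lemma constructible_solvable_single:
  assumes G: "polycoeffs I G" "degree_below A M G"
    and F: "polycoeffs I F" "degree_below A N F" and A: "constructible I A"
    and nil: "\<And>B. constructible I B \<Longrightarrow> degree_below B M G \<Longrightarrow> constructible I (\<lambda>x. B x \<and> solvable [] G x)"
  shows "constructible I (\<lambda>x. A x \<and> solvable [F] G x)"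
  using assms(2,4,5)
proof (induction N arbitrary: A)
  case 0
  then show ?case using nil by (simp add: solvable_drop_zero)
next
  case (Suc d)
  let ?c = "\<lambda>x. coeff (F x) d"
  have c: "polyfun I ?c" using F(1) by (simp add: polycoeffs_def)
  show ?case
  proof (rule constructible_cases[where f = ?c])
    show "constructible I (\<lambda>x. (A x \<and> ?c x = 0) \<and> solvable [F] G x)"
      using Suc.prems c degree_below_cases[OF Suc.prems(2)]
      by (intro Suc.IH constructible_conj constructible_zero) (auto elim: degree_below_mono)
    let ?A = "\<lambda>x. A x \<and> ?c x \<noteq> 0"
    obtain M' where M': "degree_below A M' (\<lambda>x. G x ^ d)"
      using degree_below_power[OF Suc.prems(1)] by blast
    have cA: "constructible I ?A"
      using Suc.prems c by (intro constructible_conj constructible_nonzero)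
    have "constructible I (\<lambda>x. ?A x \<and> F x dvd G x ^ d)"
      by (rule constructible_dvd[OF F(1) cA _ _ polycoeffs_power[OF G(1)]])
        (use Suc.prems M' in \<open>auto elim: degree_below_mono\<close>)
    from constructible_conj[OF cA constructible_not[OF this]]
    have "constructible I (\<lambda>x. ?A x \<and> \<not> (?A x \<and> F x dvd G x ^ d))" .
    moreover have "solvable [F] G x \<longleftrightarrow> \<not> (?A x \<and> F x dvd G x ^ d)" if "?A x" for x
    proof -
      have "degree (F x) \<le> d"
        using Suc.prems(2) that by (intro degree_le) (auto simp: degree_below_def)
      moreover have "d \<le> degree (F x)" using that by (intro le_degree) auto
      ultimately have "degree (F x) = d" by simp
      moreover have "F x \<noteq> 0" using that by auto
      ultimately show ?thesis
        using nullstellensatz_univariate[of "F x" "G x"] that by (auto simp: solvable_def)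
    qed
    then have "(\<lambda>x. ?A x \<and> solvable [F] G x) = (\<lambda>x. ?A x \<and> \<not> (?A x \<and> F x dvd G x ^ d))"
      by (rule fun_conj_cong)
    ultimately show "constructible I (\<lambda>x. ?A x \<and> solvable [F] G x)" by simp
  qed
qed

text \<open>Elimination of one variable, by induction on the number of equations. Two equations are
  merged by the Euclidean algorithm until one of them is zero; a single one is handled by
  divisibility. The inequation \<open>G\<close> is carried along unchanged.\<close>

lemma constructible_solvable:
  assumes G: "polycoeffs I G" 
    and "degree_below A M G"
    and "\<forall>F\<in>set Fs. polycoeffs I F \<and> (\<exists>N. degree_below A N F)" and "constructible I A"
  shows "constructible I (\<lambda>x. A x \<and> solvable Fs G x)"
  using assms(2-4)
proof (induction "length Fs" arbitrary: Fs A)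
  case 0
  have "solvable [] G x \<longleftrightarrow> (\<exists>k\<in>{..<M}. coeff (G x) k \<noteq> 0)" if "A x" for x
  proof -
    have "solvable [] G x \<longleftrightarrow> G x \<noteq> 0"
      using poly_all_0_iff_0[of "G x"] by (auto simp: solvable_def)
    also have "\<dots> \<longleftrightarrow> (\<exists>k\<in>{..<M}. coeff (G x) k \<noteq> 0)"
      using 0(2) that unfolding degree_below_def poly_eq_iff by (metis coeff_0 lessThan_iff not_less)
    finally show ?thesis .
  qed
  then have "(\<lambda>x. A x \<and> solvable [] G x) = (\<lambda>x. A x \<and> (\<exists>k\<in>{..<M}. coeff (G x) k \<noteq> 0))"
    by (rule fun_conj_cong)
  moreover have "constructible I (\<lambda>x. A x \<and> (\<exists>k\<in>{..<M}. coeff (G x) k \<noteq> 0))"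
    using 0 G by (auto simp: polycoeffs_def intro!: constructible_conj constructible_bex constructible_nonzero)
  ultimately show ?case using 0(1) by simp
next
  case (Suc l)
  show ?case
  proof (cases l)
    case 0
    then obtain F where Fs: "Fs = [F]" using Suc.hyps(2) by (metis length_0_conv length_Suc_conv)
    then obtain N where "degree_below A N F" using Suc.prems by auto
    then show ?thesis unfolding Fs
      using Suc.prems Fs 0
      by (intro constructible_solvable_single[OF G]) (auto intro: Suc.hyps(1))
  next
    case (Suc l')
    obtain F Fs' where "Fs = F # Fs'" "length Fs' = Suc l'"
      using \<open>Suc l = length Fs\<close> Suc by (metis length_Suc_conv)
    then obtain F' Hs where Fs: "Fs = F # F' # Hs" and l: "l = Suc (length Hs)"
      using Suc by (metis length_Suc_conv)
    \<comment> \<open>Inner induction on the sum \<open>s\<close> of the formal degrees of the first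
      two equations: each branch either drops a leading coefficient or performs one Euclidean
      step.\<close>
    have *: "constructible I (\<lambda>x. B x \<and> solvable (F # F' # Hs) G x)"
      if "N + N' = s" "polycoeffs I F" "polycoeffs I F'" "degree_below B N F" "degree_below B N' F'"
        "degree_below B M G" "\<forall>F\<in>set Hs. polycoeffs I F \<and> (\<exists>N. degree_below B N F)" "constructible I B"
      for s N N' F F' B
      using that
    proof (induction s arbitrary: N N' F F' B rule: less_induct)
      case (less s)
      \<comment> \<open>The case in which the first equation has the smaller bound; the other one
        follows by exchanging the two equations.\<close>
      have *: "constructible I (\<lambda>x. B x \<and> solvable (F # F' # Hs) G x)"
        if NN: "N \<le> N'" "N + N' = s"
          and F: "polycoeffs I F" "polycoeffs I F'" "degree_below B N F" "degree_below B N' F'"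
        for N N' F F'
      proof (cases N)
        case 0
        then have "degree_below B 0 F" using F by simp
        then have "(\<lambda>x. B x \<and> solvable (F # F' # Hs) G x) = (\<lambda>x. B x \<and> solvable (F' # Hs) G x)"
          by (rule solvable_drop_zero)
        moreover have "constructible I (\<lambda>x. B x \<and> solvable (F' # Hs) G x)"
          by (rule Suc.hyps(1)) (use l F less.prems in auto)
        ultimately show ?thesis by simp
      next
        case N: (Suc d)
        then obtain e where N': "N' = Suc e" and de: "d \<le> e" using NN by (cases N') auto
        let ?c = "\<lambda>x. coeff (F x) d"
        have c: "polyfun I ?c" using F(1) by (simp add: polycoeffs_def)
        show ?thesis
        proof (rule constructible_cases[where f = ?c])
          have mono: "degree_below (\<lambda>x. B x \<and> ?c x = 0) N F" if "degree_below B N F" for N F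
            using that by (rule degree_below_mono) simp
          show "constructible I (\<lambda>x. (B x \<and> ?c x = 0) \<and> solvable (F # F' # Hs) G x)"
          proof (rule less.IH[of "d + N'" d N'])
            show "degree_below (\<lambda>x. B x \<and> ?c x = 0) d F"
              using F(3) N by (simp add: degree_below_cases)
            show "\<forall>F\<in>set Hs. polycoeffs I F \<and> (\<exists>N. degree_below (\<lambda>x. B x \<and> ?c x = 0) N F)"
              using less.prems(7) mono by blast
          qed (use NN N F c less.prems in \<open>auto intro!: mono constructible_conj constructible_zero\<close>)
          let ?B = "\<lambda>x. B x \<and> ?c x \<noteq> 0"
          have mono: "degree_below ?B N F" if "degree_below B N F" for N F
            using that by (rule degree_below_mono) simp
          \<comment> \<open>Where the leading coefficient of \<open>F\<close> is nonzero,
            \<open>F\<close> and \<open>H\<close> have the same common roots as \<open>F\<close> and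
            \<open>F'\<close>.\<close>
          define H where "H x = smult (coeff (F x) d) (F' x) - smult (coeff (F' x) e) (monom 1 (e - d) * F x)" for x
          have "constructible I (\<lambda>x. ?B x \<and> solvable (F # H # Hs) G x)"
          proof (rule less.IH[of "N + e" N e])
            show "polycoeffs I H" unfolding H_def by (rule polycoeffs_cross) fact+
            show "degree_below ?B e H"
              using F(3,4) N N' de unfolding degree_below_def H_def by (meson coeff_cross_zero)
            show "\<forall>F\<in>set Hs. polycoeffs I F \<and> (\<exists>N. degree_below ?B N F)"
              using less.prems(7) mono by blast
          qed (use NN N N' F c less.prems in \<open>auto intro!: mono constructible_conj constructible_nonzero\<close>)
          moreover have "(?B x \<and> solvable (F # H # Hs) G x) = (?B x \<and> solvable (F # F' # Hs) G x)" for x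
            by (auto simp: solvable_def H_def)
          ultimately show "constructible I (\<lambda>x. ?B x \<and> solvable (F # F' # Hs) G x)" by simp
        qed
      qed
      show ?case
      proof (cases "N \<le> N'")
        case True
        then show ?thesis using less.prems by (intro *) auto
      next
        case False
        then have "constructible I (\<lambda>x. B x \<and> solvable (F' # F # Hs) G x)"
          using less.prems by (intro *[of N' N]) auto
        moreover have "solvable (F' # F # Hs) G = solvable (F # F' # Hs) G"
          by (auto simp: solvable_def fun_eq_iff)
        ultimately show ?thesis by simp
      qed
    qed
    obtain N N' where "degree_below A N F" "degree_below A N' F'"
      using Suc.prems Fs by auto
    then show ?thesis unfolding Fs using Suc.prems Fs by (intro *[OF refl]) auto
  qed
qed


section \<open>Disjunctive normal forms and projection\<close>

lemma constructible_dnf_neg: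
  assumes "\<forall>(fs, g)\<in>set L. (\<forall>f\<in>set fs. polyfun I f) \<and> polyfun I g"
  shows "\<exists>L'. (\<forall>(fs, g)\<in>set L'. (\<forall>f\<in>set fs. polyfun I f) \<and> polyfun I g) \<and>
    (\<forall>x. (\<not> (\<exists>(fs, g)\<in>set L. (\<forall>f\<in>set fs. f x = 0) \<and> g x \<noteq> 0)) \<longleftrightarrow>
         (\<exists>(fs, g)\<in>set L'. (\<forall>f\<in>set fs. f x = 0) \<and> g x \<noteq> 0))"
  using assms
proof (induction L)
  case Nil
  show ?case by (rule exI[of _ "[([], \<lambda>_. 1)]"]) (auto intro: polyfun_const)
next
  case (Cons b L)
  obtain fs g where b: "b = (fs, g)" by (cases b)
  have fg: "\<forall>f\<in>set fs. polyfun I f" "polyfun I g" using Cons.prems b by auto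
  obtain L' where L': "\<forall>(fs, g)\<in>set L'. (\<forall>f\<in>set fs. polyfun I f) \<and> polyfun I g"
    "\<And>x. (\<not> (\<exists>(fs, g)\<in>set L. (\<forall>f\<in>set fs. f x = 0) \<and> g x \<noteq> 0)) \<longleftrightarrow>
         (\<exists>(fs, g)\<in>set L'. (\<forall>f\<in>set fs. f x = 0) \<and> g x \<noteq> 0)"
    using Cons by auto
  \<comment> \<open>A block fails if its inequation vanishes or one of its equations does not.
    Conjoined with a block of \<open>L'\<close>, the former adds \<open>g\<close> to the equations
    (\<open>L1\<close>) and the latter multiplies some \<open>f\<close> into the inequation
    (\<open>L2\<close>), so each block keeps a single inequation.\<close>
  define L1 where "L1 = map (\<lambda>(hs, h). (g # hs, h)) L'"
  define L2 where "L2 = concat (map (\<lambda>f. map (\<lambda>(hs, h). (hs, \<lambda>x. f x * h x)) L') fs)"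
  have pf: "\<forall>(fs, g)\<in>set (L1 @ L2). (\<forall>f\<in>set fs. polyfun I f) \<and> polyfun I g"
    using L'(1) fg by (fastforce simp: L1_def L2_def split_beta intro!: polyfun_mult)
  have L1: "(\<exists>(fs, g)\<in>set L1. (\<forall>f\<in>set fs. f x = 0) \<and> g x \<noteq> 0) \<longleftrightarrow>
     g x = 0 \<and> (\<exists>(fs, g)\<in>set L'. (\<forall>f\<in>set fs. f x = 0) \<and> g x \<noteq> 0)" for x
    by (auto simp: L1_def split_beta)
  have L2: "(\<exists>(fs, g)\<in>set L2. (\<forall>f\<in>set fs. f x = 0) \<and> g x \<noteq> 0) \<longleftrightarrow>
     (\<exists>f\<in>set fs. f x \<noteq> 0) \<and> (\<exists>(fs, g)\<in>set L'. (\<forall>f\<in>set fs. f x = 0) \<and> g x \<noteq> 0)" for x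
    by (auto simp: L2_def split_beta)
  have "(\<not> (\<exists>(fs, g)\<in>set (b # L). (\<forall>f\<in>set fs. f x = 0) \<and> g x \<noteq> 0)) \<longleftrightarrow>
         (\<exists>(fs, g)\<in>set (L1 @ L2). (\<forall>f\<in>set fs. f x = 0) \<and> g x \<noteq> 0)" for x
  proof -
    have "(\<exists>(fs, g)\<in>set (L1 @ L2). (\<forall>f\<in>set fs. f x = 0) \<and> g x \<noteq> 0) \<longleftrightarrow>
        (g x = 0 \<or> (\<exists>f\<in>set fs. f x \<noteq> 0)) \<and> \<not> (\<exists>(fs, g)\<in>set L. (\<forall>f\<in>set fs. f x = 0) \<and> g x \<noteq> 0)"
      unfolding set_append bex_Un L1 L2 L'(2) by blast
    then show ?thesis by (simp add: b) blast
  qed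
  with pf show ?case by blast
qed

text \<open>Blocks of several equations and one inequation are exactly what \<open>solvable\<close>
  handles. The conjunction of two blocks concatenates the equations and multiplies the
  inequations.\<close>

lemma constructible_dnf:
  assumes "constructible I P"
  shows "\<exists>L. (\<forall>(fs, g)\<in>set L. (\<forall>f\<in>set fs. polyfun I f) \<and> polyfun I g) \<and>
    (\<forall>x. P x \<longleftrightarrow> (\<exists>(fs, g)\<in>set L. (\<forall>f\<in>set fs. f x = 0) \<and> g x \<noteq> 0))"
  using assms
proof (induction rule: constructible.induct)
  case (constructible_zero f)
  then show ?case by (intro exI[of _ "[([f], \<lambda>_. 1)]"]) (auto intro: polyfun_const)
next
  case (constructible_not P)
  then obtain L where L: "\<forall>(fs, g)\<in>set L. (\<forall>f\<in>set fs. polyfun I f) \<and> polyfun I g"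
    "\<And>x. P x \<longleftrightarrow> (\<exists>(fs, g)\<in>set L. (\<forall>f\<in>set fs. f x = 0) \<and> g x \<noteq> 0)" by blast
  show ?case unfolding L(2) by (rule constructible_dnf_neg[OF L(1)])
next
  case (constructible_conj P Q)
  then obtain L M where L: "\<forall>(fs, g)\<in>set L. (\<forall>f\<in>set fs. polyfun I f) \<and> polyfun I g"
    "\<And>x. P x \<longleftrightarrow> (\<exists>(fs, g)\<in>set L. (\<forall>f\<in>set fs. f x = 0) \<and> g x \<noteq> 0)"
    and M: "\<forall>(fs, g)\<in>set M. (\<forall>f\<in>set fs. polyfun I f) \<and> polyfun I g"
    "\<And>x. Q x \<longleftrightarrow> (\<exists>(fs, g)\<in>set M. (\<forall>f\<in>set fs. f x = 0) \<and> g x \<noteq> 0)" by blast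
  define N where "N = concat (map (\<lambda>(fs, g). map (\<lambda>(hs, h). (fs @ hs, \<lambda>x. g x * h x)) M) L)"
  have "\<forall>(fs, g)\<in>set N. (\<forall>f\<in>set fs. polyfun I f) \<and> polyfun I g"
    using L(1) M(1) by (fastforce simp: N_def split_beta intro!: polyfun_mult)
  moreover have "P x \<and> Q x \<longleftrightarrow> (\<exists>(fs, g)\<in>set N. (\<forall>f\<in>set fs. f x = 0) \<and> g x \<noteq> 0)" for x
    unfolding L(2) M(2) by (auto simp: N_def split_beta ball_Un)
  ultimately show ?case by blast
qed

lemma polyfun_as_poly:
  assumes "polyfun (insert v I) f"
  shows "\<exists>F N. polycoeffs I F \<and> degree_below (\<lambda>_. True) N F \<and> (\<forall>x y. f (x(v := y)) = poly (F x) y)"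
  using assms
proof (induction rule: polyfun.induct)
  case (polyfun_const c)
  have "polycoeffs I (\<lambda>x. [:c:])" by (auto simp: polycoeffs_def intro: polyfun.polyfun_const)
  moreover have "degree_below (\<lambda>_. True) 1 (\<lambda>x. [:c:])"
    by (auto simp: degree_below_def coeff_pCons split: nat.split)
  ultimately show ?case by fastforce
next
  case (polyfun_var u)
  show ?case
  proof (cases "u = v")
    case True
    have "polycoeffs I (\<lambda>x. [:0, 1:])" by (auto simp: polycoeffs_def intro: polyfun.polyfun_const)
    moreover have "degree_below (\<lambda>_. True) 2 (\<lambda>x. [:0, 1:])"
      by (auto simp: degree_below_def coeff_pCons split: nat.split)
    ultimately show ?thesis using True by fastforce
  next
    case False
    then have u: "u \<in> I" using polyfun_var by auto
    have "polycoeffs I (\<lambda>x. [:x u:])"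
      unfolding polycoeffs_def
    proof
      fix k show "polyfun I (\<lambda>x. coeff [:x u:] k)"
        by (cases k) (auto intro: polyfun.polyfun_const polyfun.polyfun_var u)
    qed
    moreover have "degree_below (\<lambda>_. True) 1 (\<lambda>x. [:x u:])"
      by (auto simp: degree_below_def coeff_pCons split: nat.split)
    ultimately show ?thesis using False by fastforce
  qed
next
  case (polyfun_add f g)
  then obtain F N G M where F: "polycoeffs I F" "degree_below (\<lambda>_. True) N F" "\<forall>x y. f (x(v := y)) = poly (F x) y"
    and G: "polycoeffs I G" "degree_below (\<lambda>_. True) M G" "\<forall>x y. g (x(v := y)) = poly (G x) y" by blast
  have "polycoeffs I (\<lambda>x. F x + G x)"
    using F(1) G(1) by (auto simp: polycoeffs_def intro: polyfun.polyfun_add)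
  moreover have "degree_below (\<lambda>_. True) (max N M) (\<lambda>x. F x + G x)"
    using F(2) G(2) by (auto simp: degree_below_def)
  moreover have "\<forall>x y. f (x(v := y)) + g (x(v := y)) = poly (F x + G x) y"
    using F(3) G(3) by (simp del: fun_upd_apply)
  ultimately show ?case by blast
next
  case (polyfun_mult f g)
  then obtain F N G M where F: "polycoeffs I F" "degree_below (\<lambda>_. True) N F" "\<forall>x y. f (x(v := y)) = poly (F x) y"
    and G: "polycoeffs I G" "degree_below (\<lambda>_. True) M G" "\<forall>x y. g (x(v := y)) = poly (G x) y" by blast
  have "degree_below (\<lambda>_. True) (N + M) (\<lambda>x. F x * G x)"
    unfolding degree_below_def
  proof (intro allI impI)
    fix x k assume k: "N + M \<le> k"
    have "coeff (F x) i * coeff (G x) (k - i) = 0" if "i \<le> k" for i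
    proof (cases "N \<le> i")
      case True
      then show ?thesis using F(2) by (simp add: degree_below_def)
    next
      case False
      then have "M \<le> k - i" using k by simp
      then show ?thesis using G(2) by (simp add: degree_below_def)
    qed
    then show "coeff (F x * G x) k = 0"
      unfolding coeff_mult by (intro sum.neutral ballI) (simp only: atMost_iff)
  qed
  moreover have "\<forall>x y. f (x(v := y)) * g (x(v := y)) = poly (F x * G x) y"
    using F(3) G(3) by (simp del: fun_upd_apply)
  ultimately show ?case using polycoeffs_mult[OF F(1) G(1)] by blast
qed

lemma constructible_Ex_single:
  assumes "constructible (insert v I) P"
  shows "constructible I (\<lambda>x. \<exists>y. P (x(v := y)))"
proof -
  obtain L where L: "\<And>fs g. (fs, g) \<in> set L \<Longrightarrow> (\<forall>f\<in>set fs. polyfun (insert v I) f) \<and> polyfun (insert v I) g"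
    "\<And>x. P x \<longleftrightarrow> (\<exists>(fs, g)\<in>set L. (\<forall>f\<in>set fs. f x = 0) \<and> g x \<noteq> 0)"
    using constructible_dnf[OF assms] by blast
  define rep where "rep f F \<longleftrightarrow> polycoeffs I F \<and> (\<exists>N. degree_below (\<lambda>_. True) N F)
      \<and> (\<forall>x y. f (x(v := y)) = poly (F x) y)" for f F
  have "\<exists>F. rep f F" if "polyfun (insert v I) f" for f
    using polyfun_as_poly[OF that] unfolding rep_def by blast
  then obtain Q where Q': "\<And>f. polyfun (insert v I) f \<Longrightarrow> rep f (Q f)" by metis
  note Q = Q'[unfolded rep_def]
  have "constructible I (\<lambda>x. True \<and> solvable (map Q fs) (Q g) x)" if mem: "(fs, g) \<in> set L" for fs g
  proof -
    obtain M where "degree_below (\<lambda>_. True) M (Q g)" using Q L(1)[OF mem] by blast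
    then show ?thesis
      using L(1)[OF mem] Q by (intro constructible_solvable constructible_True) auto
  qed
  then have "constructible I (\<lambda>x. \<exists>b\<in>set L. solvable (map Q (fst b)) (Q (snd b)) x)"
    by (intro constructible_bex) auto
  moreover have "(\<exists>b\<in>set L. solvable (map Q (fst b)) (Q (snd b)) x) \<longleftrightarrow> (\<exists>y. P (x(v := y)))" for x
  proof -
    have "solvable (map Q fs) (Q g) x \<longleftrightarrow> (\<exists>y. (\<forall>f\<in>set fs. f (x(v := y)) = 0) \<and> g (x(v := y)) \<noteq> 0)"
      if "(fs, g) \<in> set L" for fs g
      using L(1)[OF that] Q by (simp add: solvable_def)
    then have "(\<exists>b\<in>set L. solvable (map Q (fst b)) (Q (snd b)) x) \<longleftrightarrow>
        (\<exists>(fs, g)\<in>set L. \<exists>y. (\<forall>f\<in>set fs. f (x(v := y)) = 0) \<and> g (x(v := y)) \<noteq> 0)"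
      by (intro bex_cong refl) (auto simp: split_beta simp del: fun_upd_apply)
    then show ?thesis unfolding L(2) by (auto simp: split_beta simp del: fun_upd_apply)
  qed
  ultimately show ?thesis by simp
qed

theorem constructible_Ex:
  assumes "finite V" "constructible (I \<union> V) P"
  shows "constructible I (\<lambda>x. \<exists>y. P (\<lambda>v. if v \<in> V then y v else x v))"
  using assms
proof (induction V arbitrary: P rule: finite_induct)
  case empty
  then show ?case by simp
next
  case (insert v V)
  then have "constructible (I \<union> V) (\<lambda>x. \<exists>a. P (x(v := a)))"
    by (intro constructible_Ex_single) simp
  then have "constructible I (\<lambda>x. \<exists>y. \<exists>a. P ((\<lambda>u. if u \<in> V then y u else x u)(v := a)))"
    by (rule insert.IH)
  moreover have "(\<exists>y. \<exists>a. P ((\<lambda>u. if u \<in> V then y u else x u)(v := a))) \<longleftrightarrow>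
      (\<exists>y. P (\<lambda>u. if u \<in> insert v V then y u else x u))" for x
  proof
    assume "\<exists>y. \<exists>a. P ((\<lambda>u. if u \<in> V then y u else x u)(v := a))"
    then obtain y a where "P ((\<lambda>u. if u \<in> V then y u else x u)(v := a))" by blast
    moreover have "(\<lambda>u. if u \<in> V then y u else x u)(v := a)
        = (\<lambda>u. if u \<in> insert v V then (y(v := a)) u else x u)" by auto
    ultimately show "\<exists>y. P (\<lambda>u. if u \<in> insert v V then y u else x u)" by metis
  next
    assume "\<exists>y. P (\<lambda>u. if u \<in> insert v V then y u else x u)"
    then obtain y where "P (\<lambda>u. if u \<in> insert v V then y u else x u)" by blast
    moreover have "(\<lambda>u. if u \<in> insert v V then y u else x u) = (\<lambda>u. if u \<in> V then y u else x u)(v := y v)"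
      by auto
    ultimately show "\<exists>y. \<exists>a. P ((\<lambda>u. if u \<in> V then y u else x u)(v := a))" by metis
  qed
  ultimately show ?case by simp
qed

section \<open>Generic behaviour of constructible sets\<close>

lemma polyfun_on_line:
  assumes "polyfun I f"
  shows "\<exists>p. \<forall>t. f (\<lambda>v. a v + t * b v) = poly p t"
  using assms
proof (induction rule: polyfun.induct)
  case (polyfun_const c)
  show ?case by (rule exI[of _ "[:c:]"]) simp
next
  case (polyfun_var v)
  show ?case by (rule exI[of _ "[:a v, b v:]"]) simp
next
  case (polyfun_add f g)
  then obtain p q where "\<forall>t. f (\<lambda>v. a v + t * b v) = poly p t" "\<forall>t. g (\<lambda>v. a v + t * b v) = poly q t"
    by blast
  then show ?case by (intro exI[of _ "p + q"]) simp
next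
  case (polyfun_mult f g)
  then obtain p q where "\<forall>t. f (\<lambda>v. a v + t * b v) = poly p t" "\<forall>t. g (\<lambda>v. a v + t * b v) = poly q t"
    by blast
  then show ?case by (intro exI[of _ "p * q"]) simp
qed

text \<open>Irreducibility of affine space, seen on the line from \<open>x\<close> to
  \<open>y\<close>: there \<open>f\<close> and \<open>g\<close> become univariate polynomials that
  are nonzero at 0 and at 1 respectively, so their product is a nonzero polynomial and has a
  non-root.\<close>

lemma polyfun_mult_nonzero:
  assumes f: "polyfun I f" "f x \<noteq> 0" and g: "polyfun I g" "g y \<noteq> 0"
  shows "\<exists>z. f z * g z \<noteq> 0"
proof -
  obtain p where p: "\<And>t. f (\<lambda>v. x v + t * (y v - x v)) = poly p t"
    using polyfun_on_line[OF f(1), of x "\<lambda>v. y v - x v"] by blast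
  obtain q where q: "\<And>t. g (\<lambda>v. x v + t * (y v - x v)) = poly q t"
    using polyfun_on_line[OF g(1), of x "\<lambda>v. y v - x v"] by blast
  have "poly p 0 \<noteq> 0" using p[of 0] f(2) by simp
  moreover have "poly q 1 \<noteq> 0" using q[of 1] g(2) by simp
  ultimately have "p * q \<noteq> 0" by auto
  then obtain t where "poly (p * q) t \<noteq> 0" using poly_all_0_iff_0 by blast
  then show ?thesis using p[of t] q[of t] by (metis poly_mult)
qed

text \<open>The dichotomy follows the construction of \<open>P\<close>: a nonzero polynomial is its
  own witness, a complement swaps the alternatives, and for an intersection the two witnesses are
  multiplied.\<close>

lemma constructible_generically_constant:
  assumes "constructible I P"
  shows "\<exists>f. polyfun I f \<and> (\<exists>x. f x \<noteq> 0) \<and> ((\<forall>x. f x \<noteq> 0 \<longrightarrow> P x) \<or> (\<forall>x. f x \<noteq> 0 \<longrightarrow> \<not> P x))"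
  using assms
proof (induction rule: constructible.induct)
  case (constructible_zero f)
  show ?case
  proof (cases "\<exists>x. f x \<noteq> 0")
    case True
    then show ?thesis using constructible_zero by blast
  next
    case False
    then show ?thesis by (intro exI[of _ "\<lambda>_. 1"]) (auto intro: polyfun_const)
  qed
next
  case (constructible_not P)
  then show ?case by auto
next
  case (constructible_conj P Q)
  then obtain f g where f: "polyfun I f" "\<exists>x. f x \<noteq> 0" "(\<forall>x. f x \<noteq> 0 \<longrightarrow> P x) \<or> (\<forall>x. f x \<noteq> 0 \<longrightarrow> \<not> P x)"
    and g: "polyfun I g" "\<exists>x. g x \<noteq> 0" "(\<forall>x. g x \<noteq> 0 \<longrightarrow> Q x) \<or> (\<forall>x. g x \<noteq> 0 \<longrightarrow> \<not> Q x)"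
    by blast
  have "\<exists>z. f z * g z \<noteq> 0" using polyfun_mult_nonzero f(1,2) g(1,2) by metis
  then show ?case
    using polyfun_mult[OF f(1) g(1)] f(3) g(3) by (intro exI[of _ "\<lambda>x. f x * g x"]) auto
qed

section \<open>Polynomial functions as evaluations of \<open>cpoly\<close>\<close>

lemma cpoly_eval_superset:
  assumes "finite K" "Poly_Mapping.keys p \<subseteq> K"
  shows "cpoly_eval p x = (\<Sum>\<mu>\<in>K. Poly_Mapping.lookup p \<mu> * (\<Prod>v\<in>Poly_Mapping.keys \<mu>. x v ^ Poly_Mapping.lookup \<mu> v))"
  unfolding cpoly_eval_def using assms
  by (intro sum.mono_neutral_left) (auto simp: in_keys_iff)

lemma cpoly_eval_add: "cpoly_eval (p + q) x = cpoly_eval p x + cpoly_eval q x"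
proof -
  let ?K = "Poly_Mapping.keys p \<union> Poly_Mapping.keys q"
  have "cpoly_eval (p + q) x = (\<Sum>\<mu>\<in>?K. Poly_Mapping.lookup (p + q) \<mu> * (\<Prod>v\<in>Poly_Mapping.keys \<mu>. x v ^ Poly_Mapping.lookup \<mu> v))"
    using Poly_Mapping.keys_add[of p q] by (intro cpoly_eval_superset) auto
  also have "\<dots> = cpoly_eval p x + cpoly_eval q x"
    by (simp add: lookup_add distrib_right sum.distrib cpoly_eval_superset[of ?K])
  finally show ?thesis .
qed

lemma cpoly_vars_add: "cpoly_vars (p + q) \<subseteq> cpoly_vars p \<union> cpoly_vars q"
  using Poly_Mapping.keys_add[of p q] by (auto simp: cpoly_vars_def)

definition is_cpoly :: "'v set \<Rightarrow> (('v \<Rightarrow> complex) \<Rightarrow> complex) \<Rightarrow> bool" where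
  "is_cpoly I f \<longleftrightarrow> (\<exists>p. cpoly_vars p \<subseteq> I \<and> (\<forall>x. cpoly_eval p x = f x))"

lemma is_cpoly_add: "is_cpoly I f \<Longrightarrow> is_cpoly I g \<Longrightarrow> is_cpoly I (\<lambda>x. f x + g x)"
  unfolding is_cpoly_def by (metis cpoly_eval_add cpoly_vars_add order.trans Un_least)

lemma is_cpoly_zero: "is_cpoly I (\<lambda>x. 0)"
  unfolding is_cpoly_def by (intro exI[of _ 0]) (auto simp: cpoly_vars_def cpoly_eval_def)

lemma is_cpoly_sum: "(\<And>s. s \<in> S \<Longrightarrow> is_cpoly I (f s)) \<Longrightarrow> is_cpoly I (\<lambda>x. \<Sum>s\<in>S. f s x)"
  by (induction S rule: infinite_finite_induct) (auto intro: is_cpoly_zero is_cpoly_add)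

lemma is_cpoly_monomial:
  assumes "Poly_Mapping.keys \<mu> \<subseteq> I"
  shows "is_cpoly I (\<lambda>x. c * (\<Prod>v\<in>Poly_Mapping.keys \<mu>. x v ^ Poly_Mapping.lookup \<mu> v))"
  unfolding is_cpoly_def
  by (rule exI[of _ "Poly_Mapping.single \<mu> c"]) (use assms in \<open>auto simp: cpoly_vars_def cpoly_eval_def\<close>)

lemma monomial_add:
  fixes x :: "'v \<Rightarrow> complex"
  shows "(\<Prod>v\<in>Poly_Mapping.keys (\<mu> + \<nu>). x v ^ Poly_Mapping.lookup (\<mu> + \<nu>) v)
    = (\<Prod>v\<in>Poly_Mapping.keys \<mu>. x v ^ Poly_Mapping.lookup \<mu> v) * (\<Prod>v\<in>Poly_Mapping.keys \<nu>. x v ^ Poly_Mapping.lookup \<nu> v)"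
proof -
  let ?K = "Poly_Mapping.keys \<mu> \<union> Poly_Mapping.keys \<nu>"
  have *: "(\<Prod>v\<in>Poly_Mapping.keys \<rho>. x v ^ Poly_Mapping.lookup \<rho> v) = (\<Prod>v\<in>?K. x v ^ Poly_Mapping.lookup \<rho> v)"
    if "Poly_Mapping.keys \<rho> \<subseteq> ?K" for \<rho> :: "'v \<Rightarrow>\<^sub>0 nat"
    using that by (intro prod.mono_neutral_left) (auto simp: in_keys_iff)
  have "(\<Prod>v\<in>Poly_Mapping.keys (\<mu> + \<nu>). x v ^ Poly_Mapping.lookup (\<mu> + \<nu>) v)
      = (\<Prod>v\<in>?K. x v ^ Poly_Mapping.lookup (\<mu> + \<nu>) v)"
    by (rule *) (rule Poly_Mapping.keys_add)
  also have "\<dots> = (\<Prod>v\<in>?K. x v ^ Poly_Mapping.lookup \<mu> v) * (\<Prod>v\<in>?K. x v ^ Poly_Mapping.lookup \<nu> v)"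
    by (simp add: lookup_add power_add prod.distrib)
  finally show ?thesis by (simp add: *)
qed

lemma is_cpoly_mult:
  assumes "is_cpoly I f" "is_cpoly I g"
  shows "is_cpoly I (\<lambda>x. f x * g x)"
proof -
  obtain p q where p: "cpoly_vars p \<subseteq> I" "\<And>x. cpoly_eval p x = f x"
    and q: "cpoly_vars q \<subseteq> I" "\<And>x. cpoly_eval q x = g x"
    using assms unfolding is_cpoly_def by blast
  have "is_cpoly I (\<lambda>x. \<Sum>\<mu>\<in>Poly_Mapping.keys p. \<Sum>\<nu>\<in>Poly_Mapping.keys q.
      (Poly_Mapping.lookup p \<mu> * Poly_Mapping.lookup q \<nu>) *
      (\<Prod>v\<in>Poly_Mapping.keys (\<mu> + \<nu>). x v ^ Poly_Mapping.lookup (\<mu> + \<nu>) v))"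
  proof (intro is_cpoly_sum is_cpoly_monomial)
    fix \<mu> \<nu> assume "\<mu> \<in> Poly_Mapping.keys p" "\<nu> \<in> Poly_Mapping.keys q"
    then show "Poly_Mapping.keys (\<mu> + \<nu>) \<subseteq> I"
      using p(1) q(1) Poly_Mapping.keys_add[of \<mu> \<nu>] unfolding cpoly_vars_def by blast
  qed
  then show ?thesis
    unfolding p(2)[symmetric] q(2)[symmetric] cpoly_eval_def monomial_add sum_product
    by (simp add: mult_ac)
qed

lemma polyfun_is_cpoly: "polyfun I f \<Longrightarrow> is_cpoly I f"
proof (induction rule: polyfun.induct)
  case (polyfun_const c)
  show ?case using is_cpoly_monomial[of 0 I c] by simp
next
  case (polyfun_var v)
  then show ?case using is_cpoly_monomial[of "Poly_Mapping.single v 1" I 1] by simp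
qed (auto intro: is_cpoly_add is_cpoly_mult)

section \<open>Compactness and the layer-cake inequality\<close>

text \<open>Bolzano-Weierstrass, extracting a subsequence coordinate by coordinate. Vectors are
  plain functions on a finite index set in this development, hence convergence is entrywise.\<close>

lemma bounded_family_convergent_subseq:
  fixes f :: "nat \<Rightarrow> 'i \<Rightarrow> complex"
  assumes "finite I" and bound: "\<And>k i. i \<in> I \<Longrightarrow> cmod (f k i) \<le> B"
  shows "\<exists>r l. strict_mono (r :: nat \<Rightarrow> nat) \<and> (\<forall>i\<in>I. (\<lambda>k. f (r k) i) \<longlonglongrightarrow> l i)"
  using assms
proof (induction I rule: finite_induct)
  case empty
  then show ?case by (intro exI[of _ id]) (auto simp: strict_mono_def)
next
  case (insert i I)
  then obtain r l where r: "strict_mono (r :: nat \<Rightarrow> nat)" "\<And>i. i \<in> I \<Longrightarrow> (\<lambda>k. f (r k) i) \<longlonglongrightarrow> l i"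
    by (metis insertCI)
  have "bounded (range (\<lambda>k. f (r k) i))"
    unfolding bounded_iff using insert.prems by auto
  then obtain a s where s: "strict_mono (s :: nat \<Rightarrow> nat)" "((\<lambda>k. f (r k) i) \<circ> s) \<longlonglongrightarrow> a"
    using bounded_imp_convergent_subsequence by metis
  have "(\<lambda>k. f ((r \<circ> s) k) j) \<longlonglongrightarrow> (l(i := a)) j" if "j \<in> insert i I" for j
  proof (cases "j = i")
    case True
    then show ?thesis using s(2) by (simp add: o_def)
  next
    case False
    then have "(\<lambda>k. f (r k) j) \<longlonglongrightarrow> l j" using r(2) that by auto
    from LIMSEQ_subseq_LIMSEQ[OF this s(1)] show ?thesis using False by (simp add: o_def)
  qed
  moreover have "strict_mono (r \<circ> s)" using r(1) s(1) by (rule strict_mono_o)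
  ultimately show ?case by blast
qed

text \<open>The layer-cake argument. \<open>hall\<close> says that vertex sets without edges between
  them have total weight at most the common total \<open>\<tau>\<close>. For each threshold
  \<open>s\<close>, the level sets \<open>x a >= s\<close> and \<open>y b - K >= - s\<close> have no
  edge between them, since an edge forces \<open>x a + y b < K\<close>. Integrating the resulting
  bound over \<open>s\<close> gives the claim.\<close>

lemma weighted_sum_bound:
  fixes x :: "'a \<Rightarrow> real" and y :: "'b \<Rightarrow> real"
  assumes fin: "finite A" "finite B"
    and w: "\<And>a. a \<in> A \<Longrightarrow> 0 \<le> w a" "sum w A = \<tau>"
    and w': "\<And>b. b \<in> B \<Longrightarrow> 0 \<le> w' b" "sum w' B = \<tau>"
    and hall: "\<And>S S'. S \<subseteq> A \<Longrightarrow> S' \<subseteq> B \<Longrightarrow> (\<forall>a\<in>S. \<forall>b\<in>S'. \<not> E a b) \<Longrightarrow> sum w S + sum w' S' \<le> \<tau>"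
    and E: "\<And>a b. a \<in> A \<Longrightarrow> b \<in> B \<Longrightarrow> E a b \<Longrightarrow> x a + y b < K"
  shows "(\<Sum>a\<in>A. w a * x a) + (\<Sum>b\<in>B. w' b * y b) \<le> K * \<tau>"
proof -
  \<comment> \<open>Shifting by \<open>K\<close> turns the edge condition into
    \<open>x a + z b < 0\<close>. The window from \<open>-M\<close> to \<open>M\<close> contains
    every threshold at which a level set changes, so each indicator integrates to an affine function
    of \<open>x a\<close> or \<open>z b\<close>.\<close>
  define z where "z b = y b - K" for b
  define M where "M = (\<Sum>a\<in>A. \<bar>x a\<bar>) + (\<Sum>b\<in>B. \<bar>z b\<bar>)"
  have Mx: "\<bar>x a\<bar> \<le> M" if "a \<in> A" for a
    unfolding M_def using that fin
    by (intro add_increasing2 sum_nonneg member_le_sum) auto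
  have Mz: "\<bar>z b\<bar> \<le> M" if "b \<in> B" for b
    unfolding M_def using that fin
    by (intro add_increasing sum_nonneg member_le_sum) auto
  have M0: "0 \<le> M" unfolding M_def by (intro add_nonneg_nonneg sum_nonneg) auto
  define f where "f a s = (if s \<in> {-M..x a} then w a else 0)" for a s
  define g where "g b s = (if s \<in> {- z b..M} then w' b else 0)" for b s
  have f: "(f a has_integral (x a + M) * w a) {-M..M}" if "a \<in> A" for a
  proof -
    have "- M \<le> x a" using Mx[OF that] by linarith
    then have "((\<lambda>s. w a) has_integral (x a + M) * w a) {-M..x a}"
      using has_integral_const_real[of "w a" "-M" "x a"] \<open>- M \<le> x a\<close> by simp
    then show ?thesis unfolding f_def
      by (subst has_integral_restrict) (use Mx[OF that] in auto)
  qed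
  have g: "(g b has_integral (M + z b) * w' b) {-M..M}" if "b \<in> B" for b
  proof -
    have "- z b \<le> M" using Mz[OF that] by linarith
    then have "((\<lambda>s. w' b) has_integral (M + z b) * w' b) {- z b..M}"
      using has_integral_const_real[of "w' b" "- z b" M] \<open>- z b \<le> M\<close> by simp
    then show ?thesis unfolding g_def
      by (subst has_integral_restrict) (use Mz[OF that] in auto)
  qed
  have fg: "((\<lambda>s. (\<Sum>a\<in>A. f a s) + (\<Sum>b\<in>B. g b s)) has_integral
      (\<Sum>a\<in>A. (x a + M) * w a) + (\<Sum>b\<in>B. (M + z b) * w' b)) {-M..M}"
    by (intro has_integral_add has_integral_sum fin f g)
  have const: "((\<lambda>s. \<tau>) has_integral (2 * M * \<tau>)) {-M..M}"
    using has_integral_const_real[of \<tau> "-M" M] M0 by simp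
  have "(\<Sum>a\<in>A. (x a + M) * w a) + (\<Sum>b\<in>B. (M + z b) * w' b) \<le> 2 * M * \<tau>"
  proof (rule has_integral_le[OF fg const])
    fix s assume s: "s \<in> {-M..M}"
    let ?S = "{a \<in> A. s \<le> x a}" and ?S' = "{b \<in> B. - z b \<le> s}"
    have "(\<Sum>a\<in>A. f a s) = sum w ?S"
      unfolding f_def using s fin by (subst sum.inter_filter) (auto intro!: sum.cong)
    moreover have "(\<Sum>b\<in>B. g b s) = sum w' ?S'"
      unfolding g_def using s fin by (subst sum.inter_filter) (auto intro!: sum.cong)
    moreover have "sum w ?S + sum w' ?S' \<le> \<tau>"
    proof (rule hall)
      show "\<forall>a\<in>?S. \<forall>b\<in>?S'. \<not> E a b"
        using E by (fastforce simp: z_def)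
    qed auto
    ultimately show "(\<Sum>a\<in>A. f a s) + (\<Sum>b\<in>B. g b s) \<le> \<tau>" by simp
  qed
  moreover have "(\<Sum>a\<in>A. (x a + M) * w a) = (\<Sum>a\<in>A. w a * x a) + M * \<tau>"
    by (simp add: algebra_simps sum.distrib w(2)[symmetric] sum_distrib_left)
  moreover have "(\<Sum>b\<in>B. (M + z b) * w' b) = (\<Sum>b\<in>B. w' b * y b) - K * \<tau> + M * \<tau>"
    by (simp add: z_def algebra_simps sum.distrib sum_subtractf w'(2)[symmetric] sum_distrib_left)
  ultimately show ?thesis by (simp add: algebra_simps)
qed

lemma rpow_nonneg [simp]: "0 \<le> rpow x s" by (simp add: rpow_def)

lemma rpow_mono: "0 \<le> x \<Longrightarrow> x \<le> y \<Longrightarrow> 0 \<le> s \<Longrightarrow> rpow x s \<le> rpow y s"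
  by (auto simp: rpow_def intro: powr_mono2)

lemma rpow_mult: "0 \<le> x \<Longrightarrow> 0 \<le> y \<Longrightarrow> rpow (x * y) s = rpow x s * rpow y s"
  by (auto simp: rpow_def powr_mult)

lemma rpow_eq_exp: "0 < x \<Longrightarrow> rpow x s = exp (s * ln x)"
  by (auto simp: rpow_def powr_def)

section \<open>The spectral theorem\<close>

definition cip :: "nat \<Rightarrow> (nat \<Rightarrow> complex) \<Rightarrow> (nat \<Rightarrow> complex) \<Rightarrow> complex" where
  "cip k x y = (\<Sum>i<k. cnj (x i) * y i)"

definition nsq :: "nat \<Rightarrow> (nat \<Rightarrow> complex) \<Rightarrow> real" where
  "nsq k x = (\<Sum>i<k. (cmod (x i))\<^sup>2)"

definition orthonormal :: "nat \<Rightarrow> ('i \<Rightarrow> nat \<Rightarrow> complex) \<Rightarrow> 'i set \<Rightarrow> bool" where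
  "orthonormal k U I \<longleftrightarrow> (\<forall>i\<in>I. \<forall>j\<in>I. cip k (U i) (U j) = (if i = j then 1 else 0))"

lemma cip_self: "cip k x x = of_real (nsq k x)"
  by (simp add: cip_def nsq_def complex_norm_square mult.commute del: of_real_power)

lemma cip_cnj: "cnj (cip k x y) = cip k y x"
  by (simp add: cip_def mult.commute)

lemma cip_add_right: "cip k x (\<lambda>i. y i + z i) = cip k x y + cip k x z"
  by (simp add: cip_def distrib_left sum.distrib)

lemma cip_add_left: "cip k (\<lambda>i. y i + z i) x = cip k y x + cip k z x"
  by (simp add: cip_def distrib_right sum.distrib)

lemma cip_diff_right: "cip k x (\<lambda>i. y i - z i) = cip k x y - cip k x z"
  by (simp add: cip_def right_diff_distrib sum_subtractf)

lemma cip_diff_left: "cip k (\<lambda>i. y i - z i) x = cip k y x - cip k z x"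
  by (simp add: cip_def left_diff_distrib sum_subtractf)

lemma cip_scale_right: "cip k x (\<lambda>i. c * y i) = c * cip k x y"
  by (simp add: cip_def sum_distrib_left mult_ac)

lemma cip_scale_left: "cip k (\<lambda>i. c * x i) y = cnj c * cip k x y"
  by (simp add: cip_def sum_distrib_left mult_ac)

lemma cip_sum_right: "cip k x (\<lambda>i. \<Sum>s\<in>S. y s i) = (\<Sum>s\<in>S. cip k x (y s))"
  by (simp add: cip_def sum_distrib_left sum.swap[of _ S])

lemma cip_sum_left: "cip k (\<lambda>i. \<Sum>s\<in>S. y s i) x = (\<Sum>s\<in>S. cip k (y s) x)"
  by (simp add: cip_def sum_distrib_right sum.swap[of _ S])

lemma nsq_nonneg [simp]: "0 \<le> nsq k x" by (simp add: nsq_def sum_nonneg)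

lemma nsq_eq_0: "nsq k x = 0 \<Longrightarrow> i < k \<Longrightarrow> x i = 0"
  by (auto simp: nsq_def sum_nonneg_eq_0_iff)

lemma nsq_Re_cip: "nsq k x = Re (cip k x x)" by (simp add: cip_self)

lemma component_le_nsq: "i < k \<Longrightarrow> (cmod (x i))\<^sup>2 \<le> nsq k x"
  unfolding nsq_def by (rule member_le_sum) auto

lemma orthonormal_cmod_le: assumes "orthonormal k U I" "i \<in> I" "a < k" shows "cmod (U i a) \<le> 1"
proof -
  have "nsq k (U i) = 1"
    using assms by (simp add: orthonormal_def nsq_Re_cip)
  then have "(cmod (U i a))\<^sup>2 \<le> 1" using component_le_nsq[OF assms(3), of "U i"] by simp
  then show ?thesis by (simp add: power_le_one_iff abs_square_le_1)
qed

lemma cip_tendsto: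
  assumes "\<And>i. i < k \<Longrightarrow> (\<lambda>n. x n i) \<longlonglongrightarrow> a i" "\<And>i. i < k \<Longrightarrow> (\<lambda>n. y n i) \<longlonglongrightarrow> b i"
  shows "(\<lambda>n. cip k (x n) (y n)) \<longlonglongrightarrow> cip k a b"
  unfolding cip_def by (intro tendsto_sum tendsto_mult tendsto_cnj assms) auto

text \<open>Fewer than \<open>k\<close> linear conditions on \<open>k\<close> unknowns: padding the
  system with zero rows gives a singular square matrix, whose kernel vector is then
  normalized.\<close>

lemma exists_unit_orthogonal:
  assumes "t < k"
  shows "\<exists>x. nsq k x = 1 \<and> (\<forall>i<t. cip k (U i) x = 0)"
proof -
  define A where "A = mat k k (\<lambda>(i, j). if i < t then cnj (U i j) else 0)"
  have A: "A \<in> carrier_mat k k" by (simp add: A_def)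
  have "A = mat\<^sub>r k k (\<lambda>i. if i = t then 0\<^sub>v k else row A i)"
    using assms by (intro eq_matI) (auto simp: A_def)
  also have "det \<dots> = 0" using A assms by (intro det_row_0) auto
  finally have "det A = 0" .
  then obtain v where v: "v \<in> carrier_vec k" "v \<noteq> 0\<^sub>v k" "A *\<^sub>v v = 0\<^sub>v k"
    using det_0_iff_vec_prod_zero[OF A] by auto
  define x where "x i = v $ i" for i
  define c where "c = complex_of_real (1 / sqrt (nsq k x))"
  have nz: "nsq k x \<noteq> 0"
  proof
    assume "nsq k x = 0"
    then have "v = 0\<^sub>v k" using v(1) nsq_eq_0[of k x] by (intro eq_vecI) (auto simp: x_def)
    with v(2) show False by simp
  qed
  have "cip k (U i) x = 0" if "i < t" for i
  proof -
    have "0 = (A *\<^sub>v v) $ i" using v(3) that assms by simp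
    also have "\<dots> = cip k (U i) x"
      using v(1) that assms by (auto simp: A_def x_def cip_def scalar_prod_def lessThan_atLeast0)
    finally show ?thesis by simp
  qed
  then have "\<forall>i<t. cip k (U i) (\<lambda>i. c * x i) = 0" by (simp add: cip_scale_right)
  moreover have "nsq k (\<lambda>i. c * x i) = 1"
  proof -
    have "nsq k (\<lambda>i. c * x i) = (cmod c)\<^sup>2 * nsq k x"
      by (simp add: nsq_def norm_mult power_mult_distrib sum_distrib_left)
    also have "\<dots> = 1" using nz by (simp add: c_def power_divide norm_divide)
    finally show ?thesis .
  qed
  ultimately show ?thesis by blast
qed

definition mv :: "nat \<Rightarrow> (nat \<Rightarrow> nat \<Rightarrow> complex) \<Rightarrow> (nat \<Rightarrow> complex) \<Rightarrow> nat \<Rightarrow> complex" where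
  "mv k Z x a = (\<Sum>b<k. Z a b * x b)"

definition hermitian :: "nat \<Rightarrow> (nat \<Rightarrow> nat \<Rightarrow> complex) \<Rightarrow> bool" where
  "hermitian k Z \<longleftrightarrow> (\<forall>a<k. \<forall>b<k. Z a b = cnj (Z b a))"

lemma hermitian_cip: assumes "hermitian k Z" shows "cip k x (mv k Z y) = cip k (mv k Z x) y"
proof -
  have "cip k x (mv k Z y) = (\<Sum>a<k. \<Sum>b<k. cnj (x a) * Z a b * y b)"
    by (simp add: cip_def mv_def sum_distrib_left mult_ac)
  also have "\<dots> = (\<Sum>a<k. \<Sum>b<k. cnj (Z b a * x a) * y b)"
  proof (intro sum.cong refl)
    fix a b assume ab: "a \<in> {..<k}" "b \<in> {..<k}"
    then have "Z a b = cnj (Z b a)" using assms unfolding hermitian_def by blast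
    then show "cnj (x a) * Z a b * y b = cnj (Z b a * x a) * y b" by simp
  qed
  also have "\<dots> = (\<Sum>b<k. \<Sum>a<k. cnj (Z b a * x a) * y b)" by (rule sum.swap)
  also have "\<dots> = cip k (mv k Z x) y"
    by (simp add: cip_def mv_def sum_distrib_right)
  finally show ?thesis .
qed

lemma mv_add: "mv k Z (\<lambda>i. x i + y i) = (\<lambda>a. mv k Z x a + mv k Z y a)"
  by (rule ext) (simp add: mv_def distrib_left sum.distrib)

lemma mv_scale: "mv k Z (\<lambda>i. c * x i) = (\<lambda>a. c * mv k Z x a)"
  by (rule ext) (simp add: mv_def sum_distrib_left mult_ac)

text \<open>A maximizer of the Rayleigh quotient on the orthogonal complement of the eigenvectors already
  found is an eigenvector.\<close>

lemma hermitian_next_eigenvector: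
  assumes herm: "hermitian k Z" and t: "t < k"
    and ev: "\<And>i a. i < t \<Longrightarrow> a < k \<Longrightarrow> mv k Z (U i) a = of_real (lam i) * U i a"
  shows "\<exists>u s. nsq k u = 1 \<and> (\<forall>i<t. cip k (U i) u = 0) \<and> (\<forall>a<k. mv k Z u a = of_real s * u a)"
proof -
  define q where "q x = Re (cip k x (mv k Z x))" for x
  define W where "W = {x. \<forall>i<t. cip k (U i) x = 0}"
  define Sph where "Sph = {x \<in> W. nsq k x = 1}"
  have ne: "Sph \<noteq> {}"
    using exists_unit_orthogonal[OF t, of U] by (auto simp: Sph_def W_def)
  have le1: "cmod (x a) \<le> 1" if "x \<in> Sph" "a < k" for x a
    using component_le_nsq[OF that(2), of x] that(1) by (simp add: Sph_def abs_square_le_1)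
  define B where "B = (\<Sum>a<k. \<Sum>b<k. cmod (Z a b))"
  have qB: "q x \<le> B" if "x \<in> Sph" for x
  proof -
    have "q x \<le> cmod (cip k x (mv k Z x))" by (simp add: q_def complex_Re_le_cmod)
    also have "\<dots> = cmod (\<Sum>a<k. \<Sum>b<k. cnj (x a) * (Z a b * x b))"
      by (simp add: cip_def mv_def sum_distrib_left)
    also have "\<dots> \<le> (\<Sum>a<k. \<Sum>b<k. cmod (cnj (x a) * (Z a b * x b)))"
      by (intro order.trans[OF norm_sum] sum_mono) auto
    also have "\<dots> \<le> B" unfolding B_def
    proof (intro sum_mono)
      fix a b assume "a \<in> {..<k}" "b \<in> {..<k}"
      then have "cmod (x a) * cmod (x b) \<le> 1 * 1" by (intro mult_mono le1 that) auto
      then have "cmod (Z a b) * (cmod (x a) * cmod (x b)) \<le> cmod (Z a b) * 1"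
        by (intro mult_left_mono) auto
      then show "cmod (cnj (x a) * (Z a b * x b)) \<le> cmod (Z a b)"
        by (simp add: norm_mult mult_ac)
    qed
    finally show ?thesis .
  qed
  have bdd: "bdd_above (q ` Sph)" using qB by (intro bdd_aboveI2) auto
  define s where "s = (SUP x\<in>Sph. q x)"
  have le_s: "q x \<le> s" if "x \<in> Sph" for x
    unfolding s_def using bdd that by (rule cSUP_upper2[OF _ _ order_refl])
  have "\<exists>x\<in>Sph. s - 1 / Suc n < q x" for n
  proof -
    have "s - 1 / Suc n < s" by simp
    then show ?thesis unfolding s_def using less_cSUP_iff[OF ne bdd] by blast
  qed
  then obtain x where x: "\<And>n. x n \<in> Sph" "\<And>n. s - 1 / Suc n < q (x n)" by metis
  obtain r u where r: "strict_mono (r :: nat \<Rightarrow> nat)" and u: "\<And>i. i < k \<Longrightarrow> (\<lambda>n. x (r n) i) \<longlonglongrightarrow> u i"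
    using bounded_family_convergent_subseq[of "{..<k}" x 1] le1[OF x(1)]
    by (metis finite_lessThan lessThan_iff)
  have "(\<lambda>n. cip k (x (r n)) (x (r n))) \<longlonglongrightarrow> cip k u u"
    using u by (intro cip_tendsto) auto
  then have "cip k u u = 1"
    using x(1) by (simp add: cip_self Sph_def LIMSEQ_const_iff)
  then have u1: "nsq k u = 1" by (simp add: nsq_Re_cip)
  have uW: "u \<in> W" unfolding W_def
  proof (intro CollectI allI impI)
    fix i assume i: "i < t"
    have "(\<lambda>n. cip k (U i) (x (r n))) \<longlonglongrightarrow> cip k (U i) u"
      using u by (intro cip_tendsto) auto
    then show "cip k (U i) u = 0"
      using x(1) i by (simp add: Sph_def W_def LIMSEQ_const_iff)
  qed
  have "(\<lambda>n. q (x (r n))) \<longlonglongrightarrow> q u"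
    unfolding q_def mv_def
    by (intro tendsto_Re cip_tendsto tendsto_sum tendsto_mult tendsto_const u) auto
  moreover have "(\<lambda>n. q (x (r n))) \<longlonglongrightarrow> s"
  proof (rule tendsto_sandwich[of "\<lambda>n. s - 1 / Suc (r n)" _ _ "\<lambda>n. s"])
    have "(\<lambda>n. s - 1 / Suc n) \<longlonglongrightarrow> s - 0"
      by (intro tendsto_diff tendsto_const LIMSEQ_Suc[OF lim_1_over_n])
    from LIMSEQ_subseq_LIMSEQ[OF this r]
    show "(\<lambda>n. s - 1 / Suc (r n)) \<longlonglongrightarrow> s" by (simp add: o_def)
  qed (use x le_s in \<open>auto intro!: eventuallyI less_imp_le\<close>)
  ultimately have qu: "q u = s" by (rule LIMSEQ_unique)
  \<comment> \<open>The form is homogeneous of degree 2, so maximality on the unit sphere becomes an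
    inequality on the whole complement \<open>W\<close>.\<close>
  have hom: "q y \<le> s * nsq k y" if "y \<in> W" for y
  proof (cases "nsq k y = 0")
    case True
    then have "q y = 0" using nsq_eq_0[OF True] by (simp add: q_def cip_def)
    then show ?thesis using True by simp
  next
    case False
    then have pos: "0 < nsq k y" using nsq_nonneg[of k y] by linarith
    define c where "c = 1 / sqrt (nsq k y)"
    have c2: "c\<^sup>2 * nsq k y = 1" using pos by (simp add: c_def power_divide)
    let ?y = "\<lambda>i. complex_of_real c * y i"
    have "nsq k ?y = c\<^sup>2 * nsq k y"
      by (simp add: nsq_def norm_mult power_mult_distrib sum_distrib_left)
    then have "?y \<in> Sph" using that c2 by (simp add: Sph_def W_def cip_scale_right)
    then have "q ?y \<le> s" by (rule le_s)
    moreover have "q ?y = c\<^sup>2 * q y"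
      by (simp add: q_def mv_scale cip_scale_right cip_scale_left power2_eq_square mult.assoc)
    ultimately have "c\<^sup>2 * q y * nsq k y \<le> s * nsq k y" using pos by simp
    moreover have "c\<^sup>2 * q y * nsq k y = q y" using c2 by (simp add: algebra_simps)
    ultimately show ?thesis by simp
  qed
  \<comment> \<open>The residual of \<open>u\<close>, to be shown zero. It lies in \<open>W\<close>
    because \<open>Z\<close> is Hermitian and the earlier vectors are eigenvectors, so that
    \<open>Z\<close> preserves \<open>W\<close>.\<close>
  define w where "w a = mv k Z u a - of_real s * u a" for a
  have weq: "w = (\<lambda>a. mv k Z u a - of_real s * u a)" by (auto simp: w_def)
  have wW: "w \<in> W" unfolding W_def
  proof (intro CollectI allI impI)
    fix i assume i: "i < t"
    have "cip k (U i) w = cip k (mv k Z (U i)) u - of_real s * cip k (U i) u"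
      unfolding w_def by (simp add: cip_diff_right cip_scale_right hermitian_cip[OF herm])
    also have "cip k (mv k Z (U i)) u = cip k (\<lambda>a. of_real (lam i) * U i a) u"
      using ev[OF i] by (simp add: cip_def)
    finally show "cip k (U i) w = 0"
      using uW i by (simp add: cip_scale_left W_def)
  qed
  \<comment> \<open>Moving from \<open>u\<close> by \<open>e\<close> times \<open>w\<close> changes
    \<open>q - s * nsq\<close> by \<open>2 * e * nsq k w\<close> to first order. As \<open>u\<close>
    maximizes this difference on \<open>W\<close>, with value 0, the second-order term has to absorb
    the change for every \<open>e\<close>.\<close>
  have ineq: "2 * e * nsq k w \<le> e\<^sup>2 * (s * nsq k w - q w)" for e :: real
  proof -
    let ?y = "\<lambda>i. u i + of_real e * w i"
    have "?y \<in> W" using uW wW by (simp add: W_def cip_add_right cip_scale_right)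
    then have "q ?y \<le> s * nsq k ?y" by (rule hom)
    moreover have "q ?y = q u + 2 * e * Re (cip k w (mv k Z u)) + e\<^sup>2 * q w"
    proof -
      have "cip k u (mv k Z w) = cnj (cip k w (mv k Z u))"
        by (simp add: hermitian_cip[OF herm] cip_cnj)
      then have "Re (cip k u (mv k Z w)) = Re (cip k w (mv k Z u))" by simp
      then show ?thesis
        by (simp add: q_def mv_add mv_scale cip_add_right cip_add_left cip_scale_right cip_scale_left
            power2_eq_square algebra_simps)
    qed
    moreover have "nsq k ?y = nsq k u + 2 * e * Re (cip k w u) + e\<^sup>2 * nsq k w"
    proof -
      have "Re (cip k u w) = Re (cip k w u)" by (metis cip_cnj cnj.simps(1))
      then show ?thesis
        by (simp add: nsq_Re_cip cip_add_right cip_add_left cip_scale_right cip_scale_left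
            power2_eq_square algebra_simps)
    qed
    moreover have "Re (cip k w (mv k Z u)) - s * Re (cip k w u) = nsq k w"
    proof -
      have "cip k w w = cip k w (mv k Z u) - of_real s * cip k w u"
        using arg_cong[OF weq, of "cip k w"] by (simp only: cip_diff_right cip_scale_right)
      then show ?thesis by (simp add: nsq_Re_cip)
    qed
    ultimately show ?thesis using qu u1 by (simp add: algebra_simps)
  qed
  have "nsq k w = 0"
  proof (rule ccontr)
    assume "nsq k w \<noteq> 0"
    then have pos: "0 < nsq k w" using nsq_nonneg[of k w] by linarith
    \<comment> \<open>\<open>D\<close> exceeds the modulus of the second-order coefficient, so
      \<open>e = nsq k w / D\<close> makes the quadratic term at most half of the linear
      one.\<close>
    define D where "D = \<bar>s * nsq k w - q w\<bar> + 1"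
    have D: "0 < D" by (simp add: D_def)
    define e where "e = nsq k w / D"
    have e: "0 < e" using pos D by (simp add: e_def)
    have "2 * e * nsq k w \<le> e\<^sup>2 * D"
      using ineq[of e] by (smt (verit, best) D_def mult_left_mono zero_le_power2)
    also have "e\<^sup>2 * D = e * nsq k w" using D by (simp add: e_def power2_eq_square)
    finally show False using e pos by simp
  qed
  then have "\<forall>a<k. mv k Z u a = of_real s * u a"
    using nsq_eq_0 by (fastforce simp: w_def)
  then show ?thesis using u1 uW by (auto simp: W_def)
qed

theorem hermitian_spectral:
  assumes herm: "hermitian k Z"
  shows "\<exists>U lam. orthonormal k U {..<k} \<and> (\<forall>i<k. \<forall>a<k. mv k Z (U i) a = of_real (lam i) * U i a)"
proof -
  have "\<exists>U lam. orthonormal k U {..<t} \<and> (\<forall>i<t. \<forall>a<k. mv k Z (U i) a = of_real (lam i) * U i a)"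
    if "t \<le> k" for t
    using that
  proof (induction t)
    case 0
    then show ?case by (simp add: orthonormal_def)
  next
    case (Suc t)
    then obtain U lam where U: "orthonormal k U {..<t}"
      and ev: "\<And>i a. i < t \<Longrightarrow> a < k \<Longrightarrow> mv k Z (U i) a = of_real (lam i) * U i a" by auto
    have "t < k" using Suc.prems by simp
    from hermitian_next_eigenvector[OF herm this, of U lam] ev
    obtain u s where u: "nsq k u = 1" "\<And>i. i < t \<Longrightarrow> cip k (U i) u = 0"
      "\<And>a. a < k \<Longrightarrow> mv k Z u a = of_real s * u a"
      by blast
    have u': "cip k u (U i) = 0" if "i < t" for i
      using u(2)[OF that] cip_cnj[of k "U i" u] by simp
    have "nsq k (U i) = 1" if "i < t" for i
      using U that by (simp add: orthonormal_def nsq_Re_cip)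
    then have "orthonormal k (U(t := u)) {..<Suc t}"
      using U u u' by (auto simp: orthonormal_def cip_self less_Suc_eq)
    moreover have "\<forall>i<Suc t. \<forall>a<k. mv k Z ((U(t := u)) i) a = of_real ((lam(t := s)) i) * (U(t := u)) i a"
      using ev u(3) by (auto simp: less_Suc_eq)
    ultimately show ?case by blast
  qed
  then show ?thesis by blast
qed


lemma sum_rotate:
  "(\<Sum>i\<in>A. \<Sum>a\<in>B. \<Sum>b\<in>C. f i a b) = (\<Sum>a\<in>B. \<Sum>b\<in>C. \<Sum>i\<in>A. f i a b)"
proof -
  have "(\<Sum>i\<in>A. \<Sum>a\<in>B. \<Sum>b\<in>C. f i a b) = (\<Sum>a\<in>B. \<Sum>i\<in>A. \<Sum>b\<in>C. f i a b)"
    by (rule sum.swap)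
  also have "\<dots> = (\<Sum>a\<in>B. \<Sum>b\<in>C. \<Sum>i\<in>A. f i a b)"
    by (rule sum.cong[OF refl], rule sum.swap)
  finally show ?thesis .
qed

text \<open>For square matrices a left inverse is a right inverse; this turns orthonormality of the
  columns into the completeness relation behind \<open>parseval\<close>.\<close>

lemma orthonormal_matrix:
  assumes "orthonormal k U {..<k}"
  defines "M \<equiv> mat k k (\<lambda>(a, i). U i a)"
  shows "mat_adjoint M * M = 1\<^sub>m k" "M * mat_adjoint M = 1\<^sub>m k"
proof -
  have M: "M \<in> carrier_mat k k" by (simp add: M_def)
  show *: "mat_adjoint M * M = 1\<^sub>m k"
  proof (rule eq_matI)
    fix i j assume "i < dim_row (1\<^sub>m k :: complex mat)" "j < dim_col (1\<^sub>m k :: complex mat)"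
    then have ij: "i < k" "j < k" by auto
    have "(mat_adjoint M * M) $$ (i, j) = cip k (U i) (U j)"
      using ij M by (simp add: scalar_prod_def cip_def M_def lessThan_atLeast0)
    then show "(mat_adjoint M * M) $$ (i, j) = 1\<^sub>m k $$ (i, j)"
      using assms ij by (simp add: orthonormal_def)
  qed (use M in auto)
  show "M * mat_adjoint M = 1\<^sub>m k"
    using mat_mult_left_right_inverse[OF mat_adjoint_carrier[OF M] M *] .
qed

lemma orthonormal_complete:
  assumes "orthonormal k U {..<k}" "a < k" "b < k"
  shows "(\<Sum>i<k. U i a * cnj (U i b)) = (if a = b then 1 else 0)"
proof -
  let ?M = "mat k k (\<lambda>(a, i). U i a)"
  have "(?M * mat_adjoint ?M) $$ (a, b) = (\<Sum>i<k. U i a * cnj (U i b))"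
    using assms by (simp add: scalar_prod_def lessThan_atLeast0)
  then show ?thesis using orthonormal_matrix(2)[OF assms(1)] assms by simp
qed

lemma parseval:
  assumes "orthonormal k U {..<k}"
  shows "cip k x y = (\<Sum>i<k. cip k x (U i) * cip k (U i) y)"
proof -
  have "(\<Sum>i<k. cip k x (U i) * cip k (U i) y)
      = (\<Sum>i<k. \<Sum>a<k. \<Sum>b<k. cnj (x a) * y b * (U i a * cnj (U i b)))"
    unfolding cip_def sum_product by (intro sum.cong refl) (simp add: mult_ac)
  also have "\<dots> = (\<Sum>a<k. \<Sum>b<k. \<Sum>i<k. cnj (x a) * y b * (U i a * cnj (U i b)))"
    by (rule sum_rotate)
  also have "\<dots> = (\<Sum>a<k. \<Sum>b<k. cnj (x a) * y b * (if a = b then 1 else 0))"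
    by (intro sum.cong refl) (simp add: sum_distrib_left[symmetric] orthonormal_complete[OF assms])
  also have "\<dots> = cip k x y" by (simp add: cip_def if_distrib cong: if_cong)
  finally show ?thesis ..
qed

text \<open>The spectral theorem in the shape used later. The eigenvalues also appear as values of
  the form at the eigenvectors, from which their signs are read off. The determinant comes from
  \<open>Z M = M D\<close> with \<open>M\<close> invertible, the trace from completeness.\<close>

theorem hermitian_diagonalization:
  assumes herm: "hermitian k Z"
  obtains U lam where "orthonormal k U {..<k}"
    and "\<And>x. cip k x (mv k Z x) = of_real (\<Sum>i<k. lam i * (cmod (cip k (U i) x))\<^sup>2)"
    and "\<And>i. i < k \<Longrightarrow> cip k (U i) (mv k Z (U i)) = of_real (lam i)"
    and "det (mat k k (\<lambda>(a, b). Z a b)) = of_real (\<Prod>i<k. lam i)"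
    and "(\<Sum>a<k. Z a a) = of_real (\<Sum>i<k. lam i)"
proof -
  obtain U lam where U: "orthonormal k U {..<k}"
    and ev: "\<And>i a. i < k \<Longrightarrow> a < k \<Longrightarrow> mv k Z (U i) a = of_real (lam i) * U i a"
    using hermitian_spectral[OF herm] by blast
  have cev: "cip k x (mv k Z (U i)) = of_real (lam i) * cip k x (U i)" if "i < k" for x i
    unfolding cip_scale_right[symmetric] using ev[OF that] by (simp add: cip_def)
  have cev': "cip k (U i) (mv k Z x) = of_real (lam i) * cip k (U i) x" if "i < k" for x i
  proof -
    have "cip k (U i) (mv k Z x) = cnj (cip k x (mv k Z (U i)))"
      by (simp add: hermitian_cip[OF herm] cip_cnj)
    then show ?thesis by (simp add: cev[OF that] cip_cnj)
  qed
  have quad: "cip k x (mv k Z x) = of_real (\<Sum>i<k. lam i * (cmod (cip k (U i) x))\<^sup>2)" for x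
  proof -
    have "cip k x (mv k Z x) = (\<Sum>i<k. cip k x (U i) * (of_real (lam i) * cip k (U i) x))"
      by (subst parseval[OF U]) (simp add: cev')
    also have "\<dots> = (\<Sum>i<k. of_real (lam i) * (cnj (cip k (U i) x) * cip k (U i) x))"
      by (simp add: cip_cnj mult_ac)
    also have "\<dots> = of_real (\<Sum>i<k. lam i * (cmod (cip k (U i) x))\<^sup>2)"
      by (simp add: complex_norm_square mult.commute del: of_real_power)
    finally show ?thesis .
  qed
  have diag: "cip k (U i) (mv k Z (U i)) = of_real (lam i)" if "i < k" for i
    using cev[OF that, of "U i"] U that by (simp add: orthonormal_def)
  let ?M = "mat k k (\<lambda>(a, i). U i a)" and ?Z = "mat k k (\<lambda>(a, b). Z a b)"
  let ?D = "mat k k (\<lambda>(a, b). if a = b then complex_of_real (lam a) else 0)"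
  have "?Z * ?M = ?M * ?D"
  proof (rule eq_matI)
    fix a i assume "a < dim_row (?M * ?D)" "i < dim_col (?M * ?D)"
    then have ai: "a < k" "i < k" by auto
    have "(?Z * ?M) $$ (a, i) = mv k Z (U i) a"
      using ai by (simp add: scalar_prod_def mv_def lessThan_atLeast0)
    also have "\<dots> = (?M * ?D) $$ (a, i)"
      using ai by (simp add: scalar_prod_def ev lessThan_atLeast0 if_distrib cong: if_cong)
    finally show "(?Z * ?M) $$ (a, i) = (?M * ?D) $$ (a, i)" .
  qed auto
  then have "det (?Z * ?M) = det (?M * ?D)" by simp
  then have "det ?Z * det ?M = det ?M * det ?D"
    using det_mult[of ?Z k ?M] det_mult[of ?M k ?D] by simp
  moreover have "det (mat_adjoint ?M * ?M) = det (1\<^sub>m k)"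
    by (rule arg_cong[OF orthonormal_matrix(1)[OF U]])
  then have "det (mat_adjoint ?M) * det ?M = 1"
    using det_mult[of "mat_adjoint ?M" k ?M] by simp
  then have "det ?M \<noteq> 0" by auto
  ultimately have "det ?Z = det ?D" by (simp add: mult.commute)
  also have "\<dots> = prod_list (diag_mat ?D)"
    by (rule det_upper_triangular[of _ k]) (auto simp: upper_triangular_def)
  also have "\<dots> = of_real (\<Prod>i<k. lam i)"
    by (simp add: prod_list_diag_prod lessThan_atLeast0)
  finally have det: "det ?Z = of_real (\<Prod>i<k. lam i)" .
  have "of_real (\<Sum>i<k. lam i) = (\<Sum>i<k. cip k (U i) (mv k Z (U i)))"
    using diag by simp
  also have "\<dots> = (\<Sum>i<k. \<Sum>a<k. \<Sum>b<k. Z a b * (U i b * cnj (U i a)))"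
    by (simp add: cip_def mv_def sum_distrib_left mult_ac)
  also have "\<dots> = (\<Sum>a<k. \<Sum>b<k. \<Sum>i<k. Z a b * (U i b * cnj (U i a)))"
    by (rule sum_rotate)
  also have "\<dots> = (\<Sum>a<k. \<Sum>b<k. Z a b * (if b = a then 1 else 0))"
    by (intro sum.cong refl) (simp add: sum_distrib_left[symmetric] orthonormal_complete[OF U])
  also have "\<dots> = (\<Sum>a<k. Z a a)" by (simp add: if_distrib cong: if_cong)
  finally have "(\<Sum>a<k. Z a a) = of_real (\<Sum>i<k. lam i)" ..
  with U quad diag det show thesis by (rule that)
qed

section \<open>Subspaces and flags\<close>

lemma submodule_vec_iff:
  "LinearCombinations.submodule class_ring W (cvec_space k) \<longleftrightarrow>
    W \<subseteq> carrier_vec k \<and> 0\<^sub>v k \<in> W \<and> (\<forall>v\<in>W. \<forall>w\<in>W. v + w \<in> W) \<and> (\<forall>c. \<forall>v\<in>W. c \<cdot>\<^sub>v v \<in> W)"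
proof -
  interpret vec_space "TYPE(complex)" k .
  show ?thesis
    unfolding submodule_def using module_axioms by (auto simp: class_ring_simps module_vec_simps)
qed

lemma subspace_vec_iff:
  "VectorSpace.subspace class_ring W (cvec_space k) \<longleftrightarrow>
    W \<subseteq> carrier_vec k \<and> 0\<^sub>v k \<in> W \<and> (\<forall>v\<in>W. \<forall>w\<in>W. v + w \<in> W) \<and> (\<forall>c. \<forall>v\<in>W. c \<cdot>\<^sub>v v \<in> W)"
proof -
  interpret vec_space "TYPE(complex)" k .
  show ?thesis
    unfolding VectorSpace.subspace_def using vectorspace_axioms by (simp add: submodule_vec_iff)
qed

abbreviation vspan :: "nat \<Rightarrow> complex vec set \<Rightarrow> complex vec set" where
  "vspan k B \<equiv> LinearCombinations.module.span class_ring (cvec_space k) B"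

lemma subspace_span:
  assumes "B \<subseteq> carrier_vec k"
  shows "VectorSpace.subspace class_ring (vspan k B) (cvec_space k)"
proof -
  interpret vec_space "TYPE(complex)" k .
  show ?thesis using assms by (intro span_is_subspace) (simp add: module_vec_simps)
qed

lemma span_least:
  assumes "VectorSpace.subspace class_ring W (cvec_space k)" "B \<subseteq> W"
  shows "vspan k B \<subseteq> W"
proof -
  interpret vec_space "TYPE(complex)" k .
  show ?thesis using assms by (intro span_is_subset) (auto simp: VectorSpace.subspace_def)
qed

lemma span_superset:
  assumes "B \<subseteq> carrier_vec k"
  shows "B \<subseteq> vspan k B"
proof -
  interpret vec_space "TYPE(complex)" k .
  show ?thesis using assms in_own_span by (simp add: module_vec_simps)
qed

lemma span_mono:
  assumes "B \<subseteq> C" "C \<subseteq> carrier_vec k"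
  shows "vspan k B \<subseteq> vspan k C"
  using assms by (intro span_least subspace_span) (auto intro: span_superset[THEN subsetD])

lemma std_flag_iff:
  assumes "i \<le> k"
  shows "std_flag k i = {v \<in> carrier_vec k. \<forall>a. i \<le> a \<and> a < k \<longrightarrow> v $ a = 0}" (is "_ = ?E i")
proof
  have "VectorSpace.subspace class_ring (?E i) (cvec_space k)"
    unfolding subspace_vec_iff by auto
  moreover have "unit_vec k ` {..<i} \<subseteq> ?E i" using assms by auto
  ultimately show "std_flag k i \<subseteq> ?E i"
    unfolding std_flag_def by (rule span_least)
  show "?E i \<subseteq> std_flag k i"
    using assms
  proof (induction i)
    case 0
    have "v = 0\<^sub>v k" if "v \<in> ?E 0" for v using that by (intro eq_vecI) auto
    moreover have "0\<^sub>v k \<in> std_flag k 0"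
      using subspace_span[of "{}" k] by (simp add: std_flag_def subspace_vec_iff)
    ultimately show ?case by blast
  next
    case (Suc i)
    have sub: "unit_vec k ` {..<Suc i} \<subseteq> carrier_vec k" by auto
    note S = subspace_span[OF sub, unfolded subspace_vec_iff]
    show ?case
    proof
      fix v assume v: "v \<in> ?E (Suc i)"
      define w where "w = v + (- (v $ i)) \<cdot>\<^sub>v unit_vec k i"
      have vc: "v \<in> carrier_vec k" and v0: "\<And>a. i < a \<Longrightarrow> a < k \<Longrightarrow> v $ a = 0"
        using v by auto
      have wc: "w \<in> carrier_vec k" using vc by (simp add: w_def)
      have "w $ a = 0" if "i \<le> a" "a < k" for a
        using that vc v0 Suc.prems by (cases "a = i") (simp_all add: w_def)
      then have "w \<in> ?E i" using wc by blast
      then have "w \<in> vspan k (unit_vec k ` {..<i})" using Suc by (auto simp: std_flag_def)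
      moreover have "vspan k (unit_vec k ` {..<i}) \<subseteq> vspan k (unit_vec k ` {..<Suc i})"
        by (rule span_mono) auto
      ultimately have "w \<in> vspan k (unit_vec k ` {..<Suc i})" by blast
      moreover have "unit_vec k i \<in> vspan k (unit_vec k ` {..<Suc i})"
        using span_superset[OF sub] by auto
      ultimately have "w + v $ i \<cdot>\<^sub>v unit_vec k i \<in> vspan k (unit_vec k ` {..<Suc i})"
        using S by blast
      moreover have "w + v $ i \<cdot>\<^sub>v unit_vec k i = v"
        using vc by (intro eq_vecI) (simp_all add: w_def)
      ultimately show "v \<in> std_flag k (Suc i)" by (simp add: std_flag_def)
    qed
  qed
qed

lemma subspace_flag_inter:
  assumes "VectorSpace.subspace class_ring L (cvec_space k)" "i \<le> k"
  shows "VectorSpace.subspace class_ring (std_flag k i \<inter> L) (cvec_space k)"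
  using assms(1) unfolding subspace_vec_iff std_flag_iff[OF assms(2)] by auto

lemma subspace_dim_le:
  assumes W: "VectorSpace.subspace class_ring W (cvec_space k)"
    and B: "finite B" "B \<subseteq> W" "W \<subseteq> vspan k B"
  shows "subspace_dim k W \<le> card B"
    and "vectorspace.fin_dim class_ring (cvec_space k\<lparr>carrier := W\<rparr>)"
proof -
  interpret vec_space "TYPE(complex)" k .
  have vs: "vectorspace class_ring (cvec_space k\<lparr>carrier := W\<rparr>)"
    by (rule subspace_is_vs[OF W])
  have span: "LinearCombinations.module.span class_ring (cvec_space k\<lparr>carrier := W\<rparr>) B = W"
    using span_li_not_depend(1)[OF B(2)] W B(3) span_least[OF W B(2)] by (simp add: VectorSpace.subspace_def)
  show "subspace_dim k W \<le> card B"
    unfolding subspace_dim_def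
    using vectorspace.gen_ge_dim[OF vs B(1)] B(2) span by simp
  show "vectorspace.fin_dim class_ring (cvec_space k\<lparr>carrier := W\<rparr>)"
    unfolding vectorspace.fin_dim_def[OF vs] using B span by auto
qed

text \<open>Echelon form adapted to the flag: \<open>I\<close> consists of the positions that are
  the last nonzero position of some vector of \<open>L\<close>. A vector of \<open>L\<close> in flag
  member \<open>i + 1\<close> either vanishes at \<open>i\<close> or makes \<open>i\<close> a pivot,
  and then subtracting a multiple of \<open>v i\<close> brings it into flag member
  \<open>i\<close>.\<close>

lemma echelon_generators:
  assumes L: "VectorSpace.subspace class_ring L (cvec_space k)"
  obtains I v where "I \<subseteq> {..<k}" and "\<And>i. i \<in> I \<Longrightarrow> v i \<in> L \<and> v i $ i = 1 \<and> (\<forall>a. i < a \<and> a < k \<longrightarrow> v i $ a = 0)"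
    and "\<And>i. i \<le> k \<Longrightarrow> std_flag k i \<inter> L \<subseteq> vspan k (v ` (I \<inter> {..<i}))"
proof -
  note sL = L[unfolded subspace_vec_iff]
  define piv where "piv i x \<longleftrightarrow> x \<in> L \<and> x $ i = 1 \<and> (\<forall>a. i < a \<and> a < k \<longrightarrow> x $ a = 0)" for i x
  define I where "I = {i. i < k \<and> (\<exists>x. piv i x)}"
  define v where "v i = (SOME x. piv i x)" for i
  have v: "piv i (v i)" if "i \<in> I" for i
    using that unfolding I_def v_def by (auto intro: someI)
  have gen: "std_flag k i \<inter> L \<subseteq> vspan k (v ` (I \<inter> {..<i}))" if "i \<le> k" for i
    using that
  proof (induction i)
    case 0
    have "x = 0\<^sub>v k" if "x \<in> std_flag k 0" for x
      using that by (intro eq_vecI) (auto simp: std_flag_iff)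
    then show ?case
      using subspace_span[of "{}" k] by (auto simp: subspace_vec_iff)
  next
    case (Suc i)
    have IH: "std_flag k i \<inter> L \<subseteq> vspan k (v ` (I \<inter> {..<i}))" using Suc by simp
    have car: "v ` (I \<inter> {..<Suc i}) \<subseteq> carrier_vec k" using v sL by (auto simp: piv_def)
    note S = subspace_span[OF car, unfolded subspace_vec_iff]
    have mono: "vspan k (v ` (I \<inter> {..<i})) \<subseteq> vspan k (v ` (I \<inter> {..<Suc i}))"
      by (rule span_mono[OF _ car]) auto
    show ?case
    proof
      fix x assume x: "x \<in> std_flag k (Suc i) \<inter> L"
      then have xL: "x \<in> L" and xc: "x \<in> carrier_vec k" and x0: "\<And>a. i < a \<Longrightarrow> a < k \<Longrightarrow> x $ a = 0"
        using Suc.prems by (auto simp: std_flag_iff)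
      show "x \<in> vspan k (v ` (I \<inter> {..<Suc i}))"
      proof (cases "x $ i = 0")
        case True
        then have "x \<in> std_flag k i"
          using xc x0 Suc.prems by (auto simp: std_flag_iff) (metis le_neq_implies_less)
        then show ?thesis using IH xL mono by blast
      next
        case False
        have "piv i ((1 / x $ i) \<cdot>\<^sub>v x)"
          using False xL xc x0 sL Suc.prems by (auto simp: piv_def)
        then have iI: "i \<in> I" using Suc.prems by (auto simp: I_def)
        note vi = v[OF iI, unfolded piv_def]
        have vic: "v i \<in> carrier_vec k" using vi sL by auto
        define w where "w = x + (- (x $ i)) \<cdot>\<^sub>v v i"
        have "w \<in> L" using xL vi sL by (auto simp: w_def)
        moreover have "w \<in> std_flag k i"
        proof -
          have "w $ a = 0" if "i \<le> a" "a < k" for a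
            using that vi vic xc x0 by (cases "a = i") (simp_all add: w_def)
          moreover have "w \<in> carrier_vec k" using xc vic by (simp add: w_def)
          ultimately show ?thesis using Suc.prems std_flag_iff[of i k] by simp
        qed
        ultimately have "w \<in> vspan k (v ` (I \<inter> {..<Suc i}))" using IH mono by blast
        moreover have "v i \<in> vspan k (v ` (I \<inter> {..<Suc i}))"
          using span_superset[OF car] iI by auto
        ultimately have "w + x $ i \<cdot>\<^sub>v v i \<in> vspan k (v ` (I \<inter> {..<Suc i}))"
          using S by blast
        moreover have "w + x $ i \<cdot>\<^sub>v v i = x"
          using xc vic by (intro eq_vecI) (simp_all add: w_def)
        ultimately show ?thesis by simp
      qed
    qed
  qed
  show thesis
    by (rule that[of I v]) (use v gen in \<open>auto simp: I_def piv_def\<close>)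
qed

text \<open>Pairing a vanishing combination with \<open>u t\<close> isolates the coefficient of
  \<open>t\<close>, so the vectors are independent. Comparing with the dimension of \<open>W\<close>
  requires a finite generating set, which \<open>echelon_generators\<close> provides.\<close>

lemma card_le_subspace_dim:
  assumes W: "VectorSpace.subspace class_ring W (cvec_space k)"
    and S: "finite S" "\<And>s. s \<in> S \<Longrightarrow> vec k (u s) \<in> W"
    and orth: "\<And>s t. s \<in> S \<Longrightarrow> t \<in> S \<Longrightarrow> (\<Sum>i<k. cnj (u s i) * u t i) = (if s = t then 1 else 0)"
  shows "card S \<le> subspace_dim k W"
proof -
  interpret vec_space "TYPE(complex)" k .
  have vs: "vectorspace class_ring (cvec_space k\<lparr>carrier := W\<rparr>)"
    by (rule subspace_is_vs[OF W])
  let ?f = "\<lambda>s. vec k (u s)"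
  have inj: "inj_on ?f S"
  proof
    fix s t assume st: "s \<in> S" "t \<in> S" "?f s = ?f t"
    then have "\<And>i. i < k \<Longrightarrow> u s i = u t i" by (metis index_vec)
    then have "(\<Sum>i<k. cnj (u s i) * u t i) = (\<Sum>i<k. cnj (u s i) * u s i)" by simp
    then show "s = t" using orth st by (metis zero_neq_one)
  qed
  have car: "?f ` S \<subseteq> carrier_vec k" by auto
  have fin: "finite (?f ` S)" using S by simp
  have lc: "\<forall>x\<in>?f ` S. a x = 0" if zero: "lincomb a (?f ` S) = 0\<^sub>v k" for a
  proof -
    have "a (?f t) = 0" if t: "t \<in> S" for t
    proof -
      have comp: "(\<Sum>s\<in>S. a (?f s) * u s i) = 0" if "i < k" for i
      proof -
        have "0 = lincomb a (?f ` S) $ i" using zero that by simp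
        also have "\<dots> = (\<Sum>x\<in>?f ` S. a x * x $ i)" by (rule lincomb_index[OF that car])
        also have "\<dots> = (\<Sum>s\<in>S. a (?f s) * u s i)"
          using that by (subst sum.reindex[OF inj]) simp
        finally show ?thesis by simp
      qed
      have "0 = (\<Sum>i<k. cnj (u t i) * (\<Sum>s\<in>S. a (?f s) * u s i))" using comp by simp
      also have "\<dots> = (\<Sum>s\<in>S. a (?f s) * (\<Sum>i<k. cnj (u t i) * u s i))"
        by (simp add: sum_distrib_left mult_ac sum.swap[of _ S])
      also have "\<dots> = (\<Sum>s\<in>S. a (?f s) * (if t = s then 1 else 0))"
        using orth t by simp
      also have "\<dots> = a (?f t)"
        using t S(1) by (simp add: if_distrib[of "(*) _"] cong: if_cong)
      finally show ?thesis by simp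
    qed
    then show ?thesis by simp
  qed
  have "lin_indpt (?f ` S)" by (rule finite_lin_indpt2[OF fin car]) (rule lc)
  then have li: "\<not> module.lin_dep class_ring (cvec_space k\<lparr>carrier := W\<rparr>) (?f ` S)"
    using span_li_not_depend(2)[of "?f ` S" W] S W by (auto simp: VectorSpace.subspace_def)
  obtain I v where Iv: "I \<subseteq> {..<k}" "\<And>i. i \<in> I \<Longrightarrow> v i \<in> W" "std_flag k k \<inter> W \<subseteq> vspan k (v ` (I \<inter> {..<k}))"
    using echelon_generators[OF W] by (metis order_refl)
  have "W \<subseteq> std_flag k k" using W by (auto simp: std_flag_iff subspace_vec_iff)
  then have "vectorspace.fin_dim class_ring (cvec_space k\<lparr>carrier := W\<rparr>)"
    using Iv by (intro subspace_dim_le(2)[OF W, of "v ` (I \<inter> {..<k})"]) auto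
  from vectorspace.li_le_dim(2)[OF vs this _ li]
  have "card (?f ` S) \<le> subspace_dim k W" using S by (auto simp: subspace_dim_def)
  then show ?thesis using inj by (simp add: card_image)
qed

section \<open>Pairings, pivots and independent pairs of subspaces\<close>

definition form :: "nat \<Rightarrow> nat \<Rightarrow> complex mat \<Rightarrow> (nat \<Rightarrow> complex) \<Rightarrow> (nat \<Rightarrow> complex) \<Rightarrow> complex" where
  "form m n A x y = (\<Sum>a<m. \<Sum>b<n. cnj (x a) * A $$ (a, b) * y b)"

lemma cscalar_prod_mult_mat_vec:
  assumes "A \<in> carrier_mat m n" "x \<in> carrier_vec m" "y \<in> carrier_vec n"
  shows "x \<bullet>c (A *\<^sub>v y) = cnj (form m n A (($) x) (($) y))"
  using assms
  by (simp add: form_def scalar_prod_def lessThan_atLeast0 sum_distrib_left mult_ac)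

lemma \<Delta>_nonneg:
  assumes "antimono_on {1..k} a" "\<forall>j\<in>{1..k}. 0 \<le> a j" "i \<in> {1..k}"
  shows "0 \<le> \<Delta> k a i"
  using assms by (auto simp: \<Delta>_def monotone_on_def)

lemma \<Delta>_sum:
  assumes "i < k"
  shows "(\<Sum>j=Suc i..k. \<Delta> k a j) = a (Suc i)"
proof -
  \<comment> \<open>The convention that the term after \<open>a k\<close> is 0 is made explicit in
    both summands, so that the sum telescopes up to the upper end.\<close>
  have "(\<Sum>j=Suc i..k. \<Delta> k a j) = (\<Sum>j=Suc i..k. (if j = Suc k then 0 else a j) - (if Suc j = Suc k then 0 else a (Suc j)))"
    by (intro sum.cong) (auto simp: \<Delta>_def)
  also have "\<dots> = - (\<Sum>j=Suc i..k. (if Suc j = Suc k then 0 else a (Suc j)) - (if j = Suc k then 0 else a j))"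
    by (simp add: sum_negf[symmetric] del: sum_negf)
  also have "\<dots> = a (Suc i)"
    using assms by (subst sum_Suc_diff) auto
  finally show ?thesis .
qed

text \<open>Summation by parts: position \<open>i\<close> is counted at all levels
  \<open>j > i\<close>, where the weights add up to \<open>a (Suc i)\<close>. Positions start from
  0, the sequence from 1.\<close>

lemma \<Delta>_sum_card:
  assumes "I \<subseteq> {..<k}"
  shows "(\<Sum>j=1..k. \<Delta> k a j * real (card (I \<inter> {..<j}))) = (\<Sum>i\<in>I. a (Suc i))"
proof -
  have fin: "finite I" using assms finite_subset by blast
  have "(\<Sum>j=1..k. \<Delta> k a j * real (card (I \<inter> {..<j}))) = (\<Sum>j=1..k. \<Sum>i\<in>I. if i < j then \<Delta> k a j else 0)"
  proof (intro sum.cong refl)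
    fix j
    have "(\<Sum>i\<in>I. if i < j then \<Delta> k a j else 0) = (\<Sum>i\<in>I \<inter> {..<j}. \<Delta> k a j)"
      using sum.inter_restrict[OF fin, of "\<lambda>_. \<Delta> k a j" "{..<j}"] by simp
    then show "\<Delta> k a j * real (card (I \<inter> {..<j})) = (\<Sum>i\<in>I. if i < j then \<Delta> k a j else 0)"
      by simp
  qed
  also have "\<dots> = (\<Sum>i\<in>I. \<Sum>j=1..k. if i < j then \<Delta> k a j else 0)" by (rule sum.swap)
  also have "\<dots> = (\<Sum>i\<in>I. a (Suc i))"
  proof (intro sum.cong refl)
    fix i assume "i \<in> I"
    then have "i < k" using assms by auto
    have "(\<Sum>j=1..k. if i < j then \<Delta> k a j else 0) = (\<Sum>j=Suc i..k. \<Delta> k a j)"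
      by (intro sum.mono_neutral_cong_right) auto
    then show "(\<Sum>j=1..k. if i < j then \<Delta> k a j else 0) = a (Suc i)"
      using \<Delta>_sum[OF \<open>i < k\<close>] by simp
  qed
  finally show ?thesis .
qed

text \<open>Each flag dimension is at most the number of pivots below it. The weights
  \<open>\<Delta> k a j\<close> are nonnegative because \<open>a\<close> is nonincreasing and
  nonnegative, so the bounds can be summed by parts.\<close>

lemma flag_dim_sum_le_pivots:
  assumes L: "VectorSpace.subspace class_ring L (cvec_space k)"
    and a: "antimono_on {1..k} a" "\<forall>j\<in>{1..k}. 0 \<le> a j"
  obtains I v where "I \<subseteq> {..<k}"
    and "\<And>i. i \<in> I \<Longrightarrow> v i \<in> L \<and> v i $ i = 1 \<and> (\<forall>s. i < s \<and> s < k \<longrightarrow> v i $ s = 0)"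
    and "(\<Sum>j=1..k. \<Delta> k a j * real (subspace_dim k (std_flag k j \<inter> L))) \<le> (\<Sum>i\<in>I. a (Suc i))"
proof -
  obtain I v where Iv: "I \<subseteq> {..<k}" "\<And>i. i \<in> I \<Longrightarrow> v i \<in> L \<and> v i $ i = 1 \<and> (\<forall>s. i < s \<and> s < k \<longrightarrow> v i $ s = 0)"
    "\<And>i. i \<le> k \<Longrightarrow> std_flag k i \<inter> L \<subseteq> vspan k (v ` (I \<inter> {..<i}))"
    using echelon_generators[OF L] by metis
  have vc: "v i \<in> carrier_vec k" if "i \<in> I" for i
    using Iv(2)[OF that] L by (auto simp: subspace_vec_iff)
  have "subspace_dim k (std_flag k j \<inter> L) \<le> card (I \<inter> {..<j})" if j: "j \<in> {1..k}" for j
  proof -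
    have jk: "j \<le> k" using j by simp
    have fin: "finite (v ` (I \<inter> {..<j}))" by simp
    have sub: "v ` (I \<inter> {..<j}) \<subseteq> std_flag k j \<inter> L"
    proof
      fix x assume "x \<in> v ` (I \<inter> {..<j})"
      then obtain i where i: "i \<in> I" "i < j" "x = v i" by blast
      then show "x \<in> std_flag k j \<inter> L"
        using Iv(2)[OF i(1)] vc[OF i(1)] std_flag_iff[OF jk] by auto
    qed
    have "subspace_dim k (std_flag k j \<inter> L) \<le> card (v ` (I \<inter> {..<j}))"
      by (rule subspace_dim_le(1)[OF subspace_flag_inter[OF L jk] fin sub Iv(3)[OF jk]])
    also have "\<dots> \<le> card (I \<inter> {..<j})" by (rule card_image_le) simp
    finally show ?thesis .
  qed
  then have "(\<Sum>j=1..k. \<Delta> k a j * real (subspace_dim k (std_flag k j \<inter> L)))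
      \<le> (\<Sum>j=1..k. \<Delta> k a j * real (card (I \<inter> {..<j})))"
    using \<Delta>_nonneg[OF a] by (intro sum_mono mult_left_mono) auto
  also have "\<dots> = (\<Sum>i\<in>I. a (Suc i))" by (rule \<Delta>_sum_card[OF Iv(1)])
  finally show thesis using Iv that by blast
qed

text \<open>Replaces a violating pair of subspaces by pivot sets whose weights exceed the trace and
  echelon vectors subject to equations between entries. There are finitely many
  \<open>(I, J)\<close>, which makes both the gap argument and the elimination of variables
  possible.\<close>

lemma rank_violation_echelon:
  assumes kraus: "set As \<subseteq> carrier_mat m n"
    and p: "antimono_on {1..n} p" "\<forall>j\<in>{1..n}. 0 \<le> p j"
    and q: "antimono_on {1..m} q" "\<forall>i\<in>{1..m}. 0 \<le> q i"
    and viol: "\<not> rank_nondecreasing m n As p q"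
  obtains I J v u where "I \<subseteq> {..<m}" "J \<subseteq> {..<n}"
    and "\<And>i. i \<in> I \<Longrightarrow> v i i = 1 \<and> (\<forall>s. i < s \<and> s < m \<longrightarrow> v i s = 0)"
    and "\<And>j. j \<in> J \<Longrightarrow> u j j = 1 \<and> (\<forall>s. j < s \<and> s < n \<longrightarrow> u j s = 0)"
    and "\<And>A i j. A \<in> set As \<Longrightarrow> i \<in> I \<Longrightarrow> j \<in> J \<Longrightarrow> form m n A (v i) (u j) = 0"
    and "(\<Sum>j=1..n. p j) < (\<Sum>i\<in>I. q (Suc i)) + (\<Sum>j\<in>J. p (Suc j))"
proof -
  obtain L R where ind: "cp_independent m n As L R"
    and gt: "(\<Sum>j=1..n. p j) < (\<Sum>i=1..m. \<Delta> m q i * real (subspace_dim m (std_flag m i \<inter> L))) +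
        (\<Sum>j=1..n. \<Delta> n p j * real (subspace_dim n (std_flag n j \<inter> R)))"
    using viol unfolding rank_nondecreasing_def not_all not_imp not_le by blast
  have L: "VectorSpace.subspace class_ring L (cvec_space m)"
    and R: "VectorSpace.subspace class_ring R (cvec_space n)"
    and orth: "\<And>A x y. A \<in> set As \<Longrightarrow> x \<in> L \<Longrightarrow> y \<in> R \<Longrightarrow> x \<bullet>c (A *\<^sub>v y) = 0"
    using ind unfolding cp_independent_def hermitian_complement_def by auto
  obtain I v where I: "I \<subseteq> {..<m}" "\<And>i. i \<in> I \<Longrightarrow> v i \<in> L \<and> v i $ i = 1 \<and> (\<forall>s. i < s \<and> s < m \<longrightarrow> v i $ s = 0)"
    "(\<Sum>j=1..m. \<Delta> m q j * real (subspace_dim m (std_flag m j \<inter> L))) \<le> (\<Sum>i\<in>I. q (Suc i))"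
    by (rule flag_dim_sum_le_pivots[OF L q]) (rule that; assumption)
  obtain J u where J: "J \<subseteq> {..<n}" "\<And>i. i \<in> J \<Longrightarrow> u i \<in> R \<and> u i $ i = 1 \<and> (\<forall>s. i < s \<and> s < n \<longrightarrow> u i $ s = 0)"
    "(\<Sum>j=1..n. \<Delta> n p j * real (subspace_dim n (std_flag n j \<inter> R))) \<le> (\<Sum>i\<in>J. p (Suc i))"
    by (rule flag_dim_sum_le_pivots[OF R p]) (rule that; assumption)
  have form0: "form m n A (($) (v i)) (($) (u j)) = 0" if "A \<in> set As" "i \<in> I" "j \<in> J" for A i j
  proof -
    have "v i \<in> L" "u j \<in> R" using I(2) J(2) that by auto
    moreover have "A \<in> carrier_mat m n" using kraus that by auto
    moreover have "v i \<in> carrier_vec m" "u j \<in> carrier_vec n"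
      using \<open>v i \<in> L\<close> \<open>u j \<in> R\<close> L R by (auto simp: subspace_vec_iff)
    ultimately show ?thesis
      using orth[OF that(1), of "v i" "u j"] cscalar_prod_mult_mat_vec[of A m n "v i" "u j"] by simp
  qed
  show thesis
  proof (rule that[of I J "\<lambda>i. ($) (v i)" "\<lambda>j. ($) (u j)"])
    show "(\<Sum>j=1..n. p j) < (\<Sum>i\<in>I. q (Suc i)) + (\<Sum>j\<in>J. p (Suc j))"
      using gt I(3) J(3) by linarith
  qed (use I(1,2) J(1,2) form0 in blast)+
qed

text \<open>The vectors selected at level \<open>a\<close> are orthonormal and lie in flag member
  \<open>a\<close> as well as in \<open>L\<close>, so their number is a lower bound for the
  dimension of the intersection. Vectors of different levels may be linearly dependent; each level
  is counted on its own.\<close>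

lemma flag_families_dim:
  assumes S: "S \<subseteq> Sigma {1..k} (\<lambda>a. {..<a})"
    and V: "\<And>a. a \<in> {1..k} \<Longrightarrow> orthonormal k (V a) {..<a}"
    and V0: "\<And>a i s. a \<le> s \<Longrightarrow> V a i s = 0"
    and a: "antimono_on {1..k} w" "\<forall>j\<in>{1..k}. 0 \<le> w j"
  defines "L \<equiv> vspan k ((\<lambda>(a, i). vec k (V a i)) ` S)"
  shows "(\<Sum>(a, i)\<in>S. \<Delta> k w a) \<le> (\<Sum>j=1..k. \<Delta> k w j * real (subspace_dim k (std_flag k j \<inter> L)))"
proof -
  have car: "(\<lambda>(a, i). vec k (V a i)) ` S \<subseteq> carrier_vec k" by auto
  have L: "VectorSpace.subspace class_ring L (cvec_space k)"
    unfolding L_def by (rule subspace_span[OF car])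
  define T where "T a = {i. (a, i) \<in> S}" for a
  have T: "T a \<subseteq> {..<a}" for a using S by (auto simp: T_def)
  have finT: "finite (T a)" for a using T finite_subset by blast
  have ST: "S = Sigma {1..k} T" using S by (auto simp: T_def)
  have "(\<Sum>(a, i)\<in>S. \<Delta> k w a) = (\<Sum>a=1..k. \<Sum>i\<in>T a. \<Delta> k w a)"
    unfolding ST by (subst sum.Sigma[symmetric]) (use finT in auto)
  also have "\<dots> = (\<Sum>a=1..k. \<Delta> k w a * real (card (T a)))" by (simp add: mult.commute)
  also have "\<dots> \<le> (\<Sum>a=1..k. \<Delta> k w a * real (subspace_dim k (std_flag k a \<inter> L)))"
  proof (intro sum_mono mult_left_mono)
    fix a assume a': "a \<in> {1..k}"
    show "0 \<le> \<Delta> k w a" using \<Delta>_nonneg[OF a a'] .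
    have ak: "a \<le> k" using a' by simp
    have "card (T a) \<le> subspace_dim k (std_flag k a \<inter> L)"
    proof (rule card_le_subspace_dim[where u = "V a"])
      show "VectorSpace.subspace class_ring (std_flag k a \<inter> L) (cvec_space k)"
        by (rule subspace_flag_inter[OF L ak])
      show "finite (T a)" by (rule finT)
      fix s assume s: "s \<in> T a"
      have "vec k (V a s) \<in> L"
        unfolding L_def using span_superset[OF car] s by (auto simp: T_def)
      moreover have "vec k (V a s) \<in> std_flag k a"
        unfolding std_flag_iff[OF ak] using V0 by auto
      ultimately show "vec k (V a s) \<in> std_flag k a \<inter> L" by simp
      fix t assume t: "t \<in> T a"
      have "s \<in> {..<a}" "t \<in> {..<a}" using s t T by auto
      then show "(\<Sum>i<k. cnj (V a s i) * V a t i) = (if s = t then 1 else 0)"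
        using V[OF a'] unfolding orthonormal_def cip_def by blast
    qed
    then show "real (card (T a)) \<le> real (subspace_dim k (std_flag k a \<inter> L))" by simp
  qed
  finally show ?thesis .
qed

text \<open>This is Hall's condition for the overlap graph: a selection without overlaps spans a
  \<open>T\<close>-independent pair, because the vanishing of \<open>form\<close> extends from
  generators to spans.\<close>

lemma rank_nondecreasing_families:
  assumes rank: "rank_nondecreasing m n As p q" and kraus: "set As \<subseteq> carrier_mat m n"
    and p: "antimono_on {1..n} p" "\<forall>j\<in>{1..n}. 0 \<le> p j"
    and q: "antimono_on {1..m} q" "\<forall>i\<in>{1..m}. 0 \<le> q i"
    and V: "\<And>a. a \<in> {1..m} \<Longrightarrow> orthonormal m (V a) {..<a}" "\<And>a i s. a \<le> s \<Longrightarrow> V a i s = 0"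
    and U: "\<And>b. b \<in> {1..n} \<Longrightarrow> orthonormal n (U b) {..<b}" "\<And>b j s. b \<le> s \<Longrightarrow> U b j s = 0"
    and S: "S \<subseteq> Sigma {1..m} (\<lambda>a. {..<a})" and S': "S' \<subseteq> Sigma {1..n} (\<lambda>b. {..<b})"
    and zero: "\<And>A a i b j. A \<in> set As \<Longrightarrow> (a, i) \<in> S \<Longrightarrow> (b, j) \<in> S' \<Longrightarrow> form m n A (V a i) (U b j) = 0"
  shows "(\<Sum>(a, i)\<in>S. \<Delta> m q a) + (\<Sum>(b, j)\<in>S'. \<Delta> n p b) \<le> (\<Sum>j=1..n. p j)"
proof -
  let ?BL = "(\<lambda>(a, i). vec m (V a i)) ` S" and ?BR = "(\<lambda>(b, j). vec n (U b j)) ` S'"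
  let ?L = "vspan m ?BL" and ?R = "vspan n ?BR"
  have carL: "?BL \<subseteq> carrier_vec m" and carR: "?BR \<subseteq> carrier_vec n" by auto
  note sL = subspace_span[OF carL] and sR = subspace_span[OF carR]
  have Lc: "?L \<subseteq> carrier_vec m" and Rc: "?R \<subseteq> carrier_vec n"
    using sL sR by (auto simp: subspace_vec_iff)
  have orth: "x \<bullet>c (A *\<^sub>v y) = 0" if A: "A \<in> set As" and x: "x \<in> ?L" and y: "y \<in> ?R" for A x y
  proof -
    have Ac: "A \<in> carrier_mat m n" using kraus A by auto
    have f0: "form m n A (($) x) (($) y) = 0" if x: "x \<in> ?BL" and y: "y \<in> ?BR" for x y
    proof -
      obtain a i b j where x': "x = vec m (V a i)" "(a, i) \<in> S" and y': "y = vec n (U b j)" "(b, j) \<in> S'"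
        using x y by auto
      have "form m n A (($) x) (($) y) = form m n A (V a i) (U b j)"
        unfolding form_def x' y' by (intro sum.cong) auto
      then show ?thesis using zero[OF A x'(2) y'(2)] by simp
    qed
    \<comment> \<open>The extension takes one argument at a time: first in \<open>x\<close> for a
      fixed generator \<open>y\<close>, then in \<open>y\<close> for a fixed \<open>x\<close> of the
      span.\<close>
    have "?L \<subseteq> {x \<in> carrier_vec m. form m n A (($) x) (($) y) = 0}" if y: "y \<in> ?BR" for y
    proof (rule span_least)
      show "VectorSpace.subspace class_ring {x \<in> carrier_vec m. form m n A (($) x) (($) y) = 0} (cvec_space m)"
        unfolding subspace_vec_iff
        by (auto simp: form_def distrib_right sum.distrib mult.assoc sum_distrib_left[symmetric])
    qed (use f0 y carL in auto)
    then have x0: "form m n A (($) x) (($) y) = 0" if "y \<in> ?BR" for y using that x by auto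
    have "?R \<subseteq> {y \<in> carrier_vec n. form m n A (($) x) (($) y) = 0}"
    proof (rule span_least)
      show "VectorSpace.subspace class_ring {y \<in> carrier_vec n. form m n A (($) x) (($) y) = 0} (cvec_space n)"
        unfolding subspace_vec_iff
        by (auto simp: form_def distrib_left sum.distrib mult.left_commute sum_distrib_left[symmetric])
    qed (use x0 carR in auto)
    then have "form m n A (($) x) (($) y) = 0" using y by auto
    then show ?thesis
      using cscalar_prod_mult_mat_vec[OF Ac, of x y] x y Lc Rc by auto
  qed
  have "cp_independent m n As ?L ?R"
    unfolding cp_independent_def hermitian_complement_def using sL sR orth Lc by auto
  then have "(\<Sum>i=1..m. \<Delta> m q i * real (subspace_dim m (std_flag m i \<inter> ?L))) +
        (\<Sum>j=1..n. \<Delta> n p j * real (subspace_dim n (std_flag n j \<inter> ?R))) \<le> (\<Sum>j=1..n. p j)"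
    using rank unfolding rank_nondecreasing_def by blast
  then show ?thesis
    using flag_families_dim[OF S V q] flag_families_dim[OF S' U p] by linarith
qed

section \<open>Scalings with nearly correct marginals\<close>

lemma bessel_identity:
  assumes fin: "finite I" and orth: "orthonormal k U I"
  shows "nsq k (\<lambda>a. x a - (\<Sum>i\<in>I. cip k (U i) x * U i a)) = nsq k x - (\<Sum>i\<in>I. (cmod (cip k (U i) x))\<^sup>2)"
proof -
  let ?c = "\<lambda>i. cip k (U i) x"
  let ?p = "\<lambda>a. \<Sum>i\<in>I. ?c i * U i a"
  have Up: "cip k (U i) ?p = ?c i" if "i \<in> I" for i
  proof -
    have "cip k (U i) ?p = (\<Sum>j\<in>I. ?c j * cip k (U i) (U j))"
      by (simp add: cip_sum_right cip_scale_right)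
    also have "\<dots> = (\<Sum>j\<in>I. if i = j then ?c j else 0)"
      using orth that by (intro sum.cong) (auto simp: orthonormal_def)
    also have "\<dots> = ?c i" using that fin by simp
    finally show ?thesis .
  qed
  have xp: "cip k ?p y = (\<Sum>i\<in>I. cnj (?c i) * cip k (U i) y)" for y
    by (simp add: cip_sum_left cip_scale_left)
  have px: "cip k y ?p = (\<Sum>i\<in>I. ?c i * cip k y (U i))" for y
    by (simp add: cip_sum_right cip_scale_right)
  have sq: "cnj z * z = of_real ((cmod z)\<^sup>2)" for z
    by (simp add: complex_norm_square mult.commute del: of_real_power)
  have "cip k (\<lambda>a. x a - ?p a) (\<lambda>a. x a - ?p a) = cip k x x - cip k x ?p - (cip k ?p x - cip k ?p ?p)"
    by (simp only: cip_diff_left cip_diff_right)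
  also have "cip k ?p ?p = (\<Sum>i\<in>I. of_real ((cmod (?c i))\<^sup>2))"
    unfolding xp using Up by (intro sum.cong refl) (simp only: sq)
  also have "cip k ?p x = (\<Sum>i\<in>I. of_real ((cmod (?c i))\<^sup>2))"
    unfolding xp by (intro sum.cong refl) (simp only: sq)
  also have "cip k x ?p = (\<Sum>i\<in>I. of_real ((cmod (?c i))\<^sup>2))"
    unfolding px by (intro sum.cong refl) (simp only: cip_cnj[symmetric, of k x] complex_norm_square)
  finally show ?thesis
    by (simp add: nsq_Re_cip del: of_real_power)
qed

lemma bessel_inequality:
  assumes "finite I" "orthonormal k U I"
  shows "(\<Sum>i\<in>I. (cmod (cip k (U i) x))\<^sup>2) \<le> nsq k x"
  using bessel_identity[OF assms, of x] nsq_nonneg[of k "\<lambda>a. x a - (\<Sum>i\<in>I. cip k (U i) x * U i a)"] by linarith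

text \<open>Gram-Schmidt along increasing pivots. \<open>N\<close> is a property closed under linear
  combinations; it will be the vanishing of pairings. The earlier vectors vanish beyond their own
  pivots, so subtracting them keeps the echelon shape.\<close>

lemma orthonormalize_echelon:
  fixes w :: "nat \<Rightarrow> nat \<Rightarrow> complex"
  assumes I: "I \<subseteq> {..<k}" and w: "\<And>i. i \<in> I \<Longrightarrow> w i i = 1 \<and> (\<forall>s. i < s \<and> s < k \<longrightarrow> w i s = 0)"
    and N: "\<And>i. i \<in> I \<Longrightarrow> N (w i)" "\<And>x y. N x \<Longrightarrow> N y \<Longrightarrow> N (\<lambda>s. x s + y s)" "\<And>c x. N x \<Longrightarrow> N (\<lambda>s. c * x s)"
    and N0: "N (\<lambda>s. 0)"
  shows "\<exists>v. orthonormal k v I \<and> (\<forall>i\<in>I. N (v i) \<and> (\<forall>s. i < s \<and> s < k \<longrightarrow> v i s = 0))"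
proof -
  have Nsum: "N (\<lambda>s. \<Sum>i\<in>A. x i s)" if "finite A" "\<And>i. i \<in> A \<Longrightarrow> N (x i)" for A :: "nat set" and x
    using that by (induction A rule: finite_induct) (auto intro: N N0)
  have "\<exists>v. orthonormal k v (I \<inter> {..<t}) \<and> (\<forall>i\<in>I \<inter> {..<t}. N (v i) \<and> (\<forall>s. i < s \<and> s < k \<longrightarrow> v i s = 0))" for t
  proof (induction t)
    case 0
    show ?case by (simp add: orthonormal_def)
  next
    case (Suc t)
    then obtain v where v: "orthonormal k v (I \<inter> {..<t})"
      and vN: "\<And>i. i \<in> I \<inter> {..<t} \<Longrightarrow> N (v i)"
      and v0: "\<And>i s. i \<in> I \<inter> {..<t} \<Longrightarrow> i < s \<Longrightarrow> s < k \<Longrightarrow> v i s = 0"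
      by blast
    show ?case
    proof (cases "t \<in> I")
      case False
      then have "I \<inter> {..<Suc t} = I \<inter> {..<t}" by (auto simp: less_Suc_eq)
      then show ?thesis using Suc by simp
    next
      case True
      then have tk: "t < k" using I by auto
      define c where "c i = cip k (v i) (w t)" for i
      define x where "x s = w t s + (\<Sum>i\<in>I \<inter> {..<t}. - c i * v i s)" for s
      have xN: "N x" unfolding x_def using True vN by (intro N(2) N(1) Nsum N(3)) auto
      have xs: "x s = 0" if "t < s" "s < k" for s
        unfolding x_def using w[OF True] v0 that by (auto intro!: sum.neutral)
      \<comment> \<open>The earlier vectors vanish at position \<open>t\<close>, so the entry 1 of
        \<open>w t\<close> survives and the remainder is nonzero.\<close>
      have "x t = 1"
        unfolding x_def using w[OF True] v0 tk by (auto intro!: sum.neutral)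
      then have "nsq k x \<noteq> 0" using nsq_eq_0[of k x t] tk by auto
      then have pos: "0 < nsq k x" using nsq_nonneg[of k x] by linarith
      have vx: "cip k (v i) x = 0" if i: "i \<in> I \<inter> {..<t}" for i
      proof -
        have "cip k (v i) x = c i + (\<Sum>j\<in>I \<inter> {..<t}. - c j * cip k (v i) (v j))"
          unfolding x_def by (simp only: cip_add_right cip_sum_right cip_scale_right c_def)
        also have "(\<Sum>j\<in>I \<inter> {..<t}. - c j * cip k (v i) (v j)) = (\<Sum>j\<in>I \<inter> {..<t}. if i = j then - c j else 0)"
          using v i by (intro sum.cong) (auto simp: orthonormal_def)
        also have "\<dots> = - c i" using i by simp
        finally show ?thesis by simp
      qed
      define r where "r = complex_of_real (1 / sqrt (nsq k x))"
      define y where "y s = r * x s" for s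
      have yeq: "y = (\<lambda>s. r * x s)" by (auto simp: y_def)
      have yN: "N y" unfolding yeq by (rule N(3)[OF xN])
      have vy: "cip k (v i) y = 0" if "i \<in> I \<inter> {..<t}" for i
        unfolding yeq cip_scale_right vx[OF that] by simp
      have yv: "cip k y (v i) = 0" if "i \<in> I \<inter> {..<t}" for i
        using vy[OF that] cip_cnj[of k "v i" y] by simp
      have "nsq k y = (cmod r)\<^sup>2 * nsq k x"
        by (simp add: y_def nsq_def norm_mult power_mult_distrib sum_distrib_left)
      also have "\<dots> = 1" using pos by (simp add: r_def power_divide norm_divide)
      finally have yy: "cip k y y = 1" by (simp add: cip_self)
      have Ieq: "I \<inter> {..<Suc t} = insert t (I \<inter> {..<t})" using True by auto
      have "orthonormal k (v(t := y)) (I \<inter> {..<Suc t})"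
        unfolding Ieq using v vy yv yy by (auto simp: orthonormal_def)
      moreover have "\<forall>i\<in>I \<inter> {..<Suc t}. N ((v(t := y)) i) \<and> (\<forall>s. i < s \<and> s < k \<longrightarrow> (v(t := y)) i s = 0)"
        unfolding Ieq using vN v0 yN xs by (auto simp: y_def)
      ultimately show ?thesis by blast
    qed
  qed
  from this[of k] show ?thesis using I by (simp add: Int_absorb2)
qed

lemma form_add_left: "form m n A (\<lambda>s. x s + y s) z = form m n A x z + form m n A y z"
  by (simp add: form_def distrib_right sum.distrib)

lemma form_scale_left: "form m n A (\<lambda>s. c * x s) z = cnj c * form m n A x z"
  by (simp add: form_def sum_distrib_left mult_ac)

lemma form_add_right: "form m n A z (\<lambda>s. x s + y s) = form m n A z x + form m n A z y"
  by (simp add: form_def distrib_left sum.distrib)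

lemma form_scale_right: "form m n A z (\<lambda>s. c * x s) = c * form m n A z x"
  by (simp add: form_def sum_distrib_left mult_ac)

text \<open>If the families span \<open>L\<close> and \<open>R\<close>, this says that a matrix mapping \<open>R\<close> into the orthogonal
  complement of \<open>L\<close> has two orthogonal parts: its restriction to \<open>R\<close> and its corestriction to \<open>L\<close>.\<close>

lemma independent_frobenius_bound:
  assumes I: "finite I" "orthonormal m v I" and J: "finite J" "orthonormal n u J"
    and zero: "\<And>i j. i \<in> I \<Longrightarrow> j \<in> J \<Longrightarrow> form m n A (v i) (u j) = 0"
  shows "(\<Sum>i\<in>I. \<Sum>b<n. (cmod (\<Sum>a<m. cnj (v i a) * A $$ (a, b)))\<^sup>2) + (\<Sum>j\<in>J. \<Sum>a<m. (cmod (\<Sum>b<n. A $$ (a, b) * u j b))\<^sup>2)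
    \<le> (\<Sum>a<m. \<Sum>b<n. (cmod (A $$ (a, b)))\<^sup>2)"
proof -
  \<comment> \<open>\<open>w a\<close> is the conjugated row \<open>a\<close> of \<open>A\<close>;
    \<open>w'\<close> removes from every row its part along the vectors \<open>u j\<close>, and
    Bessel's identity measures what is removed.\<close>
  define w where "w a b = cnj (A $$ (a, b))" for a b
  define w' where "w' a b = w a b - (\<Sum>j\<in>J. cip n (u j) (w a) * u j b)" for a b
  have rows: "nsq n (w' a) = nsq n (w a) - (\<Sum>j\<in>J. (cmod (cip n (u j) (w a)))\<^sup>2)" for a
    unfolding w'_def by (rule bessel_identity[OF J])
  have uw: "cip n (u j) (w a) = cnj (\<Sum>b<n. A $$ (a, b) * u j b)" for j a
    by (simp add: cip_def w_def mult.commute)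
  have cols: "(\<Sum>i\<in>I. (cmod (cip m (v i) (\<lambda>a. cnj (w' a b))))\<^sup>2) \<le> nsq m (\<lambda>a. cnj (w' a b))" for b
    by (rule bessel_inequality[OF I])
  \<comment> \<open>Pairing with \<open>v i\<close> does not see the removed part, which contributes
    multiples of \<open>form m n A (v i) (u j) = 0\<close>. Hence Bessel's inequality for the
    columns of the remainder bounds the corestriction.\<close>
  have vw: "cip m (v i) (\<lambda>a. cnj (w' a b)) = (\<Sum>a<m. cnj (v i a) * A $$ (a, b))" if "i \<in> I" for i b
  proof -
    have "cip m (v i) (\<lambda>a. cnj (w' a b)) = (\<Sum>a<m. cnj (v i a) * A $$ (a, b))
        - (\<Sum>a<m. \<Sum>j\<in>J. cnj (u j b) * (cnj (v i a) * (\<Sum>b<n. A $$ (a, b) * u j b)))"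
      by (simp add: cip_def[of m] w'_def w_def[of _ b] uw right_diff_distrib sum_subtractf sum_distrib_left mult_ac)
    also have "(\<Sum>a<m. \<Sum>j\<in>J. cnj (u j b) * (cnj (v i a) * (\<Sum>b<n. A $$ (a, b) * u j b)))
        = (\<Sum>j\<in>J. cnj (u j b) * form m n A (v i) (u j))"
      by (subst sum.swap) (simp add: form_def sum_distrib_left mult_ac)
    also have "\<dots> = 0" using zero[OF that] by simp
    finally show ?thesis by simp
  qed
  have "(\<Sum>i\<in>I. \<Sum>b<n. (cmod (\<Sum>a<m. cnj (v i a) * A $$ (a, b)))\<^sup>2)
      = (\<Sum>i\<in>I. \<Sum>b<n. (cmod (cip m (v i) (\<lambda>a. cnj (w' a b))))\<^sup>2)"
    using vw by simp
  also have "\<dots> = (\<Sum>b<n. \<Sum>i\<in>I. (cmod (cip m (v i) (\<lambda>a. cnj (w' a b))))\<^sup>2)"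
    by (rule sum.swap)
  also have "\<dots> \<le> (\<Sum>b<n. nsq m (\<lambda>a. cnj (w' a b)))" by (intro sum_mono cols)
  also have "\<dots> = (\<Sum>a<m. nsq n (w' a))"
    unfolding nsq_def by (subst sum.swap) simp
  also have "\<dots> = (\<Sum>a<m. nsq n (w a)) - (\<Sum>a<m. \<Sum>j\<in>J. (cmod (\<Sum>b<n. A $$ (a, b) * u j b))\<^sup>2)"
    unfolding rows uw complex_mod_cnj by (simp only: sum_subtractf)
  also have "(\<Sum>a<m. nsq n (w a)) = (\<Sum>a<m. \<Sum>b<n. (cmod (A $$ (a, b)))\<^sup>2)"
    by (simp add: nsq_def w_def)
  also have "(\<Sum>a<m. \<Sum>j\<in>J. (cmod (\<Sum>b<n. A $$ (a, b) * u j b))\<^sup>2)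
      = (\<Sum>j\<in>J. \<Sum>a<m. (cmod (\<Sum>b<n. A $$ (a, b) * u j b))\<^sup>2)"
    by (rule sum.swap)
  finally show ?thesis by linarith
qed

section \<open>Quadratic forms of a completely positive map and of its dual\<close>

lemma cp_dual_eq_cp_map: "cp_dual n As Y = cp_map n (map mat_adjoint As) Y"
  by (induction As) (simp_all add: cp_dual_def cp_map_def)

lemma sandwich_index:
  fixes A X :: "complex mat"
  assumes "A \<in> carrier_mat m n" "X \<in> carrier_mat n n" "i < m" "j < m"
  shows "(A * X * mat_adjoint A) $$ (i, j) = (\<Sum>c<n. (\<Sum>b<n. A $$ (i, b) * X $$ (b, c)) * cnj (A $$ (j, c)))"
  using assms by (simp add: scalar_prod_def lessThan_atLeast0)

lemma cp_map_index:
  assumes "set As \<subseteq> carrier_mat m n" "X \<in> carrier_mat n n" "i < m" "j < m"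
  shows "cp_map m As X $$ (i, j) = (\<Sum>l<length As. (As ! l * X * mat_adjoint (As ! l)) $$ (i, j))"
  using assms(1)
proof (induction As)
  case Nil
  then show ?case using assms by (simp add: cp_map_def)
next
  case (Cons A As)
  have "cp_map m As X \<in> carrier_mat m m" using Cons.prems by (intro cp_map_carrier) auto
  moreover have "cp_map m (A # As) X = A * X * mat_adjoint A + cp_map m As X"
    by (simp add: cp_map_def)
  ultimately have "cp_map m (A # As) X $$ (i, j) = (A * X * mat_adjoint A) $$ (i, j) + cp_map m As X $$ (i, j)"
    using assms(3,4) by simp
  also have "cp_map m As X $$ (i, j) = (\<Sum>l<length As. (As ! l * X * mat_adjoint (As ! l)) $$ (i, j))"
    using Cons by simp
  finally show ?case by (simp add: sum.lessThan_Suc_shift del: sum.lessThan_Suc)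
qed

lemma sum_product_scaled:
  fixes c :: complex
  shows "c * ((\<Sum>a\<in>A. f a) * (\<Sum>b\<in>B. g b)) = (\<Sum>a\<in>A. \<Sum>b\<in>B. c * (f a * g b))"
  by (subst sum_product) (simp only: sum_distrib_left)

lemma gram_hermitian:
  assumes "\<And>a b. a < m \<Longrightarrow> b < m \<Longrightarrow> Z a b = (\<Sum>k\<in>K. of_real (d k) * g a k * cnj (g b k))"
  shows "hermitian m Z"
  unfolding hermitian_def using assms by (auto intro!: sum.cong simp: mult_ac)

lemma gram_quadratic_form:
  assumes Z: "\<And>a b. a < m \<Longrightarrow> b < m \<Longrightarrow> Z a b = (\<Sum>k\<in>K. of_real (d k) * g a k * cnj (g b k))"
  shows "cip m x (mv m Z x) = of_real (\<Sum>k\<in>K. d k * (cmod (\<Sum>a<m. cnj (x a) * g a k))\<^sup>2)"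
proof -
  have "cip m x (mv m Z x) = (\<Sum>a<m. \<Sum>b<m. \<Sum>k\<in>K. of_real (d k) * ((cnj (x a) * g a k) * cnj (cnj (x b) * g b k)))"
    by (simp add: cip_def mv_def Z sum_distrib_left sum_distrib_right mult_ac)
  also have "\<dots> = (\<Sum>k\<in>K. \<Sum>a<m. \<Sum>b<m. of_real (d k) * ((cnj (x a) * g a k) * cnj (cnj (x b) * g b k)))"
    by (rule sum_rotate[symmetric])
  also have "\<dots> = (\<Sum>k\<in>K. of_real (d k) * ((\<Sum>a<m. cnj (x a) * g a k) * cnj (\<Sum>b<m. cnj (x b) * g b k)))"
    by (simp only: sum_product_scaled cnj_sum)
  also have "\<dots> = of_real (\<Sum>k\<in>K. d k * (cmod (\<Sum>a<m. cnj (x a) * g a k))\<^sup>2)"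
    by (simp only: complex_norm_square[symmetric] of_real_mult of_real_sum)
  finally show ?thesis .
qed

text \<open>If \<open>X\<close> is a weighted sum of rank-one matrices \<open>H_k H_k^+\<close>,
  then \<open>T(X)\<close> is the sum, with the same weights, of
  \<open>(A_l H_k) (A_l H_k)^+\<close> over all pairs \<open>(l, k)\<close>. Hermiticity and the
  quadratic form are then instances of the Gram lemmas above.\<close>

lemma cp_map_gram:
  assumes As: "set As \<subseteq> carrier_mat m n" and X: "X \<in> carrier_mat n n"
    and XH: "\<And>b c. b < n \<Longrightarrow> c < n \<Longrightarrow> X $$ (b, c) = (\<Sum>k<N. of_real (d k) * H b k * cnj (H c k))"
    and ij: "i < m" "j < m"
  shows "cp_map m As X $$ (i, j) = (\<Sum>(l, k)\<in>{..<length As} \<times> {..<N}. of_real (d k)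
     * (\<Sum>b<n. As ! l $$ (i, b) * H b k) * cnj (\<Sum>b<n. As ! l $$ (j, b) * H b k))"
proof -
  have "(As ! l * X * mat_adjoint (As ! l)) $$ (i, j) = (\<Sum>k<N. of_real (d k)
     * (\<Sum>b<n. As ! l $$ (i, b) * H b k) * cnj (\<Sum>b<n. As ! l $$ (j, b) * H b k))" if l: "l < length As" for l
  proof -
    have A: "As ! l \<in> carrier_mat m n" using As l by auto
    have "(As ! l * X * mat_adjoint (As ! l)) $$ (i, j)
       = (\<Sum>c<n. \<Sum>b<n. As ! l $$ (i, b) * X $$ (b, c) * cnj (As ! l $$ (j, c)))"
      by (simp add: sandwich_index[OF A X ij] sum_distrib_right)
    also have "\<dots> = (\<Sum>c<n. \<Sum>b<n. \<Sum>k<N. of_real (d k) * ((As ! l $$ (i, b) * H b k) * cnj (As ! l $$ (j, c) * H c k)))"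
      by (intro sum.cong refl) (simp add: XH sum_distrib_left sum_distrib_right mult_ac)
    also have "\<dots> = (\<Sum>k<N. \<Sum>c<n. \<Sum>b<n. of_real (d k) * ((As ! l $$ (i, b) * H b k) * cnj (As ! l $$ (j, c) * H c k)))"
      by (rule sum_rotate[symmetric])
    also have "\<dots> = (\<Sum>k<N. of_real (d k) * (\<Sum>b<n. As ! l $$ (i, b) * H b k) * cnj (\<Sum>b<n. As ! l $$ (j, b) * H b k))"
    proof (intro sum.cong refl)
      fix k
      have "(\<Sum>c<n. \<Sum>b<n. of_real (d k) * ((As ! l $$ (i, b) * H b k) * cnj (As ! l $$ (j, c) * H c k)))
         = (\<Sum>b<n. \<Sum>c<n. of_real (d k) * ((As ! l $$ (i, b) * H b k) * cnj (As ! l $$ (j, c) * H c k)))"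
        by (rule sum.swap)
      also have "\<dots> = of_real (d k) * ((\<Sum>b<n. As ! l $$ (i, b) * H b k) * cnj (\<Sum>b<n. As ! l $$ (j, b) * H b k))"
        by (simp only: sum_product_scaled cnj_sum)
      finally show "(\<Sum>c<n. \<Sum>b<n. of_real (d k) * ((As ! l $$ (i, b) * H b k) * cnj (As ! l $$ (j, c) * H c k)))
         = of_real (d k) * (\<Sum>b<n. As ! l $$ (i, b) * H b k) * cnj (\<Sum>b<n. As ! l $$ (j, b) * H b k)"
        by (simp only: mult.assoc)
    qed
    finally show ?thesis .
  qed
  then have "cp_map m As X $$ (i, j) = (\<Sum>l<length As. \<Sum>k<N. of_real (d k)
     * (\<Sum>b<n. As ! l $$ (i, b) * H b k) * cnj (\<Sum>b<n. As ! l $$ (j, b) * H b k))"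
    by (simp add: cp_map_index[OF As X ij])
  then show ?thesis by (simp only: sum.cartesian_product)
qed

lemma cp_map_hermitian_quadratic:
  assumes As: "set As \<subseteq> carrier_mat m n" and X: "X \<in> carrier_mat n n"
    and XH: "\<And>b c. b < n \<Longrightarrow> c < n \<Longrightarrow> X $$ (b, c) = (\<Sum>k<N. of_real (d k) * H b k * cnj (H c k))"
  shows "hermitian m (\<lambda>i j. cp_map m As X $$ (i, j))"
    and "cip m x (mv m (\<lambda>i j. cp_map m As X $$ (i, j)) x)
      = of_real (\<Sum>l<length As. \<Sum>k<N. d k * (cmod (form m n (As ! l) x (\<lambda>b. H b k)))\<^sup>2)"
proof -
  define K where "K = {..<length As} \<times> {..<N}"
  define g where "g a lk = (\<Sum>b<n. As ! fst lk $$ (a, b) * H b (snd lk))" for a lk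
  have Z: "cp_map m As X $$ (i, j) = (\<Sum>lk\<in>K. of_real (d (snd lk)) * g i lk * cnj (g j lk))"
    if "i < m" "j < m" for i j
  proof -
    have "cp_map m As X $$ (i, j) = (\<Sum>(l, k)\<in>{..<length As} \<times> {..<N}. of_real (d k)
     * (\<Sum>b<n. As ! l $$ (i, b) * H b k) * cnj (\<Sum>b<n. As ! l $$ (j, b) * H b k))"
      by (rule cp_map_gram[OF As X _ that]) (rule XH)
    then show ?thesis unfolding K_def g_def by (simp only: case_prod_unfold)
  qed
  show "hermitian m (\<lambda>i j. cp_map m As X $$ (i, j))"
    by (rule gram_hermitian) (rule Z)
  have "cip m x (mv m (\<lambda>i j. cp_map m As X $$ (i, j)) x)
     = of_real (\<Sum>lk\<in>K. d (snd lk) * (cmod (\<Sum>a<m. cnj (x a) * g a lk))\<^sup>2)"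
    by (rule gram_quadratic_form) (rule Z)
  also have "(\<Sum>lk\<in>K. d (snd lk) * (cmod (\<Sum>a<m. cnj (x a) * g a lk))\<^sup>2)
     = (\<Sum>l<length As. \<Sum>k<N. d k * (cmod (form m n (As ! l) x (\<lambda>b. H b k)))\<^sup>2)"
    unfolding K_def g_def form_def
    by (simp add: sum.cartesian_product split_beta sum_distrib_left mult.assoc)
  finally show "cip m x (mv m (\<lambda>i j. cp_map m As X $$ (i, j)) x)
      = of_real (\<Sum>l<length As. \<Sum>k<N. d k * (cmod (form m n (As ! l) x (\<lambda>b. H b k)))\<^sup>2)" .
qed

lemma one_gram:
  "b < n \<Longrightarrow> c < n \<Longrightarrow> (1\<^sub>m n :: complex mat) $$ (b, c)
    = (\<Sum>k<n. of_real ((\<lambda>_. 1) k) * (if b = k then 1 else 0) * cnj (if c = k then 1 else 0))"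
  by (simp add: if_distrib cong: if_cong)

lemma form_unit:
  assumes "k < n"
  shows "form m n A x (\<lambda>b. if b = k then 1 else 0) = (\<Sum>a<m. cnj (x a) * A $$ (a, k))"
  using assms by (simp add: form_def if_distrib cong: if_cong)

lemma cp_map_one_quadratic:
  assumes "set As \<subseteq> carrier_mat m n"
  shows "cip m x (mv m (\<lambda>i j. cp_map m As (1\<^sub>m n) $$ (i, j)) x)
      = of_real (\<Sum>l<length As. \<Sum>b<n. (cmod (\<Sum>a<m. cnj (x a) * As ! l $$ (a, b)))\<^sup>2)"
  using cp_map_hermitian_quadratic(2)[OF assms one_carrier_mat one_gram]
  by (simp add: form_unit)

lemma cp_dual_one_quadratic:
  assumes As: "set As \<subseteq> carrier_mat m n"
  shows "cip n y (mv n (\<lambda>i j. cp_dual n As (1\<^sub>m m) $$ (i, j)) y)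
      = of_real (\<Sum>l<length As. \<Sum>a<m. (cmod (\<Sum>b<n. As ! l $$ (a, b) * y b))\<^sup>2)"
proof -
  have "set (map mat_adjoint As) \<subseteq> carrier_mat n m" using As by auto
  from cp_map_one_quadratic[OF this, of y]
  have "cip n y (mv n (\<lambda>i j. cp_dual n As (1\<^sub>m m) $$ (i, j)) y)
    = of_real (\<Sum>l<length As. \<Sum>a<m. (cmod (\<Sum>b<n. cnj (y b) * map mat_adjoint As ! l $$ (b, a)))\<^sup>2)"
    by (simp add: cp_dual_eq_cp_map)
  also have "(\<Sum>l<length As. \<Sum>a<m. (cmod (\<Sum>b<n. cnj (y b) * map mat_adjoint As ! l $$ (b, a)))\<^sup>2)
    = (\<Sum>l<length As. \<Sum>a<m. (cmod (\<Sum>b<n. As ! l $$ (a, b) * y b))\<^sup>2)"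
  proof (intro sum.cong refl)
    fix l a assume l: "l \<in> {..<length As}" "a \<in> {..<m}"
    then have "As ! l \<in> carrier_mat m n" using As by auto
    then have "(\<Sum>b<n. cnj (y b) * map mat_adjoint As ! l $$ (b, a)) = cnj (\<Sum>b<n. As ! l $$ (a, b) * y b)"
      using l by (simp add: mult.commute)
    then show "(cmod (\<Sum>b<n. cnj (y b) * map mat_adjoint As ! l $$ (b, a)))\<^sup>2 = (cmod (\<Sum>b<n. As ! l $$ (a, b) * y b))\<^sup>2"
      by (simp only: complex_mod_cnj)
  qed
  finally show ?thesis .
qed

lemma cp_map_one_trace:
  assumes As: "set As \<subseteq> carrier_mat m n"
  shows "(\<Sum>a<m. cp_map m As (1\<^sub>m n) $$ (a, a)) = of_real (\<Sum>l<length As. \<Sum>a<m. \<Sum>b<n. (cmod (As ! l $$ (a, b)))\<^sup>2)"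
proof -
  have "cp_map m As (1\<^sub>m n) $$ (a, a) = of_real (\<Sum>l<length As. \<Sum>b<n. (cmod (As ! l $$ (a, b)))\<^sup>2)" if "a < m" for a
  proof -
    have "cip m (\<lambda>s. if s = a then 1 else 0) (mv m (\<lambda>i j. cp_map m As (1\<^sub>m n) $$ (i, j)) (\<lambda>s. if s = a then 1 else 0))
       = cp_map m As (1\<^sub>m n) $$ (a, a)"
      using that by (simp add: cip_def mv_def if_distrib if_distribR cong: if_cong)
    then show ?thesis
      using cp_map_one_quadratic[OF As, of "\<lambda>s. if s = a then 1 else 0"] that
      by (simp add: if_distrib if_distribR cong: if_cong)
  qed
  then have "(\<Sum>a<m. cp_map m As (1\<^sub>m n) $$ (a, a)) = (\<Sum>a<m. of_real (\<Sum>l<length As. \<Sum>b<n. (cmod (As ! l $$ (a, b)))\<^sup>2))"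
    by simp
  also have "\<dots> = of_real (\<Sum>a<m. \<Sum>l<length As. \<Sum>b<n. (cmod (As ! l $$ (a, b)))\<^sup>2)" by simp
  also have "(\<Sum>a<m. \<Sum>l<length As. \<Sum>b<n. (cmod (As ! l $$ (a, b)))\<^sup>2) = (\<Sum>l<length As. \<Sum>a<m. \<Sum>b<n. (cmod (As ! l $$ (a, b)))\<^sup>2)"
    by (rule sum.swap)
  finally show ?thesis .
qed

lemma frobenius_norm_entry:
  assumes "i < dim_row M" "j < dim_col M"
  shows "cmod (M $$ (i, j)) \<le> frobenius_norm M"
proof -
  have "(cmod (M $$ (i, j)))\<^sup>2 \<le> (\<Sum>j<dim_col M. (cmod (M $$ (i, j)))\<^sup>2)"
    using assms(2) by (intro member_le_sum) auto
  also have "\<dots> \<le> (\<Sum>i<dim_row M. \<Sum>j<dim_col M. (cmod (M $$ (i, j)))\<^sup>2)"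
    using assms(1) by (intro member_le_sum[of i "{..<dim_row M}" "\<lambda>i. \<Sum>j<dim_col M. (cmod (M $$ (i, j)))\<^sup>2"]) (auto intro: sum_nonneg)
  finally show ?thesis unfolding frobenius_norm_def by (rule real_le_rsqrt)
qed

text \<open>The vector \<open>x\<close> lives on positions up to \<open>i\<close>, where the
  nonincreasing weights are at least \<open>w (Suc i)\<close>; the diagonal part therefore
  contributes at least that much. Each of the \<open>k^2\<close> error entries costs at most
  \<open>\<epsilon>\<close>, since a unit vector has entries of modulus at most 1.\<close>

lemma quadratic_form_lower_bound:
  assumes Z: "\<And>a b. a < k \<Longrightarrow> b < k \<Longrightarrow> cmod (Z a b - (if a = b then of_real (w (Suc a)) else 0)) \<le> \<epsilon>"
    and x: "nsq k x = 1" "\<And>s. i < s \<Longrightarrow> s < k \<Longrightarrow> x s = 0" and i: "i < k" and w: "antimono_on {1..k} w"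
  shows "w (Suc i) - (real k)\<^sup>2 * \<epsilon> \<le> Re (cip k x (mv k Z x))"
proof -
  define E where "E a b = Z a b - (if a = b then of_real (w (Suc a)) else 0)" for a b
  have "cip k x (mv k Z x) = (\<Sum>a<k. \<Sum>b<k. cnj (x a) * (E a b * x b) + cnj (x a) * ((if a = b then of_real (w (Suc a)) else 0) * x b))"
    by (simp add: cip_def mv_def E_def sum_distrib_left ring_distribs)
  also have "\<dots> = (\<Sum>a<k. \<Sum>b<k. cnj (x a) * (E a b * x b)) + (\<Sum>a<k. cnj (x a) * (of_real (w (Suc a)) * x a))"
  proof -
    have "(\<Sum>a<k. \<Sum>b<k. cnj (x a) * ((if a = b then of_real (w (Suc a)) else 0) * x b))
        = (\<Sum>a<k. cnj (x a) * (of_real (w (Suc a)) * x a))"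
      by (intro sum.cong refl) (simp add: if_distrib if_distribR cong: if_cong)
    then show ?thesis by (simp only: sum.distrib)
  qed
  also have "(\<Sum>a<k. cnj (x a) * (of_real (w (Suc a)) * x a)) = of_real (\<Sum>a<k. w (Suc a) * (cmod (x a))\<^sup>2)"
    by (simp add: complex_norm_square mult_ac del: of_real_power)
  finally have eq: "Re (cip k x (mv k Z x)) = Re (\<Sum>a<k. \<Sum>b<k. cnj (x a) * (E a b * x b)) + (\<Sum>a<k. w (Suc a) * (cmod (x a))\<^sup>2)"
    by simp
  have x1: "cmod (x a) \<le> 1" if "a < k" for a
    using component_le_nsq[OF that, of x] x(1) by (simp add: abs_square_le_1)
  have "cmod (\<Sum>a<k. \<Sum>b<k. cnj (x a) * (E a b * x b)) \<le> (\<Sum>a<k. \<Sum>b<k. \<epsilon>)"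
  proof (intro order.trans[OF norm_sum sum_mono] order.trans[OF norm_sum sum_mono])
    fix a b assume ab: "a \<in> {..<k}" "b \<in> {..<k}"
    have "cmod (E a b) \<le> \<epsilon>" using Z ab by (simp add: E_def)
    then have "cmod (x a) * (cmod (E a b) * cmod (x b)) \<le> 1 * (\<epsilon> * 1)"
      using ab x1 by (intro mult_mono) (auto intro: order.trans[OF norm_ge_zero])
    then show "cmod (cnj (x a) * (E a b * x b)) \<le> \<epsilon>" by (simp add: norm_mult)
  qed
  also have "\<dots> = (real k)\<^sup>2 * \<epsilon>" by (simp add: power2_eq_square)
  finally have "- ((real k)\<^sup>2 * \<epsilon>) \<le> Re (\<Sum>a<k. \<Sum>b<k. cnj (x a) * (E a b * x b))"
    using abs_Re_le_cmod[of "\<Sum>a<k. \<Sum>b<k. cnj (x a) * (E a b * x b)"] by linarith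
  moreover have "w (Suc i) \<le> (\<Sum>a<k. w (Suc a) * (cmod (x a))\<^sup>2)"
  proof -
    have "w (Suc i) = (\<Sum>a<k. w (Suc i) * (cmod (x a))\<^sup>2)"
      using x(1) by (simp add: nsq_def sum_distrib_left[symmetric])
    also have "\<dots> \<le> (\<Sum>a<k. w (Suc a) * (cmod (x a))\<^sup>2)"
    proof (rule sum_mono)
      fix a assume a: "a \<in> {..<k}"
      show "w (Suc i) * (cmod (x a))\<^sup>2 \<le> w (Suc a) * (cmod (x a))\<^sup>2"
      proof (cases "a \<le> i")
        case True
        then have "w (Suc i) \<le> w (Suc a)" using w i by (auto simp: monotone_on_def)
        then show ?thesis by (rule mult_right_mono) simp
      next
        case False
        then show ?thesis using x(2) a by simp
      qed
    qed
    finally show ?thesis .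
  qed
  ultimately show ?thesis using eq by linarith
qed

text \<open>After orthonormalization, the forms of \<open>T(I)\<close> at the \<open>v i\<close> and
  of the dual at the \<open>u j\<close> are at least the weights, up to
  \<open>m^2 \<epsilon>\<close> and \<open>n^2 \<epsilon>\<close>. By
  \<open>independent_frobenius_bound\<close> these values add up to at most the trace of
  \<open>T(I)\<close>, which is at most that of \<open>Q\<close> plus \<open>m \<epsilon>\<close>.
  At most \<open>m\<close> and \<open>n\<close> vectors occur, hence the cubes.\<close>

lemma echelon_sum_bound:
  assumes kraus: "set As \<subseteq> carrier_mat m n" and p: "antimono_on {1..n} p" and q: "antimono_on {1..m} q"
    and T1: "frobenius_norm (cp_map m As (1\<^sub>m n) - diag_of m q) \<le> \<epsilon>"
    and T2: "frobenius_norm (cp_dual n As (1\<^sub>m m) - diag_of n p) \<le> \<epsilon>"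
    and I: "I \<subseteq> {..<m}" and J: "J \<subseteq> {..<n}"
    and v: "\<And>i. i \<in> I \<Longrightarrow> v i i = 1 \<and> (\<forall>s. i < s \<and> s < m \<longrightarrow> v i s = 0)"
    and u: "\<And>j. j \<in> J \<Longrightarrow> u j j = 1 \<and> (\<forall>s. j < s \<and> s < n \<longrightarrow> u j s = 0)"
    and zero: "\<And>A i j. A \<in> set As \<Longrightarrow> i \<in> I \<Longrightarrow> j \<in> J \<Longrightarrow> form m n A (v i) (u j) = 0"
  shows "(\<Sum>i\<in>I. q (Suc i)) + (\<Sum>j\<in>J. p (Suc j)) \<le> (\<Sum>i=1..m. q i) + (real m + real m ^ 3 + real n ^ 3) * \<epsilon>"
proof -
  have finI: "finite I" and finJ: "finite J" using I J finite_subset by blast+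
  \<comment> \<open>The families are treated one after the other: the pairings of \<open>v'\<close>
    with the old \<open>u\<close> are secured first, and then \<open>u\<close> is replaced relative
    to \<open>v'\<close>.\<close>
  have "\<exists>v'. orthonormal m v' I \<and> (\<forall>i\<in>I. (\<forall>A\<in>set As. \<forall>j\<in>J. form m n A (v' i) (u j) = 0) \<and> (\<forall>s. i < s \<and> s < m \<longrightarrow> v' i s = 0))"
    by (rule orthonormalize_echelon[OF I v, where N = "\<lambda>x. \<forall>A\<in>set As. \<forall>j\<in>J. form m n A x (u j) = 0"])
      (use zero in \<open>auto simp: form_add_left form_scale_left form_def\<close>)
  then obtain v' where v': "orthonormal m v' I" "\<And>A i j. A \<in> set As \<Longrightarrow> i \<in> I \<Longrightarrow> j \<in> J \<Longrightarrow> form m n A (v' i) (u j) = 0"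
    "\<And>i s. i \<in> I \<Longrightarrow> i < s \<Longrightarrow> s < m \<Longrightarrow> v' i s = 0" by blast
  have "\<exists>u'. orthonormal n u' J \<and> (\<forall>j\<in>J. (\<forall>A\<in>set As. \<forall>i\<in>I. form m n A (v' i) (u' j) = 0) \<and> (\<forall>s. j < s \<and> s < n \<longrightarrow> u' j s = 0))"
    by (rule orthonormalize_echelon[OF J u, where N = "\<lambda>x. \<forall>A\<in>set As. \<forall>i\<in>I. form m n A (v' i) x = 0"])
      (use v'(2) in \<open>auto simp: form_add_right form_scale_right form_def\<close>)
  then obtain u' where u': "orthonormal n u' J" "\<And>A i j. A \<in> set As \<Longrightarrow> i \<in> I \<Longrightarrow> j \<in> J \<Longrightarrow> form m n A (v' i) (u' j) = 0"
    "\<And>j s. j \<in> J \<Longrightarrow> j < s \<Longrightarrow> s < n \<Longrightarrow> u' j s = 0" by blast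
  let ?T = "\<lambda>i j. cp_map m As (1\<^sub>m n) $$ (i, j)" and ?D = "\<lambda>i j. cp_dual n As (1\<^sub>m m) $$ (i, j)"
  have Tc: "cp_map m As (1\<^sub>m n) \<in> carrier_mat m m" by (rule cp_map_carrier[OF kraus])
  have Dc: "cp_dual n As (1\<^sub>m m) \<in> carrier_mat n n" by (rule cp_dual_carrier[OF kraus])
  have T: "cmod (?T a b - (if a = b then of_real (q (Suc a)) else 0)) \<le> \<epsilon>" if "a < m" "b < m" for a b
  proof -
    have "cmod ((cp_map m As (1\<^sub>m n) - diag_of m q) $$ (a, b)) \<le> \<epsilon>"
      using frobenius_norm_entry[of a "cp_map m As (1\<^sub>m n) - diag_of m q" b] T1 that Tc
      by (simp add: diag_of_def mat_diag_def)
    then show ?thesis using that Tc by (auto simp: diag_of_def mat_diag_def split: if_splits)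
  qed
  have D: "cmod (?D a b - (if a = b then of_real (p (Suc a)) else 0)) \<le> \<epsilon>" if "a < n" "b < n" for a b
  proof -
    have "cmod ((cp_dual n As (1\<^sub>m m) - diag_of n p) $$ (a, b)) \<le> \<epsilon>"
      using frobenius_norm_entry[of a "cp_dual n As (1\<^sub>m m) - diag_of n p" b] T2 that Dc
      by (simp add: diag_of_def mat_diag_def)
    then show ?thesis using that Dc by (auto simp: diag_of_def mat_diag_def split: if_splits)
  qed
  have eps: "0 \<le> \<epsilon>" using T1 by (rule order.trans[rotated]) (simp add: frobenius_norm_def sum_nonneg)
  have qI: "q (Suc i) - (real m)\<^sup>2 * \<epsilon> \<le> (\<Sum>l<length As. \<Sum>b<n. (cmod (\<Sum>a<m. cnj (v' i a) * As ! l $$ (a, b)))\<^sup>2)"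
    if i: "i \<in> I" for i
  proof -
    have "q (Suc i) - (real m)\<^sup>2 * \<epsilon> \<le> Re (cip m (v' i) (mv m ?T (v' i)))"
      using v' i I by (intro quadratic_form_lower_bound T q) (auto simp: orthonormal_def nsq_Re_cip)
    then show ?thesis by (simp add: cp_map_one_quadratic[OF kraus])
  qed
  have pJ: "p (Suc j) - (real n)\<^sup>2 * \<epsilon> \<le> (\<Sum>l<length As. \<Sum>a<m. (cmod (\<Sum>b<n. As ! l $$ (a, b) * u' j b))\<^sup>2)"
    if j: "j \<in> J" for j
  proof -
    have "p (Suc j) - (real n)\<^sup>2 * \<epsilon> \<le> Re (cip n (u' j) (mv n ?D (u' j)))"
      using u' j J by (intro quadratic_form_lower_bound D p) (auto simp: orthonormal_def nsq_Re_cip)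
    then show ?thesis by (simp add: cp_dual_one_quadratic[OF kraus])
  qed
  have "(\<Sum>i\<in>I. q (Suc i) - (real m)\<^sup>2 * \<epsilon>) + (\<Sum>j\<in>J. p (Suc j) - (real n)\<^sup>2 * \<epsilon>)
     \<le> (\<Sum>i\<in>I. \<Sum>l<length As. \<Sum>b<n. (cmod (\<Sum>a<m. cnj (v' i a) * As ! l $$ (a, b)))\<^sup>2)
      + (\<Sum>j\<in>J. \<Sum>l<length As. \<Sum>a<m. (cmod (\<Sum>b<n. As ! l $$ (a, b) * u' j b))\<^sup>2)"
    by (intro add_mono sum_mono qI pJ)
  also have "\<dots> = (\<Sum>l<length As. (\<Sum>i\<in>I. \<Sum>b<n. (cmod (\<Sum>a<m. cnj (v' i a) * As ! l $$ (a, b)))\<^sup>2)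
      + (\<Sum>j\<in>J. \<Sum>a<m. (cmod (\<Sum>b<n. As ! l $$ (a, b) * u' j b))\<^sup>2))"
    by (simp only: sum.distrib sum.swap[of _ I "{..<length As}"] sum.swap[of _ J "{..<length As}"])
  also have "\<dots> \<le> (\<Sum>l<length As. \<Sum>a<m. \<Sum>b<n. (cmod (As ! l $$ (a, b)))\<^sup>2)"
  proof (rule sum_mono)
    fix l assume "l \<in> {..<length As}"
    then have "As ! l \<in> set As" by simp
    then show "(\<Sum>i\<in>I. \<Sum>b<n. (cmod (\<Sum>a<m. cnj (v' i a) * As ! l $$ (a, b)))\<^sup>2)
      + (\<Sum>j\<in>J. \<Sum>a<m. (cmod (\<Sum>b<n. As ! l $$ (a, b) * u' j b))\<^sup>2) \<le> (\<Sum>a<m. \<Sum>b<n. (cmod (As ! l $$ (a, b)))\<^sup>2)"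
      by (intro independent_frobenius_bound finI finJ v'(1) u'(1) u'(2))
  qed
  also have "\<dots> = (\<Sum>a<m. Re (?T a a))"
    using arg_cong[OF cp_map_one_trace[OF kraus], of Re] by simp
  also have "\<dots> \<le> (\<Sum>a<m. q (Suc a) + \<epsilon>)"
  proof (rule sum_mono)
    fix a assume "a \<in> {..<m}"
    then have "Re (?T a a - of_real (q (Suc a))) \<le> \<epsilon>"
      using T[of a a] complex_Re_le_cmod[of "?T a a - of_real (q (Suc a))"] by simp
    then show "Re (?T a a) \<le> q (Suc a) + \<epsilon>" by simp
  qed
  also have "\<dots> = (\<Sum>i=1..m. q i) + real m * \<epsilon>"
    by (simp add: sum.distrib sum.atLeast1_atMost_eq)
  finally have main: "(\<Sum>i\<in>I. q (Suc i)) - real (card I) * ((real m)\<^sup>2 * \<epsilon>) + ((\<Sum>j\<in>J. p (Suc j)) - real (card J) * ((real n)\<^sup>2 * \<epsilon>))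
     \<le> (\<Sum>i=1..m. q i) + real m * \<epsilon>"
    by (simp add: sum_subtractf)
  have "card I \<le> m" "card J \<le> n" using card_mono[OF _ I] card_mono[OF _ J] by auto
  then have "real (card I) * ((real m)\<^sup>2 * \<epsilon>) \<le> real m * ((real m)\<^sup>2 * \<epsilon>)"
    "real (card J) * ((real n)\<^sup>2 * \<epsilon>) \<le> real n * ((real n)\<^sup>2 * \<epsilon>)"
    using eps by (intro mult_right_mono; simp)+
  with main show ?thesis by (simp add: power3_eq_cube power2_eq_square algebra_simps)
qed

section \<open>Leading minors and triangular congruences\<close>

lemma GL_iff: "M \<in> GL k \<longleftrightarrow> M \<in> carrier_mat k k \<and> det M \<noteq> 0"
proof
  assume "M \<in> GL k"
  then have M: "M \<in> carrier_mat k k" and "invertible_mat M" by (auto simp: GL_def)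
  from \<open>invertible_mat M\<close> obtain B where "inverts_mat M B" "inverts_mat B M"
    unfolding invertible_mat_def by blast
  then have B: "M * B = 1\<^sub>m k" "B * M = 1\<^sub>m (dim_row B)"
    using carrier_matD(1)[OF M] unfolding inverts_mat_def by simp_all
  have "dim_col B = k" using arg_cong[OF B(1), of dim_col] unfolding index_mult_mat index_one_mat .
  moreover have "dim_row B = k"
    using arg_cong[OF B(2), of dim_col] carrier_matD(2)[OF M] unfolding index_mult_mat index_one_mat by simp
  ultimately have "B \<in> carrier_mat k k" by (intro carrier_matI)
  from det_mult[OF M this] B(1) have "det M * det B = 1" by simp
  then show "M \<in> carrier_mat k k \<and> det M \<noteq> 0" using M by auto
next
  assume M: "M \<in> carrier_mat k k \<and> det M \<noteq> 0"
  then have "M \<in> Units (ring_mat TYPE(complex) k ())" by (intro det_non_zero_imp_unit) auto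
  then obtain B where "B \<in> carrier_mat k k" "B * M = 1\<^sub>m k" "M * B = 1\<^sub>m k"
    by (auto simp: Units_def ring_mat_def)
  then show "M \<in> GL k" using M
    by (auto simp: GL_def invertible_mat_def inverts_mat_def)
qed

lemma GL_mult: "g \<in> GL k \<Longrightarrow> h \<in> GL k \<Longrightarrow> g * h \<in> GL k"
  by (auto simp: GL_iff det_mult)

lemma GL_flag_iff:
  "M \<in> GL_flag k \<longleftrightarrow> M \<in> carrier_mat k k \<and> (\<forall>i<k. \<forall>j<i. M $$ (i, j) = 0) \<and> (\<forall>i<k. M $$ (i, i) \<noteq> 0)"
proof -
  have "det M = (\<Prod>i<k. M $$ (i, i))" if "M \<in> carrier_mat k k" "upper_triangular M"
    using det_upper_triangular[OF that(2,1)] that(1) by (simp add: prod_list_diag_prod lessThan_atLeast0)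
  then show ?thesis
    by (auto simp: GL_flag_def GL_iff upper_triangular_def)
qed

lemma GL_flag_mult:
  assumes "g \<in> GL_flag k" "h \<in> GL_flag k"
  shows "g * h \<in> GL_flag k" and "i < k \<Longrightarrow> (g * h) $$ (i, i) = g $$ (i, i) * h $$ (i, i)"
proof -
  have gc: "g \<in> carrier_mat k k" and hc: "h \<in> carrier_mat k k" using assms by (auto simp: GL_flag_iff)
  have ind: "(g * h) $$ (i, j) = (\<Sum>s<k. g $$ (i, s) * h $$ (s, j))" if "i < k" "j < k" for i j
    using gc hc that by (simp add: scalar_prod_def lessThan_atLeast0)
  have zero: "g $$ (i, s) * h $$ (s, j) = 0" if "i < k" "s < k" "j < i \<or> (j = i \<and> s \<noteq> i)" for i j s
    using assms that unfolding GL_flag_iff by (cases "s < i") (auto simp: not_less)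
  have low: "(g * h) $$ (i, j) = 0" if "i < k" "j < i" for i j
    using ind[of i j] zero that by (simp add: sum.neutral)
  have diag: "(g * h) $$ (i, i) = g $$ (i, i) * h $$ (i, i)" if "i < k" for i
  proof -
    have "(\<Sum>s<k. g $$ (i, s) * h $$ (s, i)) = (\<Sum>s\<in>{i}. g $$ (i, s) * h $$ (s, i))"
      using zero[of i _ i] that by (intro sum.mono_neutral_right) blast+
    then show ?thesis using ind[OF that that] by simp
  qed
  show "g * h \<in> GL_flag k"
    using assms low diag gc hc by (auto simp: GL_flag_iff)
  show "i < k \<Longrightarrow> (g * h) $$ (i, i) = g $$ (i, i) * h $$ (i, i)" by (rule diag)
qed

lemma one_GL_flag: "1\<^sub>m k \<in> GL_flag k" by (auto simp: GL_flag_iff)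

definition leading_block :: "nat \<Rightarrow> complex mat \<Rightarrow> complex mat" where
  "leading_block j M = mat j j (\<lambda>(a, b). M $$ (a, b))"

lemma leading_block_carrier [simp]: "leading_block j M \<in> carrier_mat j j"
  by (simp add: leading_block_def)

lemma \<eta>_sandwich:
  assumes M: "M \<in> carrier_mat k k" and j: "j \<le> k"
  shows "\<eta> k j * M * mat_adjoint (\<eta> k j) = leading_block j M"
proof -
  have e: "\<eta> k j \<in> carrier_mat j k" by (simp add: \<eta>_def)
  have e': "mat_adjoint (\<eta> k j) \<in> carrier_mat k j" using e by simp
  have row: "(\<eta> k j * M) $$ (a, c) = M $$ (a, c)" if "a < j" "c < k" for a c
    using M that j
    by (simp add: \<eta>_def scalar_prod_def if_distrib if_distribR cong: if_cong)
  have "(\<eta> k j * M * mat_adjoint (\<eta> k j)) $$ (a, b) = M $$ (a, b)" if "a < j" "b < j" for a b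
  proof -
    have "(\<eta> k j * M * mat_adjoint (\<eta> k j)) $$ (a, b) = (\<Sum>c = 0..<k. (\<eta> k j * M) $$ (a, c) * mat_adjoint (\<eta> k j) $$ (c, b))"
      using M e e' that by (simp add: scalar_prod_def)
    also have "\<dots> = (\<Sum>c = 0..<k. M $$ (a, c) * (if c = b then 1 else 0))"
      using e that j row by (intro sum.cong refl) (auto simp: \<eta>_def)
    also have "\<dots> = M $$ (a, b)" using that j by (simp add: if_distrib cong: if_cong)
    finally show ?thesis .
  qed
  then show ?thesis
    using e M by (intro eq_matI) (auto simp: leading_block_def)
qed

lemma rel_det_leading_blocks:
  assumes "M \<in> carrier_mat k k"
  shows "rel_det k a M = (\<Prod>j=1..k. rpow (Re (det (leading_block j M))) (\<Delta> k a j))"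
  unfolding rel_det_def using \<eta>_sandwich[OF assms] by (intro prod.cong) auto

lemma det_leading_block_triangular:
  assumes g: "g \<in> GL_flag k" and j: "j \<le> k"
  shows "det (leading_block j g) = (\<Prod>i<j. g $$ (i, i))"
proof -
  have "upper_triangular (leading_block j g)"
    using g j by (auto simp: upper_triangular_def leading_block_def GL_flag_iff)
  from det_upper_triangular[OF this leading_block_carrier]
  show ?thesis by (simp add: prod_list_diag_prod leading_block_def lessThan_atLeast0)
qed

lemma det_mat_adjoint:
  assumes "M \<in> carrier_mat k k"
  shows "det (mat_adjoint M) = cnj (det M)"
proof -
  have "mat_adjoint M = transpose_mat (map_mat cnj M)"
    using assms by (intro eq_matI) auto
  then have "det (mat_adjoint M) = det (map_mat cnj M)"
    using det_transpose[of "map_mat cnj M" k] assms by simp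
  also have "\<dots> = cnj (det M)"
  proof -
    have "comm_ring_hom cnj" by unfold_locales auto
    then show ?thesis by (rule comm_ring_hom.hom_det)
  qed
  finally show ?thesis .
qed

text \<open>An upper triangular \<open>g\<close> maps the span of the first \<open>j\<close> unit
  vectors to itself, so a leading block of the congruence involves leading blocks only.\<close>

lemma leading_block_triangular_congruence:
  assumes g: "g \<in> GL_flag k" and Y: "Y \<in> carrier_mat k k" and j: "j \<le> k"
  shows "leading_block j (mat_adjoint g * Y * g) = mat_adjoint (leading_block j g) * leading_block j Y * leading_block j g"
proof -
  have gc: "g \<in> carrier_mat k k" using g by (simp add: GL_flag_iff)
  have g0: "g $$ (s, a) = 0" if "a < j" "j \<le> s" "s < k" for a s using g that by (auto simp: GL_flag_iff)
  have L: "(mat_adjoint g * Y * g) $$ (a, b) = (\<Sum>t<k. (\<Sum>s<k. cnj (g $$ (s, a)) * Y $$ (s, t)) * g $$ (t, b))"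
    if "a < k" "b < k" for a b
    using gc Y that by (simp add: scalar_prod_def lessThan_atLeast0)
  show ?thesis
  proof (rule eq_matI)
    fix a b assume "a < dim_row (mat_adjoint (leading_block j g) * leading_block j Y * leading_block j g)"
      "b < dim_col (mat_adjoint (leading_block j g) * leading_block j Y * leading_block j g)"
    then have ab: "a < j" "b < j" by (auto simp: leading_block_def)
    have "leading_block j (mat_adjoint g * Y * g) $$ (a, b)
       = (\<Sum>t<k. (\<Sum>s<k. cnj (g $$ (s, a)) * Y $$ (s, t)) * g $$ (t, b))"
      using ab j L[of a b] by (simp add: leading_block_def)
    also have "\<dots> = (\<Sum>t<j. (\<Sum>s<k. cnj (g $$ (s, a)) * Y $$ (s, t)) * g $$ (t, b))"
      using j g0 ab by (intro sum.mono_neutral_right) auto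
    also have "\<dots> = (\<Sum>t<j. (\<Sum>s<j. cnj (g $$ (s, a)) * Y $$ (s, t)) * g $$ (t, b))"
      using j g0 ab by (intro sum.cong refl arg_cong2[of _ _ _ _ "(*)"] sum.mono_neutral_right) auto
    also have "\<dots> = (mat_adjoint (leading_block j g) * leading_block j Y * leading_block j g) $$ (a, b)"
      using ab by (simp add: leading_block_def scalar_prod_def lessThan_atLeast0)
    finally show "leading_block j (mat_adjoint g * Y * g) $$ (a, b)
       = (mat_adjoint (leading_block j g) * leading_block j Y * leading_block j g) $$ (a, b)" .
  qed (auto simp: leading_block_def)
qed

lemma det_leading_block_congruence:
  assumes g: "g \<in> GL_flag k" and Y: "Y \<in> carrier_mat k k" and j: "j \<le> k"
  shows "det (leading_block j (mat_adjoint g * Y * g))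
    = of_real (\<Prod>i<j. (cmod (g $$ (i, i)))\<^sup>2) * det (leading_block j Y)"
proof -
  let ?g = "leading_block j g"
  have "det (leading_block j (mat_adjoint g * Y * g)) = det (mat_adjoint ?g) * det (leading_block j Y) * det ?g"
    unfolding leading_block_triangular_congruence[OF g Y j]
    by (simp only: det_mult[OF mult_carrier_mat[OF mat_adjoint_carrier[OF leading_block_carrier] leading_block_carrier]
          leading_block_carrier] det_mult[OF mat_adjoint_carrier[OF leading_block_carrier] leading_block_carrier])
  also have "\<dots> = (det ?g * cnj (det ?g)) * det (leading_block j Y)"
    by (simp add: det_mat_adjoint[OF leading_block_carrier])
  also have "det ?g * cnj (det ?g) = of_real ((cmod (det ?g))\<^sup>2)"
    by (rule complex_norm_square[symmetric])
  also have "(cmod (det ?g))\<^sup>2 = (\<Prod>i<j. (cmod (g $$ (i, i)))\<^sup>2)"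
    by (simp add: det_leading_block_triangular[OF g j] prod_norm[symmetric] prod_power_distrib[symmetric])
  finally show ?thesis .
qed

text \<open>Summation by parts in the exponents: \<open>x i\<close> enters at all levels
  \<open>j > i\<close>, with total exponent \<open>2 * a (Suc i)\<close>. The product is the
  relative determinant of the diagonal matrix with entries \<open>(x i)^2\<close>.\<close>

lemma prod_rpow_flag:
  assumes "\<And>i. i < k \<Longrightarrow> 0 < x i"
  shows "(\<Prod>j=1..k. rpow (\<Prod>i<j. (x i)\<^sup>2) (\<Delta> k a j)) = exp (2 * (\<Sum>i<k. a (Suc i) * ln (x i)))"
proof -
  have "(\<Prod>j=1..k. rpow (\<Prod>i<j. (x i)\<^sup>2) (\<Delta> k a j)) = (\<Prod>j=1..k. exp (\<Delta> k a j * (\<Sum>i<j. 2 * ln (x i))))"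
  proof (intro prod.cong refl)
    fix j assume j: "j \<in> {1..k}"
    have x0: "0 < x i" if "i < j" for i using assms[of i] that j by simp
    have x0': "x i \<noteq> 0" if "i < j" for i using x0[OF that] by simp
    have pos: "0 < (\<Prod>i<j. (x i)\<^sup>2)" using x0' by (intro prod_pos) simp
    have "ln (\<Prod>i<j. (x i)\<^sup>2) = (\<Sum>i<j. ln ((x i)\<^sup>2))"
      using x0' by (intro ln_prod) auto
    also have "\<dots> = (\<Sum>i<j. 2 * ln (x i))"
      using x0 by (intro sum.cong refl) (simp add: ln_realpow)
    finally show "rpow (\<Prod>i<j. (x i)\<^sup>2) (\<Delta> k a j) = exp (\<Delta> k a j * (\<Sum>i<j. 2 * ln (x i)))"
      by (simp add: rpow_eq_exp[OF pos])
  qed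
  also have "\<dots> = exp (\<Sum>j=1..k. \<Delta> k a j * (\<Sum>i<j. 2 * ln (x i)))" by (simp add: exp_sum)
  also have "(\<Sum>j=1..k. \<Delta> k a j * (\<Sum>i<j. 2 * ln (x i))) = (\<Sum>j=1..k. \<Sum>i<k. if i < j then \<Delta> k a j * (2 * ln (x i)) else 0)"
  proof (intro sum.cong refl)
    fix j assume j: "j \<in> {1..k}"
    have "(\<Sum>i<k. if i < j then \<Delta> k a j * (2 * ln (x i)) else 0) = (\<Sum>i<j. \<Delta> k a j * (2 * ln (x i)))"
      using j by (intro sum.mono_neutral_cong_right) auto
    then show "\<Delta> k a j * (\<Sum>i<j. 2 * ln (x i)) = (\<Sum>i<k. if i < j then \<Delta> k a j * (2 * ln (x i)) else 0)"
      by (simp add: sum_distrib_left)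
  qed
  also have "\<dots> = (\<Sum>i<k. \<Sum>j=1..k. if i < j then \<Delta> k a j * (2 * ln (x i)) else 0)" by (rule sum.swap)
  also have "\<dots> = (\<Sum>i<k. 2 * (a (Suc i) * ln (x i)))"
  proof (intro sum.cong refl)
    fix i assume "i \<in> {..<k}"
    then have "i < k" by simp
    have "(\<Sum>j=1..k. if i < j then \<Delta> k a j * (2 * ln (x i)) else 0) = (\<Sum>j=Suc i..k. \<Delta> k a j * (2 * ln (x i)))"
      by (intro sum.mono_neutral_cong_right) auto
    also have "\<dots> = (\<Sum>j=Suc i..k. \<Delta> k a j) * (2 * ln (x i))" by (simp only: sum_distrib_right)
    finally show "(\<Sum>j=1..k. if i < j then \<Delta> k a j * (2 * ln (x i)) else 0) = 2 * (a (Suc i) * ln (x i))"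
      using \<Delta>_sum[OF \<open>i < k\<close>] by simp
  qed
  finally show ?thesis by (simp add: sum_distrib_left)
qed

text \<open>The triangular group acts on relative determinants through a positive character, whose
  logarithm is the logarithmic term of F.\<close>

lemma rel_det_congruence:
  assumes g: "g \<in> GL_flag k" and Y: "Y \<in> carrier_mat k k"
    and nonneg: "\<And>j. j \<in> {1..k} \<Longrightarrow> 0 \<le> Re (det (leading_block j Y))"
  shows "rel_det k a (mat_adjoint g * Y * g) = exp (2 * (\<Sum>i<k. a (Suc i) * ln (cmod (g $$ (i, i))))) * rel_det k a Y"
proof -
  have gc: "g \<in> carrier_mat k k" using g by (simp add: GL_flag_iff)
  have Zc: "mat_adjoint g * Y * g \<in> carrier_mat k k" using gc Y by auto
  have "rel_det k a (mat_adjoint g * Y * g)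
     = (\<Prod>j=1..k. rpow (\<Prod>i<j. (cmod (g $$ (i, i)))\<^sup>2) (\<Delta> k a j) * rpow (Re (det (leading_block j Y))) (\<Delta> k a j))"
    unfolding rel_det_leading_blocks[OF Zc]
  proof (intro prod.cong refl)
    fix j assume j: "j \<in> {1..k}"
    have "Re (det (leading_block j (mat_adjoint g * Y * g))) = (\<Prod>i<j. (cmod (g $$ (i, i)))\<^sup>2) * Re (det (leading_block j Y))"
      using det_leading_block_congruence[OF g Y, of j] j by (simp del: of_real_prod of_real_power)
    then show "rpow (Re (det (leading_block j (mat_adjoint g * Y * g)))) (\<Delta> k a j)
      = rpow (\<Prod>i<j. (cmod (g $$ (i, i)))\<^sup>2) (\<Delta> k a j) * rpow (Re (det (leading_block j Y))) (\<Delta> k a j)"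
      using nonneg[OF j] by (simp add: rpow_mult prod_nonneg)
  qed
  also have "\<dots> = (\<Prod>j=1..k. rpow (\<Prod>i<j. (cmod (g $$ (i, i)))\<^sup>2) (\<Delta> k a j)) * rel_det k a Y"
    by (simp only: prod.distrib rel_det_leading_blocks[OF Y])
  also have "(\<Prod>j=1..k. rpow (\<Prod>i<j. (cmod (g $$ (i, i)))\<^sup>2) (\<Delta> k a j)) = exp (2 * (\<Sum>i<k. a (Suc i) * ln (cmod (g $$ (i, i)))))"
    using g by (intro prod_rpow_flag) (auto simp: GL_flag_iff)
  finally show ?thesis .
qed

lemma rel_det_adjoint_mult:
  assumes "h \<in> GL_flag k"
  shows "rel_det k a (mat_adjoint h * h) = exp (2 * (\<Sum>i<k. a (Suc i) * ln (cmod (h $$ (i, i)))))"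
proof -
  have hc: "h \<in> carrier_mat k k" using assms by (simp add: GL_flag_iff)
  have lb: "leading_block j (1\<^sub>m k) = 1\<^sub>m j" if "j \<le> k" for j
    using that by (intro eq_matI) (auto simp: leading_block_def)
  have "mat_adjoint h * 1\<^sub>m k * h = mat_adjoint h * h"
    by (simp only: right_mult_one_mat[OF mat_adjoint_carrier[OF hc]])
  moreover have "rel_det k a (1\<^sub>m k) = 1"
    unfolding rel_det_leading_blocks[OF one_carrier_mat] using lb
    by (intro prod.neutral) (simp add: rpow_def)
  ultimately show ?thesis
    using rel_det_congruence[OF assms one_carrier_mat, of a] lb by simp
qed

lemma rel_det_nonneg [simp]: "0 \<le> rel_det k a X"
  unfolding rel_det_def by (intro prod_nonneg) simp

text \<open>The eigenvalues of a leading block are nonnegative and add up to at most the full trace,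
  so each of them is at most the trace. This crude bound takes the place of the inequality between
  arithmetic and geometric means.\<close>

lemma psd_leading_minor:
  assumes herm: "hermitian k (\<lambda>i j. Z $$ (i, j))" and psd: "\<And>x. 0 \<le> Re (cip k x (mv k (\<lambda>i j. Z $$ (i, j)) x))" and j: "j \<le> k"
  shows "0 \<le> Re (det (leading_block j Z))" "Re (det (leading_block j Z)) \<le> (\<Sum>a<k. Re (Z $$ (a, a))) ^ j"
proof -
  let ?Z = "\<lambda>i j. Z $$ (i, j)"
  have hermj: "hermitian j ?Z" using herm j unfolding hermitian_def by (meson less_le_trans)
  obtain U lam where U: "orthonormal j U {..<j}"
    and quad: "\<And>i. i < j \<Longrightarrow> cip j (U i) (mv j ?Z (U i)) = of_real (lam i)"
    and det: "det (mat j j (\<lambda>(a, b). Z $$ (a, b))) = of_real (\<Prod>i<j. lam i)"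
    and tr: "(\<Sum>a<j. Z $$ (a, a)) = of_real (\<Sum>i<j. lam i)"
    by (rule hermitian_diagonalization[OF hermj]) (rule that; assumption)
  \<comment> \<open>Vectors of the block are padded by zeros, so that positivity of the whole matrix
    applies to them.\<close>
  have ext: "cip j x (mv j ?Z x) = cip k (\<lambda>s. if s < j then x s else 0) (mv k ?Z (\<lambda>s. if s < j then x s else 0))" for x
  proof -
    have "mv k ?Z (\<lambda>s. if s < j then x s else 0) a = mv j ?Z x a" for a
      unfolding mv_def using j by (intro sum.mono_neutral_cong_right) auto
    then show ?thesis
      unfolding cip_def using j by (intro sum.mono_neutral_cong_left) auto
  qed
  have lam: "0 \<le> lam i" if "i < j" for i
    using psd[of "\<lambda>s. if s < j then U i s else 0"] unfolding ext[symmetric] quad[OF that] by simp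
  have diag: "0 \<le> Re (Z $$ (a, a))" if "a < k" for a
    using psd[of "\<lambda>s. if s = a then 1 else 0"] that
    by (simp add: cip_def mv_def if_distrib if_distribR cong: if_cong)
  have sum_le: "(\<Sum>i<j. lam i) \<le> (\<Sum>a<k. Re (Z $$ (a, a)))"
  proof -
    have "(\<Sum>i<j. lam i) = (\<Sum>a<j. Re (Z $$ (a, a)))" using arg_cong[OF tr, of Re] by simp
    also have "\<dots> \<le> (\<Sum>a<k. Re (Z $$ (a, a)))" using j diag by (intro sum_mono2) auto
    finally show ?thesis .
  qed
  have Re_det: "Re (det (leading_block j Z)) = (\<Prod>i<j. lam i)" using det by (simp add: leading_block_def del: of_real_prod)
  show "0 \<le> Re (det (leading_block j Z))" unfolding Re_det using lam by (intro prod_nonneg) auto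
  have "(\<Prod>i<j. lam i) \<le> (\<Prod>i<j. \<Sum>a<k. Re (Z $$ (a, a)))"
  proof (rule prod_mono)
    fix i assume i: "i \<in> {..<j}"
    have "lam i \<le> (\<Sum>i<j. lam i)" using i lam by (intro member_le_sum) auto
    then show "0 \<le> lam i \<and> lam i \<le> (\<Sum>a<k. Re (Z $$ (a, a)))" using sum_le lam i by simp
  qed
  then show "Re (det (leading_block j Z)) \<le> (\<Sum>a<k. Re (Z $$ (a, a))) ^ j" unfolding Re_det by simp
qed

text \<open>The minor of size \<open>j\<close> is at most \<open>t ^ j\<close>, which is the
  corresponding minor of \<open>t\<close> times the identity. The square root only brings this into
  the form of \<open>prod_rpow_flag\<close>.\<close>

lemma rel_det_psd_bound:
  assumes Z: "Z \<in> carrier_mat k k" and herm: "hermitian k (\<lambda>i j. Z $$ (i, j))"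
    and psd: "\<And>x. 0 \<le> Re (cip k x (mv k (\<lambda>i j. Z $$ (i, j)) x))"
    and a: "antimono_on {1..k} a" "\<forall>j\<in>{1..k}. 0 \<le> a j"
    and t: "(\<Sum>i<k. Re (Z $$ (i, i))) \<le> t" "0 < t"
  shows "rel_det k a Z \<le> exp ((\<Sum>i=1..k. a i) * ln t)"
proof -
  have "rel_det k a Z \<le> (\<Prod>j=1..k. rpow (\<Prod>i<j. (sqrt t)\<^sup>2) (\<Delta> k a j))"
    unfolding rel_det_leading_blocks[OF Z]
  proof (intro prod_mono conjI rpow_nonneg)
    fix j assume j: "j \<in> {1..k}"
    have "0 \<le> (\<Sum>i<k. Re (Z $$ (i, i)))"
    proof (rule sum_nonneg)
      fix i assume "i \<in> {..<k}"
      then show "0 \<le> Re (Z $$ (i, i))"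
        using psd[of "\<lambda>s. if s = i then 1 else 0"]
        by (simp add: cip_def mv_def if_distrib if_distribR cong: if_cong)
    qed
    then have "(\<Sum>i<k. Re (Z $$ (i, i))) ^ j \<le> t ^ j" using t(1) by (intro power_mono)
    moreover have "Re (det (leading_block j Z)) \<le> (\<Sum>i<k. Re (Z $$ (i, i))) ^ j" "0 \<le> Re (det (leading_block j Z))"
      using psd_leading_minor[OF herm psd, of j] j by auto
    ultimately show "rpow (Re (det (leading_block j Z))) (\<Delta> k a j) \<le> rpow (\<Prod>i<j. (sqrt t)\<^sup>2) (\<Delta> k a j)"
      using t(2) \<Delta>_nonneg[OF a j] by (intro rpow_mono) auto
  qed
  also have "\<dots> = exp (2 * (\<Sum>i<k. a (Suc i) * ln (sqrt t)))"
    using t(2) by (intro prod_rpow_flag) simp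
  also have "2 * (\<Sum>i<k. a (Suc i) * ln (sqrt t)) = (\<Sum>i=1..k. a i) * ln t"
    using t(2) by (simp add: ln_sqrt sum_distrib_left sum_distrib_right sum.atLeast1_atMost_eq)
  finally show ?thesis .
qed

section \<open>From positive capacity to scalings\<close>

text \<open>For \<open>m\<close> by \<open>n\<close> Kraus operators this is the trace of
  \<open>T(I)\<close>, by \<open>cp_map_one_trace\<close>; it is the first term of F.\<close>

definition kraus_norm :: "nat \<Rightarrow> nat \<Rightarrow> complex mat list \<Rightarrow> real" where
  "kraus_norm m n As = (\<Sum>l<length As. \<Sum>a<m. \<Sum>b<n. (cmod (As ! l $$ (a, b)))\<^sup>2)"

lemma kraus_norm_nonneg [simp]: "0 \<le> kraus_norm m n As"
  unfolding kraus_norm_def by (intro sum_nonneg) simp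

lemma length_cp_scale [simp]: "length (cp_scale g h As) = length As"
  by (simp add: cp_scale_def)

lemma cp_scale_carrier:
  assumes "set As \<subseteq> carrier_mat m n" "g \<in> carrier_mat m m" "h \<in> carrier_mat n n"
  shows "set (cp_scale g h As) \<subseteq> carrier_mat m n"
proof -
  have "mat_adjoint g * A * h \<in> carrier_mat m n" if "A \<in> carrier_mat m n" for A
    by (rule mult_carrier_mat[OF mult_carrier_mat[OF mat_adjoint_carrier[OF assms(2)] that] assms(3)])
  then show ?thesis using assms(1) by (auto simp: cp_scale_def)
qed

lemma cp_scale_cp_scale:
  assumes "set As \<subseteq> carrier_mat m n" "g \<in> carrier_mat m m" "h \<in> carrier_mat n n"
    "D \<in> carrier_mat m m" "E \<in> carrier_mat n n"
  shows "cp_scale D E (cp_scale g h As) = cp_scale (g * D) (h * E) As"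
proof -
  have "mat_adjoint D * (mat_adjoint g * A * h) * E = mat_adjoint (g * D) * A * (h * E)" if "A \<in> set As" for A
  proof -
    have "A \<in> carrier_mat m n" using assms that by auto
    then show ?thesis using assms by (simp add: mat_adjoint_mult mult_mat_assoc)
  qed
  then show ?thesis by (simp add: cp_scale_def)
qed

lemma map_adjoint_cp_scale:
  assumes "set As \<subseteq> carrier_mat m n" "g \<in> carrier_mat m m" "h \<in> carrier_mat n n"
  shows "map mat_adjoint (cp_scale g h As) = cp_scale h g (map mat_adjoint As)"
proof -
  have "mat_adjoint (mat_adjoint g * A * h) = mat_adjoint h * mat_adjoint A * g" if "A \<in> set As" for A
  proof -
    have "A \<in> carrier_mat m n" using assms that by auto
    then show ?thesis using assms by (simp add: mat_adjoint_mult mult_mat_assoc)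
  qed
  then show ?thesis by (simp add: cp_scale_def)
qed

lemma kraus_norm_adjoint:
  assumes "set As \<subseteq> carrier_mat m n"
  shows "kraus_norm n m (map mat_adjoint As) = kraus_norm m n As"
proof -
  have "(\<Sum>a<n. \<Sum>b<m. (cmod (map mat_adjoint As ! l $$ (a, b)))\<^sup>2) = (\<Sum>a<m. \<Sum>b<n. (cmod (As ! l $$ (a, b)))\<^sup>2)"
    if l: "l < length As" for l
  proof -
    have "As ! l \<in> carrier_mat m n" using assms l by auto
    then have "(\<Sum>a<n. \<Sum>b<m. (cmod (map mat_adjoint As ! l $$ (a, b)))\<^sup>2) = (\<Sum>a<n. \<Sum>b<m. (cmod (As ! l $$ (b, a)))\<^sup>2)"
      using l by (intro sum.cong refl) simp
    also have "\<dots> = (\<Sum>a<m. \<Sum>b<n. (cmod (As ! l $$ (a, b)))\<^sup>2)" by (rule sum.swap)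
    finally show ?thesis .
  qed
  then show ?thesis by (simp add: kraus_norm_def)
qed

lemma triangular_conjugate_gram:
  assumes h: "h \<in> carrier_mat n n" and bc: "b < n" "c < n"
  shows "(h * diag_of n p * mat_adjoint h) $$ (b, c)
    = (\<Sum>k<n. of_real (p (Suc k)) * h $$ (b, k) * cnj (h $$ (c, k)))"
proof -
  have "diag_of n p \<in> carrier_mat n n" by (simp add: diag_of_def mat_diag_def)
  from sandwich_index[OF h this bc]
  have "(h * diag_of n p * mat_adjoint h) $$ (b, c)
    = (\<Sum>k<n. (\<Sum>s<n. h $$ (b, s) * (if s = k then of_real (p (Suc k)) else 0)) * cnj (h $$ (c, k)))"
    by (simp add: diag_of_def mat_diag_def)
  also have "\<dots> = (\<Sum>k<n. of_real (p (Suc k)) * h $$ (b, k) * cnj (h $$ (c, k)))"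
    by (intro sum.cong refl) (simp add: if_distrib mult_ac cong: if_cong)
  finally show ?thesis .
qed

lemma capacity_le:
  assumes "h \<in> GL_flag n"
  shows "capacity m n As p q * rel_det n p (mat_adjoint h * h) \<le> rel_det m q (cp_map m As (h * diag_of n p * mat_adjoint h))"
proof -
  have "bdd_below ((\<lambda>h. rel_det m q (cp_map m As (h * diag_of n p * mat_adjoint h)) / rel_det n p (mat_adjoint h * h)) ` GL_flag n)"
    by (rule bdd_belowI2[of _ 0]) simp
  then have "capacity m n As p q \<le> rel_det m q (cp_map m As (h * diag_of n p * mat_adjoint h)) / rel_det n p (mat_adjoint h * h)"
    unfolding capacity_def using assms by (rule cINF_lower)
  moreover have "0 < rel_det n p (mat_adjoint h * h)"
    using rel_det_adjoint_mult[OF assms] by simp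
  ultimately show ?thesis by (simp add: pos_le_divide_eq)
qed

text \<open>The bound \<open>ln y <= y\<close> at \<open>y = (t + 1) / (1 + 2 * \<tau>)\<close>.
  This scaling makes the slope \<open>\<tau> / (1 + 2 * \<tau>)\<close> at most 1/2, which leaves
  half of \<open>t\<close> for coercivity.\<close>

lemma log_bounded_by_linear:
  fixes \<tau> t :: real
  assumes "0 \<le> \<tau>" "0 \<le> t"
  shows "\<tau> * ln (t + 1) \<le> t / 2 + 1 / 2 + \<tau> * ln (1 + 2 * \<tau>)"
proof -
  have "ln ((t + 1) / (1 + 2 * \<tau>)) \<le> (t + 1) / (1 + 2 * \<tau>)"
    using assms by (intro order.trans[OF ln_le_minus_one]) auto
  moreover have "ln ((t + 1) / (1 + 2 * \<tau>)) = ln (t + 1) - ln (1 + 2 * \<tau>)"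
    using assms by (simp add: ln_div)
  ultimately have "\<tau> * ln (t + 1) \<le> \<tau> * (ln (1 + 2 * \<tau>) + (t + 1) / (1 + 2 * \<tau>))"
    using assms by (intro mult_left_mono) auto
  also have "\<dots> = \<tau> * ln (1 + 2 * \<tau>) + (\<tau> / (1 + 2 * \<tau>)) * (t + 1)" by (simp add: algebra_simps)
  also have "\<dots> \<le> \<tau> * ln (1 + 2 * \<tau>) + (1 / 2) * (t + 1)"
    using assms by (intro add_left_mono mult_right_mono) (auto simp: field_simps)
  finally show ?thesis by (simp add: algebra_simps add_divide_distrib)
qed

text \<open>Let \<open>Z = T_{g,h}(P)\<close> and \<open>t = Tr T_{g,h}(I)\<close>. The relative
  determinant of \<open>Z\<close> is at least the capacity times the exponential of the two
  logarithmic terms, and at most the power with exponent \<open>\<tau>\<close> of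
  \<open>K * (t + 1)\<close>. In logarithms, the multiple of \<open>ln (t + 1)\<close> is absorbed
  by half of \<open>t\<close>.\<close>

lemma capacity_pos_coercive:
  assumes kraus: "set As \<subseteq> carrier_mat m n"
    and p: "\<forall>j\<in>{1..n}. 0 \<le> p j"
    and q: "antimono_on {1..m} q" "\<forall>i\<in>{1..m}. 0 \<le> q i"
    and cap: "0 < capacity m n As p q"
  shows "\<exists>C. \<forall>g\<in>GL_flag m. \<forall>h\<in>GL_flag n.
    2 * (\<Sum>i<m. q (Suc i) * ln (cmod (g $$ (i, i)))) + 2 * (\<Sum>j<n. p (Suc j) * ln (cmod (h $$ (j, j))))
      \<le> kraus_norm m n (cp_scale g h As) / 2 + C"
proof -
  define \<tau> where "\<tau> = (\<Sum>i=1..m. q i)"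
  \<comment> \<open>\<open>K\<close> dominates every entry of \<open>P\<close>, so that the trace of
    \<open>Z\<close> is at most \<open>K * t\<close>. The summand 1, here and in
    \<open>t + 1\<close>, keeps the arguments of \<open>ln\<close> positive.\<close>
  define K where "K = 1 + (\<Sum>j=1..n. p j)"
  have \<tau>0: "0 \<le> \<tau>" unfolding \<tau>_def using q(2) by (intro sum_nonneg) auto
  have "0 \<le> (\<Sum>j=1..n. p j)" using p by (intro sum_nonneg) auto
  then have K1: "1 \<le> K" by (simp add: K_def)
  have pK: "0 \<le> p (Suc j)" "p (Suc j) \<le> K" if "j < n" for j
  proof -
    have "p (Suc j) \<le> (\<Sum>j=1..n. p j)" using p that by (intro member_le_sum) auto
    then show "p (Suc j) \<le> K" by (simp add: K_def)
    show "0 \<le> p (Suc j)" using p that by simp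
  qed
  define C where "C = \<tau> * ln K + 1 / 2 + \<tau> * ln (1 + 2 * \<tau>) - ln (capacity m n As p q)"
  have "2 * (\<Sum>i<m. q (Suc i) * ln (cmod (g $$ (i, i)))) + 2 * (\<Sum>j<n. p (Suc j) * ln (cmod (h $$ (j, j))))
      \<le> kraus_norm m n (cp_scale g h As) / 2 + C" if g: "g \<in> GL_flag m" and h: "h \<in> GL_flag n" for g h
  proof -
    define Lg where "Lg = 2 * (\<Sum>i<m. q (Suc i) * ln (cmod (g $$ (i, i))))"
    define Lh where "Lh = 2 * (\<Sum>j<n. p (Suc j) * ln (cmod (h $$ (j, j))))"
    define t where "t = kraus_norm m n (cp_scale g h As)"
    have gc: "g \<in> carrier_mat m m" and hc: "h \<in> carrier_mat n n" using g h by (auto simp: GL_flag_iff)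
    let ?P = "diag_of n p"
    have Pc: "?P \<in> carrier_mat n n" by (simp add: diag_of_def mat_diag_def)
    let ?Y = "cp_map m As (h * ?P * mat_adjoint h)"
    have Yc: "?Y \<in> carrier_mat m m" by (rule cp_map_carrier[OF kraus])
    have Xc: "h * ?P * mat_adjoint h \<in> carrier_mat n n" using hc Pc by auto
    have Yh: "hermitian m (\<lambda>i j. ?Y $$ (i, j))"
      by (rule cp_map_hermitian_quadratic(1)[OF kraus Xc]) (rule triangular_conjugate_gram[OF hc])
    have Yq: "cip m x (mv m (\<lambda>i j. ?Y $$ (i, j)) x)
      = of_real (\<Sum>l<length As. \<Sum>k<n. p (Suc k) * (cmod (form m n (As ! l) x (\<lambda>b. h $$ (b, k))))\<^sup>2)" for x
      by (rule cp_map_hermitian_quadratic(2)[OF kraus Xc]) (rule triangular_conjugate_gram[OF hc])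
    have Ypsd: "0 \<le> Re (cip m x (mv m (\<lambda>i j. ?Y $$ (i, j)) x))" for x
      unfolding Yq Re_complex_of_real using pK by (intro sum_nonneg mult_nonneg_nonneg) auto
    let ?Bs = "cp_scale g h As"
    have Bc: "set ?Bs \<subseteq> carrier_mat m n" by (rule cp_scale_carrier[OF kraus gc hc])
    let ?Z = "cp_map m ?Bs ?P"
    have Zc: "?Z \<in> carrier_mat m m" by (rule cp_map_carrier[OF Bc])
    have ZY: "?Z = mat_adjoint g * ?Y * g" by (rule cp_map_scale[OF kraus gc hc Pc])
    have Pg: "?P $$ (b, c) = (\<Sum>k<n. of_real (p (Suc k)) * (if b = k then 1 else 0) * cnj (if c = k then 1 else 0))"
      if "b < n" "c < n" for b c
    proof -
      have "(\<Sum>k<n. of_real (p (Suc k)) * (if b = k then 1 else 0) * cnj (if c = k then 1 else 0))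
        = (\<Sum>k<n. if k = b then (if b = c then complex_of_real (p (Suc b)) else 0) else 0)"
        by (intro sum.cong refl) auto
      also have "\<dots> = ?P $$ (b, c)" using that by (simp add: diag_of_def mat_diag_def)
      finally show ?thesis ..
    qed
    have Zh: "hermitian m (\<lambda>i j. ?Z $$ (i, j))"
      by (rule cp_map_hermitian_quadratic(1)[OF Bc Pc]) (rule Pg)
    have Zq: "cip m x (mv m (\<lambda>i j. ?Z $$ (i, j)) x)
      = of_real (\<Sum>l<length ?Bs. \<Sum>k<n. p (Suc k) * (cmod (form m n (?Bs ! l) x (\<lambda>b. if b = k then 1 else 0)))\<^sup>2)" for x
      by (rule cp_map_hermitian_quadratic(2)[OF Bc Pc]) (rule Pg)
    have Zpsd: "0 \<le> Re (cip m x (mv m (\<lambda>i j. ?Z $$ (i, j)) x))" for x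
      unfolding Zq Re_complex_of_real using pK by (intro sum_nonneg mult_nonneg_nonneg) auto
    have Zdiag: "Re (?Z $$ (a, a)) = (\<Sum>l<length ?Bs. \<Sum>k<n. p (Suc k) * (cmod (?Bs ! l $$ (a, k)))\<^sup>2)" if "a < m" for a
    proof -
      have "cip m (\<lambda>s. if s = a then 1 else 0) (mv m (\<lambda>i j. ?Z $$ (i, j)) (\<lambda>s. if s = a then 1 else 0)) = ?Z $$ (a, a)"
        using that by (simp add: cip_def mv_def if_distrib if_distribR cong: if_cong)
      then have "?Z $$ (a, a) = of_real (\<Sum>l<length ?Bs. \<Sum>k<n. p (Suc k) * (cmod (form m n (?Bs ! l) (\<lambda>s. if s = a then 1 else 0) (\<lambda>b. if b = k then 1 else 0)))\<^sup>2)"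
        using Zq[of "\<lambda>s. if s = a then 1 else 0"] by simp
      also have "(\<Sum>l<length ?Bs. \<Sum>k<n. p (Suc k) * (cmod (form m n (?Bs ! l) (\<lambda>s. if s = a then 1 else 0) (\<lambda>b. if b = k then 1 else 0)))\<^sup>2)
         = (\<Sum>l<length ?Bs. \<Sum>k<n. p (Suc k) * (cmod (?Bs ! l $$ (a, k)))\<^sup>2)"
      proof (intro sum.cong refl)
        fix l k assume "k \<in> {..<n}"
        then have "form m n (?Bs ! l) (\<lambda>s. if s = a then 1 else 0) (\<lambda>b. if b = k then 1 else 0) = ?Bs ! l $$ (a, k)"
          using that by (simp add: form_unit if_distrib if_distribR cong: if_cong)
        then show "p (Suc k) * (cmod (form m n (?Bs ! l) (\<lambda>s. if s = a then 1 else 0) (\<lambda>b. if b = k then 1 else 0)))\<^sup>2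
          = p (Suc k) * (cmod (?Bs ! l $$ (a, k)))\<^sup>2" by simp
      qed
      finally show ?thesis by simp
    qed
    have t0: "0 \<le> t" by (simp add: t_def)
    have "(\<Sum>a<m. Re (?Z $$ (a, a))) = (\<Sum>a<m. \<Sum>l<length ?Bs. \<Sum>k<n. p (Suc k) * (cmod (?Bs ! l $$ (a, k)))\<^sup>2)"
      using Zdiag by (intro sum.cong refl) simp
    also have "\<dots> \<le> (\<Sum>a<m. \<Sum>l<length ?Bs. \<Sum>k<n. K * (cmod (?Bs ! l $$ (a, k)))\<^sup>2)"
      using pK by (intro sum_mono mult_right_mono) auto
    also have "\<dots> = (\<Sum>l<length ?Bs. \<Sum>a<m. \<Sum>k<n. K * (cmod (?Bs ! l $$ (a, k)))\<^sup>2)" by (rule sum.swap)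
    also have "\<dots> = K * t" unfolding t_def kraus_norm_def by (simp only: sum_distrib_left)
    also have "\<dots> \<le> K * (t + 1)" using K1 by simp
    finally have tr: "(\<Sum>a<m. Re (?Z $$ (a, a))) \<le> K * (t + 1)" .
    have "exp Lg * (capacity m n As p q * exp Lh) \<le> exp Lg * rel_det m q ?Y"
      using capacity_le[OF h, of m As p q] unfolding rel_det_adjoint_mult[OF h] Lh_def by simp
    also have "\<dots> = rel_det m q ?Z"
      unfolding ZY Lg_def using psd_leading_minor(1)[OF Yh Ypsd]
      by (intro rel_det_congruence[OF g Yc, symmetric]) auto
    also have "\<dots> \<le> exp (\<tau> * ln (K * (t + 1)))"
      unfolding \<tau>_def using K1 t0 by (intro rel_det_psd_bound[OF Zc Zh Zpsd q tr]) simp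
    finally have "exp Lg * (exp (ln (capacity m n As p q)) * exp Lh) \<le> exp (\<tau> * ln (K * (t + 1)))"
      using cap by simp
    then have "Lg + (ln (capacity m n As p q) + Lh) \<le> \<tau> * ln (K * (t + 1))"
      by (simp only: exp_add[symmetric] exp_le_cancel_iff)
    also have "ln (K * (t + 1)) = ln K + ln (t + 1)" using K1 t0 by (intro ln_mult_pos) auto
    finally have "Lg + Lh \<le> \<tau> * ln K + \<tau> * ln (t + 1) - ln (capacity m n As p q)"
      by (simp add: algebra_simps)
    also have "\<dots> \<le> t / 2 + C"
      using log_bounded_by_linear[OF \<tau>0 t0] by (simp add: C_def)
    finally show ?thesis unfolding Lg_def Lh_def t_def .
  qed
  then show ?thesis by blast
qed

lemma cp_map_one_index:
  assumes "set Bs \<subseteq> carrier_mat m n" "a < m" "b < m"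
  shows "cp_map m Bs (1\<^sub>m n) $$ (a, b) = (\<Sum>l<length Bs. \<Sum>c<n. Bs ! l $$ (a, c) * cnj (Bs ! l $$ (b, c)))"
proof -
  have "(Bs ! l * 1\<^sub>m n * mat_adjoint (Bs ! l)) $$ (a, b) = (\<Sum>c<n. Bs ! l $$ (a, c) * cnj (Bs ! l $$ (b, c)))"
    if "l < length Bs" for l
  proof -
    have B: "Bs ! l \<in> carrier_mat m n" using assms(1) that by auto
    show ?thesis
      by (subst sandwich_index[OF B one_carrier_mat assms(2,3)])
        (intro sum.cong refl, simp add: if_distrib cong: if_cong)
  qed
  then show ?thesis by (simp add: cp_map_index[OF assms(1) one_carrier_mat assms(2,3)])
qed

definition elementary :: "nat \<Rightarrow> nat \<Rightarrow> nat \<Rightarrow> complex \<Rightarrow> complex mat" where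
  "elementary k a b \<sigma> = mat k k (\<lambda>(i, j). (if i = j then 1 else 0) + (if i = a \<and> j = b then \<sigma> else 0))"

lemma elementary_GL_flag:
  assumes "a \<le> b" "a = b \<longrightarrow> 1 + \<sigma> \<noteq> 0"
  shows "elementary k a b \<sigma> \<in> GL_flag k"
  using assms by (auto simp: elementary_def GL_flag_iff)

lemma cmod_add_square: "(cmod (x + y))\<^sup>2 = (cmod x)\<^sup>2 + (2 * Re (y * cnj x) + (cmod y)\<^sup>2)"
  unfolding cmod_power2 by (simp add: power2_eq_square algebra_simps)

text \<open>An exact expansion in \<open>\<sigma>\<close>. Its linear coefficient is the entry
  \<open>(a, b)\<close> of \<open>T(I)\<close>: the marginal is the gradient of the trace along
  elementary directions.\<close>

lemma kraus_norm_elementary: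
  assumes Bs: "set Bs \<subseteq> carrier_mat m n" and ab: "a < m" "b < m"
  shows "kraus_norm m n (cp_scale (elementary m a b \<sigma>) (1\<^sub>m n) Bs)
    = kraus_norm m n Bs + (2 * Re (cnj \<sigma> * cp_map m Bs (1\<^sub>m n) $$ (a, b)) + (cmod \<sigma>)\<^sup>2 * Re (cp_map m Bs (1\<^sub>m n) $$ (a, a)))"
proof -
  let ?D = "elementary m a b \<sigma>"
  have Dc: "?D \<in> carrier_mat m m" by (simp add: elementary_def)
  have entry: "cp_scale ?D (1\<^sub>m n) Bs ! l $$ (i, c) = Bs ! l $$ (i, c) + (if i = b then cnj \<sigma> * Bs ! l $$ (a, c) else 0)"
    if l: "l < length Bs" and i: "i < m" and c: "c < n" for l i c
  proof -
    have B: "Bs ! l \<in> carrier_mat m n" using Bs l by auto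
    have "mat_adjoint ?D * Bs ! l \<in> carrier_mat m n" using B mat_adjoint_carrier[OF Dc] by (rule mult_carrier_mat[rotated])
    then have "cp_scale ?D (1\<^sub>m n) Bs ! l $$ (i, c) = (mat_adjoint ?D * Bs ! l) $$ (i, c)"
      using l by (simp add: cp_scale_def right_mult_one_mat)
    also have "\<dots> = (\<Sum>s<m. cnj (?D $$ (s, i)) * Bs ! l $$ (s, c))"
      using Dc B i c by (simp add: scalar_prod_def lessThan_atLeast0)
    also have "\<dots> = (\<Sum>s<m. (if s = i then Bs ! l $$ (s, c) else 0) + (if s = a then (if i = b then cnj \<sigma> * Bs ! l $$ (s, c) else 0) else 0))"
      using i by (intro sum.cong refl) (auto simp: elementary_def distrib_right)
    also have "\<dots> = Bs ! l $$ (i, c) + (if i = b then cnj \<sigma> * Bs ! l $$ (a, c) else 0)"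
      using i ab by (simp add: sum.distrib)
    finally show ?thesis .
  qed
  have "kraus_norm m n (cp_scale ?D (1\<^sub>m n) Bs)
      = (\<Sum>l<length Bs. \<Sum>i<m. \<Sum>c<n. (cmod (Bs ! l $$ (i, c)))\<^sup>2 +
          (if i = b then 2 * Re (cnj \<sigma> * Bs ! l $$ (a, c) * cnj (Bs ! l $$ (b, c))) + (cmod \<sigma>)\<^sup>2 * (cmod (Bs ! l $$ (a, c)))\<^sup>2 else 0))"
    unfolding kraus_norm_def length_cp_scale
    by (intro sum.cong refl) (auto simp: entry cmod_add_square norm_mult power_mult_distrib)
  also have "\<dots> = kraus_norm m n Bs + (\<Sum>l<length Bs. \<Sum>i<m. \<Sum>c<n.
          (if i = b then 2 * Re (cnj \<sigma> * Bs ! l $$ (a, c) * cnj (Bs ! l $$ (b, c))) + (cmod \<sigma>)\<^sup>2 * (cmod (Bs ! l $$ (a, c)))\<^sup>2 else 0))"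
    unfolding kraus_norm_def by (simp only: sum.distrib)
  also have "(\<Sum>l<length Bs. \<Sum>i<m. \<Sum>c<n.
          (if i = b then 2 * Re (cnj \<sigma> * Bs ! l $$ (a, c) * cnj (Bs ! l $$ (b, c))) + (cmod \<sigma>)\<^sup>2 * (cmod (Bs ! l $$ (a, c)))\<^sup>2 else 0))
     = (\<Sum>l<length Bs. \<Sum>c<n. 2 * Re (cnj \<sigma> * Bs ! l $$ (a, c) * cnj (Bs ! l $$ (b, c))) + (cmod \<sigma>)\<^sup>2 * (cmod (Bs ! l $$ (a, c)))\<^sup>2)"
  proof (rule sum.cong[OF refl])
    fix l
    have "(\<Sum>i<m. \<Sum>c<n. (if i = b then 2 * Re (cnj \<sigma> * Bs ! l $$ (a, c) * cnj (Bs ! l $$ (b, c))) + (cmod \<sigma>)\<^sup>2 * (cmod (Bs ! l $$ (a, c)))\<^sup>2 else 0))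
       = (\<Sum>i<m. if i = b then (\<Sum>c<n. 2 * Re (cnj \<sigma> * Bs ! l $$ (a, c) * cnj (Bs ! l $$ (b, c))) + (cmod \<sigma>)\<^sup>2 * (cmod (Bs ! l $$ (a, c)))\<^sup>2) else 0)"
      by (intro sum.cong refl) simp
    also have "\<dots> = (\<Sum>c<n. 2 * Re (cnj \<sigma> * Bs ! l $$ (a, c) * cnj (Bs ! l $$ (b, c))) + (cmod \<sigma>)\<^sup>2 * (cmod (Bs ! l $$ (a, c)))\<^sup>2)"
      using ab by (simp only: sum.delta finite_lessThan lessThan_iff if_True)
    finally show "(\<Sum>i<m. \<Sum>c<n. (if i = b then 2 * Re (cnj \<sigma> * Bs ! l $$ (a, c) * cnj (Bs ! l $$ (b, c))) + (cmod \<sigma>)\<^sup>2 * (cmod (Bs ! l $$ (a, c)))\<^sup>2 else 0))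
       = (\<Sum>c<n. 2 * Re (cnj \<sigma> * Bs ! l $$ (a, c) * cnj (Bs ! l $$ (b, c))) + (cmod \<sigma>)\<^sup>2 * (cmod (Bs ! l $$ (a, c)))\<^sup>2)" .
  qed
  also have "\<dots> = 2 * Re (cnj \<sigma> * cp_map m Bs (1\<^sub>m n) $$ (a, b)) + (cmod \<sigma>)\<^sup>2 * Re (cp_map m Bs (1\<^sub>m n) $$ (a, a))"
  proof -
    have "Re (cp_map m Bs (1\<^sub>m n) $$ (a, a)) = (\<Sum>l<length Bs. \<Sum>c<n. (cmod (Bs ! l $$ (a, c)))\<^sup>2)"
      by (simp add: cp_map_one_index[OF Bs ab(1) ab(1)] complex_norm_square[symmetric] del: of_real_power)
    moreover have "2 * Re (cnj \<sigma> * cp_map m Bs (1\<^sub>m n) $$ (a, b))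
       = (\<Sum>l<length Bs. \<Sum>c<n. 2 * Re (cnj \<sigma> * Bs ! l $$ (a, c) * cnj (Bs ! l $$ (b, c))))"
      by (simp only: cp_map_one_index[OF Bs ab] sum_distrib_left mult.assoc Re_sum)
    ultimately show ?thesis by (simp only: sum.distrib sum_distrib_left)
  qed
  finally show ?thesis .
qed

lemma ln_quadratic_lower_bound:
  fixes x :: real
  assumes "\<bar>x\<bar> \<le> 1 / 2"
  shows "x - 2 * x\<^sup>2 \<le> ln (1 + x)"
proof (cases "0 \<le> x")
  case True
  then have "x - x\<^sup>2 \<le> ln (1 + x)" using assms by (intro ln_one_plus_pos_lower_bound) auto
  then show ?thesis by (smt (verit) zero_le_power2)
next
  case False
  then have "- (- x) - 2 * (- x)\<^sup>2 \<le> ln (1 - (- x))" using assms by (intro ln_one_minus_pos_lower_bound) auto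
  then show ?thesis by simp
qed

text \<open>A step of size \<open>s\<close> along an elementary matrix lowers F to first order by
  \<open>2 * s\<close> times the defect of one entry, at a second-order cost of order
  \<open>s^2\<close>. A point within \<open>s^2\<close> of the infimum leaves no room for a larger
  gain, so every defect is of order \<open>s\<close>.\<close>

lemma near_minimizer_marginal:
  assumes Bs: "set Bs \<subseteq> carrier_mat m n" and q: "\<forall>i\<in>{1..m}. 0 \<le> q i"
    and s: "0 < s" "s \<le> 1 / 2" and B: "kraus_norm m n Bs \<le> B"
    and min: "\<And>D. D \<in> GL_flag m \<Longrightarrow> kraus_norm m n Bs
       \<le> kraus_norm m n (cp_scale D (1\<^sub>m n) Bs) - 2 * (\<Sum>i<m. q (Suc i) * ln (cmod (D $$ (i, i)))) + s\<^sup>2"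
    and ab: "a < m" "b < m"
  shows "cmod (cp_map m Bs (1\<^sub>m n) $$ (a, b) - (if a = b then of_real (q (Suc a)) else 0)) \<le> s * (1 + B + 2 * (\<Sum>i=1..m. q i))"
proof -
  let ?T = "\<lambda>a b. cp_map m Bs (1\<^sub>m n) $$ (a, b)"
  define Q where "Q = (\<Sum>i=1..m. q i)"
  have Q0: "0 \<le> Q" unfolding Q_def using q by (intro sum_nonneg) auto
  have Tdiag: "?T a a = of_real (Re (?T a a))" "0 \<le> Re (?T a a)" "Re (?T a a) \<le> B" if "a < m" for a
  proof -
    have eq: "?T a a = of_real (\<Sum>l<length Bs. \<Sum>c<n. (cmod (Bs ! l $$ (a, c)))\<^sup>2)"
      by (simp add: cp_map_one_index[OF Bs that that] complex_norm_square[symmetric] del: of_real_power)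
    then show "?T a a = of_real (Re (?T a a))" by simp
    show "0 \<le> Re (?T a a)" unfolding eq Re_complex_of_real by (intro sum_nonneg) simp
    have "(\<Sum>c<n. (cmod (Bs ! l $$ (a, c)))\<^sup>2) \<le> (\<Sum>a<m. \<Sum>c<n. (cmod (Bs ! l $$ (a, c)))\<^sup>2)" for l
      using that by (intro member_le_sum[of a "{..<m}" "\<lambda>a. \<Sum>c<n. (cmod (Bs ! l $$ (a, c)))\<^sup>2"] sum_nonneg) auto
    then have "Re (?T a a) \<le> kraus_norm m n Bs"
      unfolding eq Re_complex_of_real kraus_norm_def by (intro sum_mono)
    then show "Re (?T a a) \<le> B" using B by simp
  qed
  have B0: "0 \<le> B" using B kraus_norm_nonneg[of m n Bs] by linarith
  have off: "cmod (?T a b) \<le> s * (1 + B + 2 * Q)" if ab: "a < b" "b < m" for a b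
  proof (cases "?T a b = 0")
    case True
    then show ?thesis using s B0 Q0 by simp
  next
    case False
    \<comment> \<open>The phase makes the linear term real and as negative as a step of length
      \<open>s\<close> permits. As \<open>a < b\<close>, the elementary matrix is unipotent and the
      logarithmic term is 0.\<close>
    define \<sigma> where "\<sigma> = - of_real s * ?T a b / of_real (cmod (?T a b))"
    have "cnj \<sigma> * ?T a b = - of_real s * (cnj (?T a b) * ?T a b) / of_real (cmod (?T a b))"
      by (simp add: \<sigma>_def)
    also have "\<dots> = of_real (- s * cmod (?T a b))"
      using False by (simp add: complex_norm_square[symmetric] mult.commute[of "cnj _"] power2_eq_square)
    finally have re: "Re (cnj \<sigma> * ?T a b) = - s * cmod (?T a b)" by (simp only: Re_complex_of_real)
    have cs: "cmod \<sigma> = s" using False s by (simp add: \<sigma>_def norm_mult norm_divide)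
    have D: "elementary m a b \<sigma> \<in> GL_flag m" using ab by (intro elementary_GL_flag) auto
    have "(\<Sum>i<m. q (Suc i) * ln (cmod (elementary m a b \<sigma> $$ (i, i)))) = 0"
      using ab by (intro sum.neutral) (auto simp: elementary_def)
    with min[OF D] kraus_norm_elementary[OF Bs, of a b \<sigma>] ab
    have "0 \<le> 2 * (- s * cmod (?T a b)) + s\<^sup>2 * Re (?T a a) + s\<^sup>2"
      unfolding re cs by simp
    moreover have "s\<^sup>2 * Re (?T a a) \<le> s\<^sup>2 * B"
      using Tdiag(3)[of a] ab by (intro mult_left_mono) auto
    ultimately have "s * (2 * cmod (?T a b)) \<le> s * (s * (B + 1))"
      by (simp add: power2_eq_square algebra_simps)
    then have "2 * cmod (?T a b) \<le> s * (B + 1)" using s by simp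
    moreover have "0 \<le> s * (B + 1)" "0 \<le> s * Q" using s B0 Q0 by auto
    ultimately show ?thesis by (simp add: algebra_simps)
  qed
  have diag: "\<bar>Re (?T b b) - q (Suc b)\<bar> \<le> s * (1 + B + 2 * Q)" if b: "b < m" for b
  proof -
    \<comment> \<open>A diagonal step whose sign opposes the defect. The bound
      \<open>s <= 1/2\<close> keeps \<open>1 + x\<close> positive and within the range of
      \<open>ln_quadratic_lower_bound\<close>.\<close>
    define x where "x = (if Re (?T b b) \<ge> q (Suc b) then - s else s)"
    have x: "\<bar>x\<bar> = s" "x\<^sup>2 = s\<^sup>2" using s by (auto simp: x_def)
    have x1: "0 < 1 + x" using x s by linarith
    have "1 + complex_of_real x \<noteq> 0" using x1 by (metis Re_complex_of_real less_irrefl of_real_1 of_real_add zero_complex.sel(1))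
    then have D: "elementary m b b (of_real x) \<in> GL_flag m" by (intro elementary_GL_flag) auto
    have "(\<Sum>i<m. q (Suc i) * ln (cmod (elementary m b b (of_real x) $$ (i, i)))) = (\<Sum>i<m. if i = b then q (Suc i) * ln (1 + x) else 0)"
    proof (intro sum.cong refl)
      fix i assume "i \<in> {..<m}"
      moreover have "cmod (1 + complex_of_real x) = 1 + x"
        using x1 by (metis abs_of_pos norm_of_real of_real_1 of_real_add)
      ultimately show "q (Suc i) * ln (cmod (elementary m b b (of_real x) $$ (i, i))) = (if i = b then q (Suc i) * ln (1 + x) else 0)"
        by (simp add: elementary_def)
    qed
    also have "\<dots> = q (Suc b) * ln (1 + x)" using b by simp
    finally have ln: "(\<Sum>i<m. q (Suc i) * ln (cmod (elementary m b b (of_real x) $$ (i, i)))) = q (Suc b) * ln (1 + x)" .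
    have qb: "0 \<le> q (Suc b)" using q b by simp
    have "q (Suc b) \<le> Q" unfolding Q_def using q b by (intro member_le_sum) auto
    have "0 \<le> 2 * (x * Re (?T b b)) + s\<^sup>2 * Re (?T b b) - 2 * (q (Suc b) * ln (1 + x)) + s\<^sup>2"
      using min[OF D] kraus_norm_elementary[OF Bs b b, of "of_real x"] unfolding ln by (simp add: x)
    moreover have "q (Suc b) * (x - 2 * s\<^sup>2) \<le> q (Suc b) * ln (1 + x)"
      using ln_quadratic_lower_bound[of x] x s qb by (intro mult_left_mono) auto
    moreover have "s\<^sup>2 * Re (?T b b) \<le> s\<^sup>2 * B" using Tdiag(3)[OF b] by (intro mult_left_mono) auto
    moreover have "s\<^sup>2 * q (Suc b) \<le> s\<^sup>2 * Q" using \<open>q (Suc b) \<le> Q\<close> by (intro mult_left_mono) auto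
    ultimately have "0 \<le> 2 * (x * (Re (?T b b) - q (Suc b))) + s\<^sup>2 * (B + 4 * Q + 1)"
      by (simp add: algebra_simps)
    moreover have "x * (Re (?T b b) - q (Suc b)) = - (s * \<bar>Re (?T b b) - q (Suc b)\<bar>)"
      by (auto simp: x_def abs_if algebra_simps)
    ultimately have "s * (2 * \<bar>Re (?T b b) - q (Suc b)\<bar>) \<le> s * (s * (B + 4 * Q + 1))"
      by (simp add: power2_eq_square algebra_simps)
    then have "2 * \<bar>Re (?T b b) - q (Suc b)\<bar> \<le> s * (B + 4 * Q + 1)" using s by simp
    moreover have "0 \<le> s * (B + 1)" using s B0 by auto
    ultimately show ?thesis by (simp add: algebra_simps)
  qed
  consider "a < b" | "b < a" | "a = b" by linarith
  then have "cmod (?T a b - (if a = b then of_real (q (Suc a)) else 0)) \<le> s * (1 + B + 2 * Q)"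
  proof cases
    case 1
    then show ?thesis using off[of a b] ab by simp
  next
    case 2
    \<comment> \<open>Triangular variations do not reach entries below the diagonal; these follow by
      Hermitian symmetry.\<close>
    have "?T a b = cnj (?T b a)" using ab by (simp add: cp_map_one_index[OF Bs] mult.commute)
    then show ?thesis using off[of b a] ab 2 by simp
  next
    case 3
    have "?T b b - of_real (q (Suc b)) = of_real (Re (?T b b) - q (Suc b))"
      using Tdiag(1)[OF ab(2)] by simp
    then have "cmod (?T b b - of_real (q (Suc b))) = \<bar>Re (?T b b) - q (Suc b)\<bar>" by (metis norm_of_real real_norm_def)
    then show ?thesis using 3 diag[OF ab(2)] by simp
  qed
  then show ?thesis unfolding Q_def .
qed

lemma frobenius_norm_le:
  assumes "M \<in> carrier_mat k k" "0 \<le> e" "\<And>a b. a < k \<Longrightarrow> b < k \<Longrightarrow> cmod (M $$ (a, b)) \<le> e"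
  shows "frobenius_norm M \<le> real k * e"
proof -
  have "(\<Sum>i<k. \<Sum>j<k. (cmod (M $$ (i, j)))\<^sup>2) \<le> (\<Sum>i<k. \<Sum>j<k. e\<^sup>2)"
    using assms by (intro sum_mono power_mono) auto
  also have "\<dots> = (real k * e)\<^sup>2" by (simp add: power2_eq_square)
  finally show ?thesis
    using assms unfolding frobenius_norm_def by (intro real_le_lsqrt) (auto intro!: sum_nonneg)
qed

text \<open>Both marginals are controlled at one near-minimizer by varying \<open>g\<close> and
  \<open>h\<close> separately. For \<open>h\<close>, \<open>near_minimizer_marginal\<close> is
  applied to the adjoint Kraus operators, for which the two factors exchange roles.\<close>

theorem capacity_pos_imp_scalable:
  assumes kraus: "set As \<subseteq> carrier_mat m n"
    and p: "\<forall>j\<in>{1..n}. 0 \<le> p j"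
    and q: "antimono_on {1..m} q" "\<forall>i\<in>{1..m}. 0 \<le> q i"
    and cap: "0 < capacity m n As p q" and \<epsilon>: "0 < \<epsilon>"
  shows "\<exists>g\<in>GL_flag m. \<exists>h\<in>GL_flag n.
    frobenius_norm (cp_map m (cp_scale g h As) (1\<^sub>m n) - diag_of m q) \<le> \<epsilon> \<and>
    frobenius_norm (cp_dual n (cp_scale g h As) (1\<^sub>m m) - diag_of n p) \<le> \<epsilon>"
proof -
  define Lg where "Lg g = 2 * (\<Sum>i<m. q (Suc i) * ln (cmod (g $$ (i, i))))" for g :: "complex mat"
  define Lh where "Lh h = 2 * (\<Sum>j<n. p (Suc j) * ln (cmod (h $$ (j, j))))" for h :: "complex mat"
  define F where "F = (\<lambda>(g, h). kraus_norm m n (cp_scale g h As) - Lg g - Lh h)"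
  obtain C where C: "\<And>g h. g \<in> GL_flag m \<Longrightarrow> h \<in> GL_flag n \<Longrightarrow>
      Lg g + Lh h \<le> kraus_norm m n (cp_scale g h As) / 2 + C"
    using capacity_pos_coercive[OF kraus p q cap] unfolding Lg_def Lh_def by blast
  let ?G = "GL_flag m \<times> GL_flag n"
  have FC: "kraus_norm m n (cp_scale g h As) / 2 \<le> F (g, h) + C" if "g \<in> GL_flag m" "h \<in> GL_flag n" for g h
    using C[OF that] by (simp add: F_def)
  have bdd: "bdd_below (F ` ?G)"
  proof (rule bdd_belowI2[of _ "- C"])
    fix x assume "x \<in> ?G"
    then obtain g h where x: "x = (g, h)" "g \<in> GL_flag m" "h \<in> GL_flag n" by auto
    show "- C \<le> F x" unfolding x(1)
      using FC[OF x(2,3)] kraus_norm_nonneg[of m n "cp_scale g h As"] by linarith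
  qed
  have ne: "(1\<^sub>m m, 1\<^sub>m n) \<in> ?G" using one_GL_flag by simp
  \<comment> \<open>By coercivity this bounds the trace wherever F is at most its value at the
    identities plus 1; the near-minimizer is such a place because \<open>s^2 <= 1\<close>. The
    absolute value makes \<open>B\<close> nonnegative.\<close>
  define B where "B = 2 * \<bar>F (1\<^sub>m m, 1\<^sub>m n) + 1 + C\<bar>"
  define Q where "Q = (\<Sum>i=1..m. q i) + (\<Sum>j=1..n. p j)"
  have Q: "(\<Sum>i=1..m. q i) \<le> Q" "(\<Sum>j=1..n. p j) \<le> Q" "0 \<le> Q"
    unfolding Q_def using p q(2) sum_nonneg[of "{1..m}" q] sum_nonneg[of "{1..n}" p] by auto
  have B0: "0 \<le> B" by (simp add: B_def)
  define N where "N = (real m + real n + 1) * (1 + B + 2 * Q)"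
  have N: "0 < N" unfolding N_def using B0 Q(3) by (intro mult_pos_pos) auto
  \<comment> \<open>\<open>N\<close> covers the entrywise bound for either marginal times the matrix
    size, which converts entries to the Frobenius norm; hence \<open>s * N <= \<epsilon>\<close> is
    what the conclusion asks for.\<close>
  define s where "s = min (1 / 2) (\<epsilon> / N)"
  have s: "0 < s" "s \<le> 1 / 2" "s * N \<le> \<epsilon>" using \<epsilon> N by (auto simp: s_def min_def field_simps)
  have "\<exists>x\<in>?G. F x < (INF x\<in>?G. F x) + s\<^sup>2"
    using cINF_less_iff[OF _ bdd, of "(INF x\<in>?G. F x) + s\<^sup>2"] ne s(1) by fastforce
  then obtain g h where g: "g \<in> GL_flag m" and h: "h \<in> GL_flag n" and gh: "F (g, h) < (INF x\<in>?G. F x) + s\<^sup>2" by auto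
  have near: "F (g, h) \<le> F (g', h') + s\<^sup>2" if "g' \<in> GL_flag m" "h' \<in> GL_flag n" for g' h'
    using gh cINF_lower[OF bdd, of "(g', h')"] that by fastforce
  have gc: "g \<in> carrier_mat m m" and hc: "h \<in> carrier_mat n n" using g h by (auto simp: GL_flag_iff)
  have "s\<^sup>2 \<le> 1" using s by (simp add: power_le_one)
  then have "F (g, h) \<le> F (1\<^sub>m m, 1\<^sub>m n) + 1"
    by (rule order.trans[OF near[OF one_GL_flag one_GL_flag] add_left_mono])
  then have "F (g, h) + C \<le> \<bar>F (1\<^sub>m m, 1\<^sub>m n) + 1 + C\<bar>" by simp
  then have FB: "2 * (F (g, h) + C) \<le> B" by (simp add: B_def)
  define Bs where "Bs = cp_scale g h As"
  have Bsc: "set Bs \<subseteq> carrier_mat m n" unfolding Bs_def by (rule cp_scale_carrier[OF kraus gc hc])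
  have "kraus_norm m n Bs \<le> 2 * (F (g, h) + C)"
    using FC[OF g h] unfolding Bs_def by (simp add: divide_le_eq mult.commute)
  then have KB: "kraus_norm m n Bs \<le> B" using FB by (rule order.trans)
  have lnmult: "ln (cmod ((a * D) $$ (i, i))) = ln (cmod (a $$ (i, i))) + ln (cmod (D $$ (i, i)))"
    if "a \<in> GL_flag k" "D \<in> GL_flag k" "i < k" for a D k i
    using that GL_flag_mult(2)[OF that] by (simp add: norm_mult ln_mult GL_flag_iff)
  have T: "cmod (cp_map m Bs (1\<^sub>m n) $$ (a, b) - (if a = b then of_real (q (Suc a)) else 0)) \<le> s * (1 + B + 2 * (\<Sum>i=1..m. q i))"
    if "a < m" "b < m" for a b
  proof (rule near_minimizer_marginal[OF Bsc q(2) s(1,2) KB _ that])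
    fix D assume D: "D \<in> GL_flag m"
    then have Dc: "D \<in> carrier_mat m m" by (simp add: GL_flag_iff)
    have "cp_scale D (1\<^sub>m n) Bs = cp_scale (g * D) h As"
      unfolding Bs_def using cp_scale_cp_scale[OF kraus gc hc Dc one_carrier_mat] hc by simp
    moreover have "Lg (g * D) = Lg g + Lg D"
      unfolding Lg_def using lnmult[OF g D] by (simp add: distrib_left sum.distrib)
    ultimately show "kraus_norm m n Bs \<le> kraus_norm m n (cp_scale D (1\<^sub>m n) Bs) - 2 * (\<Sum>i<m. q (Suc i) * ln (cmod (D $$ (i, i)))) + s\<^sup>2"
      using near[OF GL_flag_mult(1)[OF g D] h] unfolding F_def Bs_def Lg_def by simp
  qed
  define Ds where "Ds = map mat_adjoint Bs"
  have Dsc: "set Ds \<subseteq> carrier_mat n m" using Bsc by (auto simp: Ds_def)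
  have Asc': "set (map mat_adjoint As) \<subseteq> carrier_mat n m" using kraus by auto
  have KD: "kraus_norm n m Ds \<le> B" using KB kraus_norm_adjoint[OF Bsc] by (simp add: Ds_def)
  have T': "cmod (cp_map n Ds (1\<^sub>m m) $$ (a, b) - (if a = b then of_real (p (Suc a)) else 0)) \<le> s * (1 + B + 2 * (\<Sum>i=1..n. p i))"
    if "a < n" "b < n" for a b
  proof (rule near_minimizer_marginal[OF Dsc p s(1,2) KD _ that])
    fix D assume D: "D \<in> GL_flag n"
    then have Dc: "D \<in> carrier_mat n n" by (simp add: GL_flag_iff)
    have "cp_scale D (1\<^sub>m m) Ds = cp_scale D (1\<^sub>m m) (cp_scale h g (map mat_adjoint As))"
      unfolding Ds_def Bs_def map_adjoint_cp_scale[OF kraus gc hc] ..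
    also have "\<dots> = cp_scale (h * D) g (map mat_adjoint As)"
      using cp_scale_cp_scale[OF Asc' hc gc Dc one_carrier_mat] gc by simp
    also have "\<dots> = map mat_adjoint (cp_scale g (h * D) As)"
      using map_adjoint_cp_scale[OF kraus gc, of "h * D"] hc Dc by simp
    finally have "kraus_norm n m (cp_scale D (1\<^sub>m m) Ds) = kraus_norm m n (cp_scale g (h * D) As)"
      using kraus_norm_adjoint[OF cp_scale_carrier[OF kraus gc, of "h * D"]] hc Dc by simp
    moreover have "kraus_norm n m Ds = kraus_norm m n (cp_scale g h As)"
      using kraus_norm_adjoint[OF Bsc] by (simp add: Ds_def Bs_def)
    moreover have "Lh (h * D) = Lh h + Lh D"
      unfolding Lh_def using lnmult[OF h D] by (simp add: distrib_left sum.distrib)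
    ultimately show "kraus_norm n m Ds \<le> kraus_norm n m (cp_scale D (1\<^sub>m m) Ds) - 2 * (\<Sum>i<n. p (Suc i) * ln (cmod (D $$ (i, i)))) + s\<^sup>2"
      using near[OF g GL_flag_mult(1)[OF h D]] unfolding F_def Lh_def by simp
  qed
  have eps: "real k * (s * (1 + B + 2 * r)) \<le> \<epsilon>" if "k \<le> m + n" "r \<le> Q" for k r
  proof -
    have "real k * (s * (1 + B + 2 * r)) = s * (real k * (1 + B + 2 * r))" by simp
    also have "\<dots> \<le> s * (real k * (1 + B + 2 * Q))" using s that by (intro mult_left_mono) auto
    also have "\<dots> \<le> s * N" unfolding N_def using s that B0 Q(3) by (intro mult_left_mono mult_right_mono) auto
    finally show ?thesis using s(3) by linarith
  qed
  have e0: "0 \<le> s * (1 + B + 2 * (\<Sum>i=1..m. q i))" "0 \<le> s * (1 + B + 2 * (\<Sum>i=1..n. p i))"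
    using s B0 p q(2) sum_nonneg[of "{1..m}" q] sum_nonneg[of "{1..n}" p] by auto
  have Tc: "cp_map m Bs (1\<^sub>m n) \<in> carrier_mat m m" by (rule cp_map_carrier[OF Bsc])
  have Tc': "cp_map n Ds (1\<^sub>m m) \<in> carrier_mat n n" by (rule cp_map_carrier[OF Dsc])
  have dc: "diag_of k w \<in> carrier_mat k k" for k w by (simp add: diag_of_def mat_diag_def)
  have dind: "diag_of k w $$ (a, b) = (if a = b then of_real (w (Suc a)) else 0)" if "a < k" "b < k" for k w a b
    using that by (simp add: diag_of_def mat_diag_def)
  have "frobenius_norm (cp_map m Bs (1\<^sub>m n) - diag_of m q) \<le> real m * (s * (1 + B + 2 * (\<Sum>i=1..m. q i)))"
    using T e0 Tc dc[of m q] dind[of _ m _ q] by (intro frobenius_norm_le) auto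
  moreover have "frobenius_norm (cp_map n Ds (1\<^sub>m m) - diag_of n p) \<le> real n * (s * (1 + B + 2 * (\<Sum>i=1..n. p i)))"
    using T' e0 Tc' dc[of n p] dind[of _ n _ p] by (intro frobenius_norm_le) auto
  moreover have "cp_dual n Bs (1\<^sub>m m) = cp_map n Ds (1\<^sub>m m)" by (simp add: cp_dual_eq_cp_map Ds_def)
  ultimately have "frobenius_norm (cp_map m Bs (1\<^sub>m n) - diag_of m q) \<le> \<epsilon>"
    "frobenius_norm (cp_dual n Bs (1\<^sub>m m) - diag_of n p) \<le> \<epsilon>"
    using eps[of m, OF _ Q(1)] eps[of n, OF _ Q(2)] by simp_all
  then show ?thesis using g h unfolding Bs_def by blast
qed

section \<open>From rank-nondecreasing maps to positive capacity\<close>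

text \<open>For each level \<open>a\<close>, an orthonormal basis of the flag member of dimension
  \<open>a\<close>, with no relation between levels. Entries from position \<open>a\<close> on
  vanish, so that the same vectors can be used in every dimension from \<open>a\<close>
  upwards.\<close>

definition flag_family :: "nat \<Rightarrow> (nat \<Rightarrow> nat \<Rightarrow> nat \<Rightarrow> complex) \<Rightarrow> bool" where
  "flag_family k V \<longleftrightarrow> (\<forall>a\<in>{1..k}. orthonormal k (V a) {..<a}) \<and> (\<forall>a i s. a \<le> s \<longrightarrow> V a i s = 0)"

abbreviation flag_index :: "nat \<Rightarrow> (nat \<times> nat) set" where
  "flag_index k \<equiv> Sigma {1..k} (\<lambda>a. {..<a})"

text \<open>The value at \<open>x\<close> of the quadratic form of \<open>T(y y^+)\<close>; it
  vanishes iff \<open>x\<close> is orthogonal to all \<open>A_l y\<close>.\<close>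

definition overlap :: "nat \<Rightarrow> nat \<Rightarrow> complex mat list \<Rightarrow> (nat \<Rightarrow> complex) \<Rightarrow> (nat \<Rightarrow> complex) \<Rightarrow> real" where
  "overlap m n As x y = (\<Sum>l<length As. (cmod (form m n (As ! l) x y))\<^sup>2)"

lemma overlap_nonneg [simp]: "0 \<le> overlap m n As x y"
  unfolding overlap_def by (intro sum_nonneg) simp

lemma flag_family_cmod_le:
  "flag_family k V \<Longrightarrow> a \<in> {1..k} \<Longrightarrow> i < a \<Longrightarrow> s < k \<Longrightarrow> cmod (V a i s) \<le> 1"
  unfolding flag_family_def by (blast intro: orthonormal_cmod_le[of k "V a" "{..<a}" i s])

lemma form_tendsto:
  assumes "\<And>i. i < m \<Longrightarrow> (\<lambda>k. x k i) \<longlonglongrightarrow> a i" "\<And>i. i < n \<Longrightarrow> (\<lambda>k. y k i) \<longlonglongrightarrow> b i"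
  shows "(\<lambda>k. form m n A (x k) (y k)) \<longlonglongrightarrow> form m n A a b"
  unfolding form_def by (intro tendsto_sum tendsto_mult tendsto_cnj tendsto_const assms) auto

text \<open>Flag families form a compact set: entries are bounded by 1 and orthonormality passes to
  limits. Both families are put on one index set in order to obtain a common subsequence.\<close>

lemma flag_family_convergent_subseq:
  assumes V: "\<And>k. flag_family m (V k)" and U: "\<And>k. flag_family n (U k)"
  obtains r V' U' where "strict_mono (r :: nat \<Rightarrow> nat)" "flag_family m V'" "flag_family n U'"
    and "\<And>a i s. (a, i) \<in> flag_index m \<Longrightarrow> s < m \<Longrightarrow> (\<lambda>k. V (r k) a i s) \<longlonglongrightarrow> V' a i s"
    and "\<And>b j s. (b, j) \<in> flag_index n \<Longrightarrow> s < n \<Longrightarrow> (\<lambda>k. U (r k) b j s) \<longlonglongrightarrow> U' b j s"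
proof -
  let ?IV = "flag_index m \<times> {..<m}" and ?IU = "flag_index n \<times> {..<n}"
  define f where "f k = case_sum (\<lambda>((a, i), s). V k a i s) (\<lambda>((b, j), s). U k b j s)" for k
  have fin: "finite (?IV <+> ?IU)" by auto
  have bound: "cmod (f k x) \<le> 1" if "x \<in> ?IV <+> ?IU" for k x
    using that flag_family_cmod_le[OF V[of k]] flag_family_cmod_le[OF U[of k]] by (auto simp: f_def)
  obtain r l where r: "strict_mono (r :: nat \<Rightarrow> nat)" and l: "\<And>x. x \<in> ?IV <+> ?IU \<Longrightarrow> (\<lambda>k. f (r k) x) \<longlonglongrightarrow> l x"
    using bounded_family_convergent_subseq[OF fin, of f 1] bound by blast
  define V' where "V' a i s = (if s < a then l (Inl ((a, i), s)) else 0)" for a i s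
  define U' where "U' b j s = (if s < b then l (Inr ((b, j), s)) else 0)" for b j s
  have lV: "(\<lambda>k. V (r k) a i s) \<longlonglongrightarrow> V' a i s" if "(a, i) \<in> flag_index m" "s < m" for a i s
  proof (cases "s < a")
    case True
    have "Inl ((a, i), s) \<in> ?IV <+> ?IU" using that by auto
    from l[OF this] show ?thesis using True by (simp add: f_def V'_def)
  next
    case False
    then have "V (r k) a i s = 0" for k using V[of "r k"] by (simp add: flag_family_def)
    then show ?thesis using False by (simp add: V'_def)
  qed
  have lU: "(\<lambda>k. U (r k) b j s) \<longlonglongrightarrow> U' b j s" if "(b, j) \<in> flag_index n" "s < n" for b j s
  proof (cases "s < b")
    case True
    have "Inr ((b, j), s) \<in> ?IV <+> ?IU" using that by auto
    from l[OF this] show ?thesis using True by (simp add: f_def U'_def)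
  next
    case False
    then have "U (r k) b j s = 0" for k using U[of "r k"] by (simp add: flag_family_def)
    then show ?thesis using False by (simp add: U'_def)
  qed
  have lim: "flag_family k W'"
    if W: "\<And>t. flag_family k (W t)" and W0: "\<And>a i s. a \<le> s \<Longrightarrow> W' a i s = 0"
      and lW: "\<And>a i s. (a, i) \<in> flag_index k \<Longrightarrow> s < k \<Longrightarrow> (\<lambda>t. W t a i s) \<longlonglongrightarrow> W' a i s" for k W W'
  proof -
    have "cip k (W' a i) (W' a j) = (if i = j then 1 else 0)" if a: "a \<in> {1..k}" "i < a" "j < a" for a i j
    proof -
      have "(\<lambda>t. cip k (W t a i) (W t a j)) \<longlonglongrightarrow> cip k (W' a i) (W' a j)"
        using a by (intro cip_tendsto lW) auto
      moreover have "cip k (W t a i) (W t a j) = (if i = j then 1 else 0)" for t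
        using W[of t] a unfolding flag_family_def orthonormal_def by blast
      ultimately show ?thesis by (simp add: LIMSEQ_const_iff)
    qed
    then show ?thesis using W0 by (auto simp: flag_family_def orthonormal_def)
  qed
  have "flag_family m V'"
    by (rule lim[where W = "\<lambda>t. V (r t)"]) (use V lV in \<open>auto simp: V'_def\<close>)
  moreover have "flag_family n U'"
    by (rule lim[where W = "\<lambda>t. U (r t)"]) (use U lU in \<open>auto simp: U'_def\<close>)
  ultimately show thesis using that r lV lU by blast
qed

text \<open>Otherwise a fixed selection \<open>(S, S')\<close> of too large weight would have
  overlaps below \<open>1 / (k + 1)\<close> for suitable families, for every \<open>k\<close>; in
  the limit they vanish, which \<open>rank_nondecreasing_families\<close> excludes. There are
  finitely many selections, so the smallest of their thresholds serves all. It does not depend on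
  \<open>h\<close>.\<close>

lemma rank_nondecreasing_uniform:
  assumes rank: "rank_nondecreasing m n As p q" and kraus: "set As \<subseteq> carrier_mat m n"
    and p: "antimono_on {1..n} p" "\<forall>j\<in>{1..n}. 0 \<le> p j"
    and q: "antimono_on {1..m} q" "\<forall>i\<in>{1..m}. 0 \<le> q i"
  shows "\<exists>\<delta>>0. \<forall>V U S S'. flag_family m V \<longrightarrow> flag_family n U \<longrightarrow> S \<subseteq> flag_index m \<longrightarrow> S' \<subseteq> flag_index n \<longrightarrow>
      (\<forall>(a, i)\<in>S. \<forall>(b, j)\<in>S'. overlap m n As (V a i) (U b j) < \<delta>) \<longrightarrow>
      (\<Sum>(a, i)\<in>S. \<Delta> m q a) + (\<Sum>(b, j)\<in>S'. \<Delta> n p b) \<le> (\<Sum>j=1..n. p j)"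
proof -
  define good where "good \<delta> SS \<longleftrightarrow> (\<forall>V U. flag_family m V \<longrightarrow> flag_family n U \<longrightarrow>
      (\<forall>(a, i)\<in>fst SS. \<forall>(b, j)\<in>snd SS. overlap m n As (V a i) (U b j) < \<delta>) \<longrightarrow>
      (\<Sum>(a, i)\<in>fst SS. \<Delta> m q a) + (\<Sum>(b, j)\<in>snd SS. \<Delta> n p b) \<le> (\<Sum>j=1..n. p j))" for \<delta> SS
  have single: "\<exists>\<delta>>0. good \<delta> (S, S')" if S: "S \<subseteq> flag_index m" "S' \<subseteq> flag_index n" for S S'
  proof (rule ccontr)
    assume no: "\<not> (\<exists>\<delta>>0. good \<delta> (S, S'))"
    have bad: "\<not> good (1 / real (Suc k)) (S, S')" for k using no by force
    have viol: "\<not> ((\<Sum>(a, i)\<in>S. \<Delta> m q a) + (\<Sum>(b, j)\<in>S'. \<Delta> n p b) \<le> (\<Sum>j=1..n. p j))"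
      using bad[of 0] unfolding good_def by auto
    have "\<exists>V U. flag_family m V \<and> flag_family n U \<and>
        (\<forall>r\<in>S. \<forall>c\<in>S'. overlap m n As (V (fst r) (snd r)) (U (fst c) (snd c)) < 1 / real (Suc k))" for k
      using bad[of k] unfolding good_def by (simp add: split_beta) blast
    then obtain V U where VU: "\<And>k. flag_family m (V k) \<and> flag_family n (U k) \<and>
        (\<forall>r\<in>S. \<forall>c\<in>S'. overlap m n As (V k (fst r) (snd r)) (U k (fst c) (snd c)) < 1 / real (Suc k))"
      by metis
    have V: "flag_family m (V k)" and U: "flag_family n (U k)" for k using VU by blast+
    have small: "overlap m n As (V k a i) (U k b j) < 1 / real (Suc k)" if "(a, i) \<in> S" "(b, j) \<in> S'" for k a i b j
      using VU[of k] that by (metis fst_conv snd_conv)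
    obtain r V' U' where r: "strict_mono (r :: nat \<Rightarrow> nat)" and V': "flag_family m V'" and U': "flag_family n U'"
      and lV: "\<And>a i s. (a, i) \<in> flag_index m \<Longrightarrow> s < m \<Longrightarrow> (\<lambda>k. V (r k) a i s) \<longlonglongrightarrow> V' a i s"
      and lU: "\<And>b j s. (b, j) \<in> flag_index n \<Longrightarrow> s < n \<Longrightarrow> (\<lambda>k. U (r k) b j s) \<longlonglongrightarrow> U' b j s"
      by (rule flag_family_convergent_subseq[OF V U]) (rule that; assumption)
    have "form m n A (V' a i) (U' b j) = 0" if A: "A \<in> set As" and ai: "(a, i) \<in> S" and bj: "(b, j) \<in> S'" for A a i b j
    proof -
      obtain l where l: "l < length As" "A = As ! l" using A by (auto simp: in_set_conv_nth)
      have le: "(cmod (form m n A (V (r k) a i) (U (r k) b j)))\<^sup>2 \<le> 1 / real (Suc (r k))" for k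
      proof -
        have "(cmod (form m n A (V (r k) a i) (U (r k) b j)))\<^sup>2 \<le> overlap m n As (V (r k) a i) (U (r k) b j)"
          unfolding overlap_def l(2) using l(1)
          by (intro member_le_sum[of l "{..<length As}" "\<lambda>l. (cmod (form m n (As ! l) (V (r k) a i) (U (r k) b j)))\<^sup>2"]) auto
        then show ?thesis using small[OF ai bj, of "r k"] by linarith
      qed
      have "(\<lambda>k. form m n A (V (r k) a i) (U (r k) b j)) \<longlonglongrightarrow> form m n A (V' a i) (U' b j)"
        using ai bj S by (intro form_tendsto lV lU) auto
      then have lim: "(\<lambda>k. (cmod (form m n A (V (r k) a i) (U (r k) b j)))\<^sup>2) \<longlonglongrightarrow> (cmod (form m n A (V' a i) (U' b j)))\<^sup>2"
        by (intro tendsto_power tendsto_norm)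
      have "(\<lambda>k. 1 / real (Suc k)) \<longlonglongrightarrow> 0" by (rule LIMSEQ_Suc[OF lim_1_over_n])
      from LIMSEQ_subseq_LIMSEQ[OF this r] have "(\<lambda>k. 1 / real (Suc (r k))) \<longlonglongrightarrow> 0" by (simp add: o_def)
      from LIMSEQ_le[OF lim this] le have "(cmod (form m n A (V' a i) (U' b j)))\<^sup>2 \<le> 0" by blast
      then show ?thesis by simp
    qed
    then have "(\<Sum>(a, i)\<in>S. \<Delta> m q a) + (\<Sum>(b, j)\<in>S'. \<Delta> n p b) \<le> (\<Sum>j=1..n. p j)"
      using V' U' S by (intro rank_nondecreasing_families[OF rank kraus p q, where V = V' and U = U'])
        (auto simp: flag_family_def)
    with viol show False by blast
  qed
  have mono: "good \<delta>' SS" if "good \<delta> SS" "\<delta>' \<le> \<delta>" for \<delta> \<delta>' SS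
    using that unfolding good_def by (fastforce intro: less_le_trans)
  have "\<exists>\<delta>>0. \<forall>SS\<in>F. good \<delta> SS" if "finite F" "F \<subseteq> Pow (flag_index m) \<times> Pow (flag_index n)" for F
    using that
  proof (induction F rule: finite_induct)
    case empty
    then show ?case by (intro exI[of _ 1]) simp
  next
    case (insert SS F)
    then obtain \<delta> where \<delta>: "0 < \<delta>" "\<forall>SS\<in>F. good \<delta> SS" by auto
    obtain \<delta>' where \<delta>': "0 < \<delta>'" "good \<delta>' SS" using single[of "fst SS" "snd SS"] insert.prems by auto
    have "\<forall>SS'\<in>insert SS F. good (min \<delta> \<delta>') SS'"
      using \<delta> \<delta>' mono by (metis insert_iff min.cobounded1 min.cobounded2)
    then show ?case using \<delta> \<delta>' by (intro exI[of _ "min \<delta> \<delta>'"]) auto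
  qed
  from this[of "Pow (flag_index m) \<times> Pow (flag_index n)"]
  obtain \<delta> where "0 < \<delta>" "\<forall>SS\<in>Pow (flag_index m) \<times> Pow (flag_index n). good \<delta> SS" by auto
  then show ?thesis unfolding good_def by (intro exI[of _ \<delta>]) auto
qed

text \<open>Each block is diagonalized on its own, and extending the eigenvectors by zeros turns the
  bases into a flag family.\<close>

lemma flag_diagonalization:
  assumes herm: "\<And>a. a \<in> {1..k} \<Longrightarrow> hermitian a (Z a)"
  obtains V \<nu> where "flag_family k V"
    and "\<And>a x. a \<in> {1..k} \<Longrightarrow> cip a x (mv a (Z a) x) = of_real (\<Sum>i<a. \<nu> a i * (cmod (cip a (V a i) x))\<^sup>2)"
    and "\<And>a i. a \<in> {1..k} \<Longrightarrow> i < a \<Longrightarrow> cip a (V a i) (mv a (Z a) (V a i)) = of_real (\<nu> a i)"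
    and "\<And>a. a \<in> {1..k} \<Longrightarrow> det (mat a a (\<lambda>(i, j). Z a i j)) = of_real (\<Prod>i<a. \<nu> a i)"
proof -
  define diag where "diag a D \<longleftrightarrow> orthonormal a (fst D) {..<a} \<and>
      (\<forall>x. cip a x (mv a (Z a) x) = of_real (\<Sum>i<a. snd D i * (cmod (cip a (fst D i) x))\<^sup>2)) \<and>
      (\<forall>i<a. cip a (fst D i) (mv a (Z a) (fst D i)) = of_real (snd D i)) \<and>
      det (mat a a (\<lambda>(i, j). Z a i j)) = of_real (\<Prod>i<a. snd D i)" for a and D :: "(nat \<Rightarrow> nat \<Rightarrow> complex) \<times> (nat \<Rightarrow> real)"
  have "\<exists>D. diag a D" if a: "a \<in> {1..k}" for a
  proof -
    obtain U lam where "orthonormal a U {..<a}"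
      "\<And>x. cip a x (mv a (Z a) x) = of_real (\<Sum>i<a. lam i * (cmod (cip a (U i) x))\<^sup>2)"
      "\<And>i. i < a \<Longrightarrow> cip a (U i) (mv a (Z a) (U i)) = of_real (lam i)"
      "det (mat a a (\<lambda>(i, j). Z a i j)) = of_real (\<Prod>i<a. lam i)"
      by (rule hermitian_diagonalization[OF herm[OF a]]) (rule that; assumption)
    then have "diag a (U, lam)" by (simp add: diag_def del: of_real_sum of_real_prod)
    then show ?thesis by blast
  qed
  then obtain D where D: "\<And>a. a \<in> {1..k} \<Longrightarrow> diag a (D a)" by metis
  define V where "V a i s = (if s < a then fst (D a) i s else 0)" for a i s
  define \<nu> where "\<nu> a i = snd (D a) i" for a i
  have cipV: "cip a (V a i) x = cip a (fst (D a) i) x" "cip a x (V a i) = cip a x (fst (D a) i)" for a i x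
    by (simp_all add: cip_def V_def)
  have mvV: "cip a x (mv a (Z a) (V a i)) = cip a x (mv a (Z a) (fst (D a) i))" for a i x
    by (simp add: cip_def mv_def V_def)
  have "cip k (V a i) (V a j) = cip a (fst (D a) i) (fst (D a) j)" if "a \<le> k" for a i j
    unfolding cip_def using that by (intro sum.mono_neutral_cong_right) (auto simp: V_def)
  then have fam: "flag_family k V"
    using D by (auto simp: flag_family_def orthonormal_def diag_def V_def)
  show thesis
  proof (rule that[of V \<nu>])
    fix a assume a: "a \<in> {1..k}"
    note Da = D[OF a, unfolded diag_def]
    show "cip a x (mv a (Z a) x) = of_real (\<Sum>i<a. \<nu> a i * (cmod (cip a (V a i) x))\<^sup>2)" for x
      unfolding cipV \<nu>_def using Da by blast
    show "cip a (V a i) (mv a (Z a) (V a i)) = of_real (\<nu> a i)" if "i < a" for i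
      unfolding cipV mvV \<nu>_def using Da that by blast
    show "det (mat a a (\<lambda>(i, j). Z a i j)) = of_real (\<Prod>i<a. \<nu> a i)"
      unfolding \<nu>_def using Da by blast
  qed (rule fam)
qed

text \<open>Levels of weight 0 are discarded: their eigenvalues may vanish, where a logarithm
  carries no information.\<close>

lemma sum_flag_weights:
  assumes "antimono_on {1..k} w" "\<forall>j\<in>{1..k}. 0 \<le> w j"
  shows "(\<Sum>(a, i)\<in>{(a, i) \<in> flag_index k. 0 < \<Delta> k w a}. \<Delta> k w a * f a i) = (\<Sum>a=1..k. \<Sum>i<a. \<Delta> k w a * f a i)"
proof -
  have "(\<Sum>(a, i)\<in>{(a, i) \<in> flag_index k. 0 < \<Delta> k w a}. \<Delta> k w a * f a i) = (\<Sum>(a, i)\<in>flag_index k. \<Delta> k w a * f a i)"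
  proof (intro sum.mono_neutral_left ballI)
    fix x assume "x \<in> flag_index k - {(a, i) \<in> flag_index k. 0 < \<Delta> k w a}"
    moreover obtain a i where "x = (a, i)" by (cases x)
    ultimately have x: "x = (a, i)" "a \<in> {1..k}" "\<not> 0 < \<Delta> k w a" by simp_all
    then have "\<Delta> k w a = 0" using \<Delta>_nonneg[OF assms x(2)] by linarith
    then show "(case x of (a, i) \<Rightarrow> \<Delta> k w a * f a i) = 0" using x by simp
  qed auto
  also have "\<dots> = (\<Sum>a=1..k. \<Sum>i<a. \<Delta> k w a * f a i)" by (rule sum.Sigma[symmetric]) auto
  finally show ?thesis .
qed

lemma sum_flag_total: "(\<Sum>a=1..k. \<Sum>i<a. \<Delta> k w a) = (\<Sum>j=1..k. w j)"
proof -
  have "(\<Sum>a=1..k. \<Sum>i<a. \<Delta> k w a) = (\<Sum>a=1..k. \<Delta> k w a * real (card ({..<k} \<inter> {..<a})))"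
    by (intro sum.cong refl) (auto simp: Int_absorb1 mult.commute)
  also have "\<dots> = (\<Sum>i<k. w (Suc i))" by (rule \<Delta>_sum_card) simp
  also have "\<dots> = (\<Sum>j=1..k. w j)" by (simp add: sum.atLeast1_atMost_eq)
  finally show ?thesis .
qed

lemma prod_rpow_flag_weights:
  assumes w: "antimono_on {1..k} w" "\<forall>j\<in>{1..k}. 0 \<le> w j"
    and pos: "\<And>a i. a \<in> {1..k} \<Longrightarrow> i < a \<Longrightarrow> 0 < \<Delta> k w a \<Longrightarrow> 0 < \<nu> a i"
  shows "(\<Prod>a=1..k. rpow (\<Prod>i<a. \<nu> a i) (\<Delta> k w a))
    = exp (\<Sum>(a, i)\<in>{(a, i) \<in> flag_index k. 0 < \<Delta> k w a}. \<Delta> k w a * ln (\<nu> a i))"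
proof -
  have "(\<Prod>a=1..k. rpow (\<Prod>i<a. \<nu> a i) (\<Delta> k w a)) = (\<Prod>a=1..k. exp (\<Sum>i<a. \<Delta> k w a * ln (\<nu> a i)))"
  proof (intro prod.cong refl)
    fix a assume a: "a \<in> {1..k}"
    show "rpow (\<Prod>i<a. \<nu> a i) (\<Delta> k w a) = exp (\<Sum>i<a. \<Delta> k w a * ln (\<nu> a i))"
    proof (cases "\<Delta> k w a = 0")
      case True
      then show ?thesis by (simp add: rpow_def)
    next
      case False
      then have "0 < \<Delta> k w a" using \<Delta>_nonneg[OF w a] by linarith
      then have \<nu>: "0 < \<nu> a i" if "i < a" for i using pos[OF a that] by simp
      then have \<nu>0: "\<nu> a i \<noteq> 0" if "i < a" for i using that by force
      have "0 < (\<Prod>i<a. \<nu> a i)" using \<nu> by (intro prod_pos) simp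
      moreover have "ln (\<Prod>i<a. \<nu> a i) = (\<Sum>i<a. ln (\<nu> a i))" using \<nu>0 by (intro ln_prod) auto
      ultimately show ?thesis by (simp add: rpow_eq_exp sum_distrib_left)
    qed
  qed
  also have "\<dots> = exp (\<Sum>a=1..k. \<Sum>i<a. \<Delta> k w a * ln (\<nu> a i))" by (simp add: exp_sum)
  finally show ?thesis by (simp only: sum_flag_weights[OF w])
qed


text \<open>\<open>h P h^+\<close> is the sum over \<open>b\<close> of \<open>\<Delta> n p b\<close>
  times the Gram matrix formed from the first \<open>b\<close> columns of \<open>h\<close>. These
  columns live on the first \<open>b\<close> positions because \<open>h\<close> is triangular, so
  expanding each block in its eigenbasis writes the form of \<open>T(h P h^+)\<close> as a sum over
  pairs \<open>(b, j)\<close>.\<close>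

lemma block_quadratic_expansion:
  assumes As: "set As \<subseteq> carrier_mat m n" and h: "h \<in> GL_flag n"
    and lam: "\<And>b x. b \<in> {1..n} \<Longrightarrow> cip b x (mv b (\<lambda>s t. \<Sum>k<b. h $$ (s, k) * cnj (h $$ (t, k))) x)
        = of_real (\<Sum>j<b. lam b j * (cmod (cip b (U b j) x))\<^sup>2)"
    and U0: "\<And>b j s. b \<le> s \<Longrightarrow> U b j s = 0"
  shows "(\<Sum>l<length As. \<Sum>k<n. p (Suc k) * (cmod (form m n (As ! l) x (\<lambda>b. h $$ (b, k))))\<^sup>2)
    = (\<Sum>(b, j)\<in>flag_index n. \<Delta> n p b * lam b j * overlap m n As x (U b j))"
proof -
  have hz: "h $$ (t, k) = 0" if "k < t" "t < n" for t k using h that by (auto simp: GL_flag_iff)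
  have block: "(\<Sum>k<b. (cmod (form m n A x (\<lambda>t. h $$ (t, k))))\<^sup>2) = (\<Sum>j<b. lam b j * (cmod (form m n A x (U b j)))\<^sup>2)"
    if b: "b \<in> {1..n}" for A b
  proof -
    define z where "z t = cnj (\<Sum>a<m. cnj (x a) * A $$ (a, t))" for t
    have formz: "form m n A x y = cip b z y" if "\<And>t. b \<le> t \<Longrightarrow> t < n \<Longrightarrow> y t = 0" for y
    proof -
      have "form m n A x y = (\<Sum>t<n. cnj (z t) * y t)"
        unfolding form_def by (subst sum.swap) (simp add: z_def sum_distrib_right)
      also have "\<dots> = (\<Sum>t<b. cnj (z t) * y t)"
        using b that by (intro sum.mono_neutral_right) auto
      finally show ?thesis by (simp add: cip_def)
    qed
    have "of_real (\<Sum>k<b. (cmod (form m n A x (\<lambda>t. h $$ (t, k))))\<^sup>2)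
      = (of_real (\<Sum>k<b. 1 * (cmod (\<Sum>a<b. cnj (z a) * h $$ (a, k)))\<^sup>2) :: complex)"
      using formz hz by (simp add: cip_def)
    also have "\<dots> = cip b z (mv b (\<lambda>s t. \<Sum>k<b. h $$ (s, k) * cnj (h $$ (t, k))) z)"
      by (rule gram_quadratic_form[symmetric]) simp
    also have "\<dots> = of_real (\<Sum>j<b. lam b j * (cmod (cip b (U b j) z))\<^sup>2)" by (rule lam[OF b])
    also have "(\<Sum>j<b. lam b j * (cmod (cip b (U b j) z))\<^sup>2) = (\<Sum>j<b. lam b j * (cmod (form m n A x (U b j)))\<^sup>2)"
    proof (rule sum.cong[OF refl])
      fix j
      have "cmod (cip b (U b j) z) = cmod (cnj (cip b z (U b j)))" by (simp only: cip_cnj)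
      then show "lam b j * (cmod (cip b (U b j) z))\<^sup>2 = lam b j * (cmod (form m n A x (U b j)))\<^sup>2"
        using formz[of "U b j"] U0 by simp
    qed
    finally show ?thesis by (simp only: of_real_eq_iff)
  qed
  have "(\<Sum>k<n. p (Suc k) * (cmod (form m n A x (\<lambda>b. h $$ (b, k))))\<^sup>2)
      = (\<Sum>b=1..n. \<Sum>j<b. \<Delta> n p b * lam b j * (cmod (form m n A x (U b j)))\<^sup>2)" for A
  proof -
    let ?f = "\<lambda>k. (cmod (form m n A x (\<lambda>b. h $$ (b, k))))\<^sup>2"
    have "(\<Sum>k<n. p (Suc k) * ?f k) = (\<Sum>k<n. \<Sum>b=1..n. if k < b then \<Delta> n p b * ?f k else 0)"
    proof (rule sum.cong[OF refl])
      fix k assume "k \<in> {..<n}"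
      then have k: "k < n" by simp
      have "(\<Sum>b=1..n. if k < b then \<Delta> n p b * ?f k else 0) = (\<Sum>b=Suc k..n. \<Delta> n p b * ?f k)"
        by (intro sum.mono_neutral_cong_right) auto
      then show "p (Suc k) * ?f k = (\<Sum>b=1..n. if k < b then \<Delta> n p b * ?f k else 0)"
        by (simp add: sum_distrib_right[symmetric] \<Delta>_sum[OF k])
    qed
    also have "\<dots> = (\<Sum>b=1..n. \<Sum>k<n. if k < b then \<Delta> n p b * ?f k else 0)" by (rule sum.swap)
    also have "\<dots> = (\<Sum>b=1..n. \<Sum>j<b. \<Delta> n p b * lam b j * (cmod (form m n A x (U b j)))\<^sup>2)"
    proof (rule sum.cong[OF refl])
      fix b assume b: "b \<in> {1..n}"
      have "(\<Sum>k<n. if k < b then \<Delta> n p b * ?f k else 0) = (\<Sum>k<b. \<Delta> n p b * ?f k)"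
        using b by (intro sum.mono_neutral_cong_right) auto
      also have "\<dots> = \<Delta> n p b * (\<Sum>k<b. ?f k)" by (simp add: sum_distrib_left)
      also have "\<dots> = (\<Sum>j<b. \<Delta> n p b * lam b j * (cmod (form m n A x (U b j)))\<^sup>2)"
        unfolding block[OF b] by (simp add: sum_distrib_left mult.assoc)
      finally show "(\<Sum>k<n. if k < b then \<Delta> n p b * ?f k else 0) = (\<Sum>j<b. \<Delta> n p b * lam b j * (cmod (form m n A x (U b j)))\<^sup>2)" .
    qed
    finally show ?thesis .
  qed
  then have "(\<Sum>l<length As. \<Sum>k<n. p (Suc k) * (cmod (form m n (As ! l) x (\<lambda>b. h $$ (b, k))))\<^sup>2)
    = (\<Sum>l<length As. \<Sum>b=1..n. \<Sum>j<b. \<Delta> n p b * lam b j * (cmod (form m n (As ! l) x (U b j)))\<^sup>2)" by simp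
  also have "\<dots> = (\<Sum>l<length As. \<Sum>(b, j)\<in>flag_index n. \<Delta> n p b * lam b j * (cmod (form m n (As ! l) x (U b j)))\<^sup>2)"
    by (intro sum.cong refl sum.Sigma) auto
  also have "\<dots> = (\<Sum>(b, j)\<in>flag_index n. \<Delta> n p b * lam b j * overlap m n As x (U b j))"
    by (subst sum.swap) (simp add: overlap_def sum_distrib_left split_beta)
  finally show ?thesis .
qed

text \<open>Along each edge, that is, an overlap of at least \<open>\<delta>\<close>, the eigenvalue
  \<open>\<nu> a i\<close> of a leading block of \<open>T(h P h^+)\<close> dominates
  \<open>\<Delta> n p b * \<delta> * lam b j\<close>. In logarithms this is the edge hypothesis of
  \<open>weighted_sum_bound\<close> for \<open>- ln (\<nu> a i)\<close> and
  \<open>ln (lam b j)\<close>, and the weighted sums are the logarithms of the two relative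
  determinants.\<close>

lemma rel_det_lower_bound:
  assumes kraus: "set As \<subseteq> carrier_mat m n"
    and p: "antimono_on {1..n} p" "\<forall>j\<in>{1..n}. 0 \<le> p j"
    and q: "antimono_on {1..m} q" "\<forall>i\<in>{1..m}. 0 \<le> q i"
    and traces: "(\<Sum>j=1..n. p j) = (\<Sum>i=1..m. q i)"
    and \<delta>: "0 < \<delta>"
    and hall: "\<And>V U S S'. flag_family m V \<Longrightarrow> flag_family n U \<Longrightarrow> S \<subseteq> flag_index m \<Longrightarrow> S' \<subseteq> flag_index n \<Longrightarrow>
      (\<forall>(a, i)\<in>S. \<forall>(b, j)\<in>S'. overlap m n As (V a i) (U b j) < \<delta>) \<Longrightarrow>
      (\<Sum>(a, i)\<in>S. \<Delta> m q a) + (\<Sum>(b, j)\<in>S'. \<Delta> n p b) \<le> (\<Sum>j=1..n. p j)"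
    and K: "\<And>b. b \<in> {1..n} \<Longrightarrow> 0 < \<Delta> n p b \<Longrightarrow> - ln (\<Delta> n p b * \<delta>) < K"
    and h: "h \<in> GL_flag n"
  shows "exp (- (K * (\<Sum>j=1..n. p j))) * rel_det n p (mat_adjoint h * h) \<le> rel_det m q (cp_map m As (h * diag_of n p * mat_adjoint h))"
proof -
  define \<tau> where "\<tau> = (\<Sum>j=1..n. p j)"
  have hc: "h \<in> carrier_mat n n" using h by (simp add: GL_flag_iff)
  have Pc: "diag_of n p \<in> carrier_mat n n" by (simp add: diag_of_def mat_diag_def)
  let ?X = "h * diag_of n p * mat_adjoint h"
  let ?Y = "cp_map m As ?X"
  have Xc: "?X \<in> carrier_mat n n" using hc Pc by auto
  have Yc: "?Y \<in> carrier_mat m m" by (rule cp_map_carrier[OF kraus])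
  let ?Z = "\<lambda>i j. ?Y $$ (i, j)"
  have Yh: "hermitian m ?Z"
    by (rule cp_map_hermitian_quadratic(1)[OF kraus Xc]) (rule triangular_conjugate_gram[OF hc])
  have Yq: "cip m x (mv m ?Z x)
    = of_real (\<Sum>l<length As. \<Sum>k<n. p (Suc k) * (cmod (form m n (As ! l) x (\<lambda>b. h $$ (b, k))))\<^sup>2)" for x
    by (rule cp_map_hermitian_quadratic(2)[OF kraus Xc]) (rule triangular_conjugate_gram[OF hc])
  let ?H = "\<lambda>b s t. \<Sum>k<b. h $$ (s, k) * cnj (h $$ (t, k))"
  have hermH: "hermitian b (?H b)" for b by (rule gram_hermitian[where d = "\<lambda>_. 1"]) simp
  obtain U lam where U: "flag_family n U"
    and lam: "\<And>b x. b \<in> {1..n} \<Longrightarrow> cip b x (mv b (?H b) x) = of_real (\<Sum>j<b. lam b j * (cmod (cip b (U b j) x))\<^sup>2)"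
    and lamq: "\<And>b j. b \<in> {1..n} \<Longrightarrow> j < b \<Longrightarrow> cip b (U b j) (mv b (?H b) (U b j)) = of_real (lam b j)"
    and lamdet: "\<And>b. b \<in> {1..n} \<Longrightarrow> det (mat b b (\<lambda>(i, j). ?H b i j)) = of_real (\<Prod>j<b. lam b j)"
    by (rule flag_diagonalization[of n ?H, OF hermH]) (rule that; assumption)
  have hermZ: "hermitian a ?Z" if "a \<in> {1..m}" for a
    using Yh that unfolding hermitian_def by (meson atLeastAtMost_iff less_le_trans)
  obtain V \<nu> where V: "flag_family m V"
    and \<nu>q: "\<And>a i. a \<in> {1..m} \<Longrightarrow> i < a \<Longrightarrow> cip a (V a i) (mv a ?Z (V a i)) = of_real (\<nu> a i)"
    and \<nu>det: "\<And>a. a \<in> {1..m} \<Longrightarrow> det (mat a a (\<lambda>(i, j). ?Z i j)) = of_real (\<Prod>i<a. \<nu> a i)"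
    by (rule flag_diagonalization[of m "\<lambda>_. ?Z", OF hermZ]) (assumption | rule that)+
  have V0: "V a i s = 0" if "a \<le> s" for a i s using V that by (simp add: flag_family_def)
  have U0: "U b j s = 0" if "b \<le> s" for b j s using U that by (simp add: flag_family_def)
  \<comment> \<open>\<open>?H b\<close> is \<open>h_b h_b^+\<close> for the leading block
    \<open>h_b\<close> of \<open>h\<close>, whereas the capacity involves \<open>h^+ h\<close>. Both
    have the same leading determinants, the squared moduli of the diagonal products.\<close>
  have lamprod: "(\<Prod>j<b. lam b j) = (\<Prod>i<b. (cmod (h $$ (i, i)))\<^sup>2)" if b: "b \<in> {1..n}" for b
  proof -
    let ?h = "leading_block b h"
    have "mat b b (\<lambda>(i, j). ?H b i j) = ?h * mat_adjoint ?h"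
      by (intro eq_matI) (auto simp: leading_block_def scalar_prod_def lessThan_atLeast0)
    then have "of_real (\<Prod>j<b. lam b j) = det ?h * cnj (det ?h)"
      using lamdet[OF b] det_mult[OF leading_block_carrier mat_adjoint_carrier[OF leading_block_carrier], of b h]
      by (simp add: det_mat_adjoint[OF leading_block_carrier] del: of_real_prod)
    also have "\<dots> = of_real ((cmod (det ?h))\<^sup>2)" by (rule complex_norm_square[symmetric])
    finally have "(\<Prod>j<b. lam b j) = (cmod (det ?h))\<^sup>2" by (simp only: of_real_eq_iff)
    also have "\<dots> = (\<Prod>i<b. (cmod (h $$ (i, i)))\<^sup>2)"
      using b by (simp add: det_leading_block_triangular[OF h] prod_norm[symmetric] prod_power_distrib[symmetric])
    finally show ?thesis .
  qed
  have lampos: "0 < lam b j" if b: "b \<in> {1..n}" and j: "j < b" for b j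
  proof -
    have "of_real (lam b j) = (of_real (\<Sum>k<b. 1 * (cmod (\<Sum>a<b. cnj (U b j a) * h $$ (a, k)))\<^sup>2) :: complex)"
      unfolding lamq[OF that, symmetric] by (rule gram_quadratic_form) simp
    then have "lam b j = (\<Sum>k<b. 1 * (cmod (\<Sum>a<b. cnj (U b j a) * h $$ (a, k)))\<^sup>2)"
      by (simp only: of_real_eq_iff)
    then have "0 \<le> lam b j" by (simp add: sum_nonneg)
    moreover have "lam b j \<noteq> 0"
    proof
      assume "lam b j = 0"
      then have "(\<Prod>j<b. lam b j) = 0" using j by auto
      then have "(\<Prod>i<b. (cmod (h $$ (i, i)))\<^sup>2) = 0" using lamprod[OF b] by simp
      then show False using h b by (auto simp: GL_flag_iff)
    qed
    ultimately show ?thesis by simp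
  qed
  have \<nu>exp: "\<nu> a i = (\<Sum>(b, j)\<in>flag_index n. \<Delta> n p b * lam b j * overlap m n As (V a i) (U b j))"
    if a: "a \<in> {1..m}" "i < a" for a i
  proof -
    have "of_real (\<nu> a i) = cip a (V a i) (mv a ?Z (V a i))" using \<nu>q[OF a] by simp
    also have "\<dots> = cip m (V a i) (mv m ?Z (V a i))"
    proof -
      have "mv m ?Z (V a i) s = mv a ?Z (V a i) s" for s
        unfolding mv_def using a V0 by (intro sum.mono_neutral_right) auto
      then show ?thesis
        unfolding cip_def using a V0 by (intro sum.mono_neutral_cong_left) auto
    qed
    finally have "\<nu> a i = (\<Sum>l<length As. \<Sum>k<n. p (Suc k) * (cmod (form m n (As ! l) (V a i) (\<lambda>b. h $$ (b, k))))\<^sup>2)"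
      unfolding Yq by (simp only: of_real_eq_iff)
    also have "\<dots> = (\<Sum>(b, j)\<in>flag_index n. \<Delta> n p b * lam b j * overlap m n As (V a i) (U b j))"
      by (rule block_quadratic_expansion[OF kraus h]) (erule lam, erule U0)
    finally show ?thesis .
  qed
  have \<nu>ge: "\<Delta> n p b * lam b j * overlap m n As (V a i) (U b j) \<le> \<nu> a i"
    if a: "a \<in> {1..m}" "i < a" and b: "b \<in> {1..n}" "j < b" for a i b j
  proof -
    have nn: "0 \<le> (case x of (b, j) \<Rightarrow> \<Delta> n p b * lam b j * overlap m n As (V a i) (U b j))" if "x \<in> flag_index n" for x
      using that \<Delta>_nonneg[OF p] less_imp_le[OF lampos] by (auto intro!: mult_nonneg_nonneg)
    have "(case (b, j) of (b, j) \<Rightarrow> \<Delta> n p b * lam b j * overlap m n As (V a i) (U b j))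
       \<le> (\<Sum>(b, j)\<in>flag_index n. \<Delta> n p b * lam b j * overlap m n As (V a i) (U b j))"
      using nn b by (intro member_le_sum) auto
    then show ?thesis using \<nu>exp[OF a] by simp
  qed
  define RA where "RA = {(a, i) \<in> flag_index m. 0 < \<Delta> m q a}"
  define CB where "CB = {(b, j) \<in> flag_index n. 0 < \<Delta> n p b}"
  define E where "E r c \<longleftrightarrow> \<delta> \<le> overlap m n As (V (fst r) (snd r)) (U (fst c) (snd c))" for r c
  have finA: "finite RA" unfolding RA_def by (rule finite_subset[of _ "flag_index m"]) auto
  have finB: "finite CB" unfolding CB_def by (rule finite_subset[of _ "flag_index n"]) auto
  have sumA: "(\<Sum>r\<in>RA. \<Delta> m q (fst r)) = \<tau>"
    using sum_flag_weights[OF q, of "\<lambda>_ _. 1"] sum_flag_total[of m q] traces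
    by (simp add: RA_def \<tau>_def split_beta)
  have sumB: "(\<Sum>c\<in>CB. \<Delta> n p (fst c)) = \<tau>"
    using sum_flag_weights[OF p, of "\<lambda>_ _. 1"] sum_flag_total[of n p]
    by (simp add: CB_def \<tau>_def split_beta)
  have hall': "(\<Sum>r\<in>S. \<Delta> m q (fst r)) + (\<Sum>c\<in>S'. \<Delta> n p (fst c)) \<le> \<tau>"
    if S: "S \<subseteq> RA" "S' \<subseteq> CB" and noE: "\<forall>r\<in>S. \<forall>c\<in>S'. \<not> E r c" for S S'
  proof -
    have sub: "S \<subseteq> flag_index m" "S' \<subseteq> flag_index n" using S by (auto simp: RA_def CB_def)
    have "\<forall>(a, i)\<in>S. \<forall>(b, j)\<in>S'. overlap m n As (V a i) (U b j) < \<delta>"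
      using noE by (fastforce simp: E_def not_le)
    from hall[OF V U sub this] show ?thesis by (simp add: \<tau>_def split_beta)
  qed
  have key: "\<Delta> n p b * \<delta> * lam b j \<le> \<nu> a i" "0 < \<Delta> n p b * \<delta> * lam b j"
    if r: "(a, i) \<in> RA" and c: "(b, j) \<in> CB" and E: "E (a, i) (b, j)" for a i b j
  proof -
    have ab: "a \<in> {1..m}" "i < a" "b \<in> {1..n}" "j < b" "0 < \<Delta> n p b"
      using r c by (auto simp: RA_def CB_def)
    have pos: "0 < lam b j" using lampos ab by simp
    show "0 < \<Delta> n p b * \<delta> * lam b j" using ab pos \<delta> by simp
    have "\<Delta> n p b * \<delta> * lam b j = \<Delta> n p b * lam b j * \<delta>" by simp
    also have "\<dots> \<le> \<Delta> n p b * lam b j * overlap m n As (V a i) (U b j)"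
      using E ab pos by (intro mult_left_mono) (auto simp: E_def)
    also have "\<dots> \<le> \<nu> a i" by (rule \<nu>ge) (use ab in auto)
    finally show "\<Delta> n p b * \<delta> * lam b j \<le> \<nu> a i" .
  qed
  \<comment> \<open>A vertex of positive weight without edges would, together with all of
    \<open>CB\<close>, have weight above \<open>\<tau>\<close>. Hence it has an edge, along which
    \<open>\<nu> a i\<close> is bounded below by a positive number.\<close>
  have \<nu>pos: "0 < \<nu> a i" if r: "(a, i) \<in> RA" for a i
  proof -
    have "\<exists>c\<in>CB. E (a, i) c"
    proof (rule ccontr)
      assume "\<not> (\<exists>c\<in>CB. E (a, i) c)"
      then have "(\<Sum>r\<in>{(a, i)}. \<Delta> m q (fst r)) + (\<Sum>c\<in>CB. \<Delta> n p (fst c)) \<le> \<tau>"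
        using r by (intro hall') auto
      then show False using sumB r by (simp add: RA_def)
    qed
    then obtain b j where "(b, j) \<in> CB" "E (a, i) (b, j)" by auto
    from key[OF r this] show ?thesis by linarith
  qed
  have "(\<Sum>r\<in>RA. \<Delta> m q (fst r) * (- ln (\<nu> (fst r) (snd r)))) + (\<Sum>c\<in>CB. \<Delta> n p (fst c) * ln (lam (fst c) (snd c))) \<le> K * \<tau>"
  proof (rule weighted_sum_bound[OF finA finB _ sumA _ sumB hall'])
    show "0 \<le> \<Delta> m q (fst r)" if "r \<in> RA" for r using that by (auto simp: RA_def)
    show "0 \<le> \<Delta> n p (fst c)" if "c \<in> CB" for c using that by (auto simp: CB_def)
    fix r c assume rc: "r \<in> RA" "c \<in> CB" "E r c"
    obtain a i b j where eq: "r = (a, i)" "c = (b, j)" by (cases r, cases c)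
    note k = key[OF rc[unfolded eq]]
    have b: "b \<in> {1..n}" "0 < \<Delta> n p b" "0 < lam b j" using rc lampos by (auto simp: eq CB_def)
    have "ln (\<Delta> n p b * \<delta> * lam b j) \<le> ln (\<nu> a i)"
      using k by (intro ln_mono) auto
    moreover have "ln (\<Delta> n p b * \<delta> * lam b j) = ln (\<Delta> n p b * \<delta>) + ln (lam b j)"
      using b \<delta> by (intro ln_mult_pos) auto
    ultimately show "- ln (\<nu> (fst r) (snd r)) + ln (lam (fst c) (snd c)) < K"
      using K[OF b(1,2)] by (simp add: eq)
  qed auto
  then have le: "- (K * \<tau>) + (\<Sum>c\<in>CB. \<Delta> n p (fst c) * ln (lam (fst c) (snd c))) \<le> (\<Sum>r\<in>RA. \<Delta> m q (fst r) * ln (\<nu> (fst r) (snd r)))"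
    by (simp add: sum_negf)
  have Q: "rel_det m q ?Y = exp (\<Sum>r\<in>RA. \<Delta> m q (fst r) * ln (\<nu> (fst r) (snd r)))"
  proof -
    have "rel_det m q ?Y = (\<Prod>a=1..m. rpow (\<Prod>i<a. \<nu> a i) (\<Delta> m q a))"
      unfolding rel_det_leading_blocks[OF Yc]
      using \<nu>det by (intro prod.cong refl) (simp add: leading_block_def del: of_real_prod)
    also have "\<dots> = exp (\<Sum>(a, i)\<in>RA. \<Delta> m q a * ln (\<nu> a i))"
      unfolding RA_def using \<nu>pos by (intro prod_rpow_flag_weights[OF q]) (auto simp: RA_def)
    finally show ?thesis by (simp add: split_beta)
  qed
  have P: "rel_det n p (mat_adjoint h * h) = exp (\<Sum>c\<in>CB. \<Delta> n p (fst c) * ln (lam (fst c) (snd c)))"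
  proof -
    have "rel_det n p (mat_adjoint h * h) = (\<Prod>b=1..n. rpow (\<Prod>i<b. (cmod (h $$ (i, i)))\<^sup>2) (\<Delta> n p b))"
      unfolding rel_det_adjoint_mult[OF h] using h by (intro prod_rpow_flag[symmetric]) (auto simp: GL_flag_iff)
    also have "\<dots> = (\<Prod>b=1..n. rpow (\<Prod>j<b. lam b j) (\<Delta> n p b))"
      using lamprod by (intro prod.cong refl) simp
    also have "\<dots> = exp (\<Sum>(b, j)\<in>CB. \<Delta> n p b * ln (lam b j))"
      unfolding CB_def using lampos by (intro prod_rpow_flag_weights[OF p]) auto
    finally show ?thesis by (simp add: split_beta)
  qed
  show ?thesis using le unfolding P Q \<tau>_def[symmetric] exp_add[symmetric] by simp
qed

theorem rank_nondecreasing_imp_capacity_pos: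
  assumes rank: "rank_nondecreasing m n As p q" and kraus: "set As \<subseteq> carrier_mat m n"
    and p: "antimono_on {1..n} p" "\<forall>j\<in>{1..n}. 0 \<le> p j"
    and q: "antimono_on {1..m} q" "\<forall>i\<in>{1..m}. 0 \<le> q i"
    and traces: "(\<Sum>j=1..n. p j) = (\<Sum>i=1..m. q i)"
  shows "0 < capacity m n As p q"
proof -
  obtain \<delta> where \<delta>: "0 < \<delta>"
    and hall: "\<And>V U S S'. flag_family m V \<Longrightarrow> flag_family n U \<Longrightarrow> S \<subseteq> flag_index m \<Longrightarrow> S' \<subseteq> flag_index n \<Longrightarrow>
      (\<forall>(a, i)\<in>S. \<forall>(b, j)\<in>S'. overlap m n As (V a i) (U b j) < \<delta>) \<Longrightarrow>
      (\<Sum>(a, i)\<in>S. \<Delta> m q a) + (\<Sum>(b, j)\<in>S'. \<Delta> n p b) \<le> (\<Sum>j=1..n. p j)"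
    using rank_nondecreasing_uniform[OF rank kraus p q] by blast
  \<comment> \<open>One constant for all levels; the summand 1 provides the strict inequality that
    \<open>weighted_sum_bound\<close> asks for.\<close>
  define K where "K = 1 + (\<Sum>b=1..n. \<bar>ln (\<Delta> n p b * \<delta>)\<bar>)"
  have K: "- ln (\<Delta> n p b * \<delta>) < K" if "b \<in> {1..n}" for b
  proof -
    have "\<bar>ln (\<Delta> n p b * \<delta>)\<bar> \<le> (\<Sum>b=1..n. \<bar>ln (\<Delta> n p b * \<delta>)\<bar>)"
      by (rule member_le_sum[OF that]) auto
    then show ?thesis by (simp add: K_def)
  qed
  have "exp (- (K * (\<Sum>j=1..n. p j))) \<le> capacity m n As p q"
    unfolding capacity_def
  proof (rule cINF_greatest)
    show "GL_flag n \<noteq> {}" using one_GL_flag by blast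
    fix h assume h: "h \<in> GL_flag n"
    have "0 < rel_det n p (mat_adjoint h * h)" using rel_det_adjoint_mult[OF h] by simp
    then show "exp (- (K * (\<Sum>j=1..n. p j))) \<le> rel_det m q (cp_map m As (h * diag_of n p * mat_adjoint h)) / rel_det n p (mat_adjoint h * h)"
      using rel_det_lower_bound[OF kraus p q traces \<delta> hall K h] by (simp add: pos_le_divide_eq)
  qed
  then show ?thesis by (rule less_le_trans[OF exp_gt_zero])
qed

section \<open>From scalings to generic pairs\<close>

type_synonym pair_coord = "nat \<times> nat + nat \<times> nat"

definition left_mat :: "nat \<Rightarrow> (pair_coord \<Rightarrow> complex) \<Rightarrow> complex mat" where
  "left_mat m x = mat m m (\<lambda>ij. x (Inl ij))"

definition right_mat :: "nat \<Rightarrow> (pair_coord \<Rightarrow> complex) \<Rightarrow> complex mat" where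
  "right_mat n x = mat n n (\<lambda>ij. x (Inr ij))"

text \<open>The coordinates describe \<open>M = g^+\<close>, so the operators are
  \<open>M A h\<close>, with entries polynomial in the coordinates; expressed in the entries of
  \<open>g\<close> they would involve conjugates.\<close>

definition scaled_kraus :: "nat \<Rightarrow> nat \<Rightarrow> complex mat list \<Rightarrow> (pair_coord \<Rightarrow> complex) \<Rightarrow> complex mat list" where
  "scaled_kraus m n As x = cp_scale (mat_adjoint (left_mat m x)) (right_mat n x) As"

definition echelon_violation :: "nat \<Rightarrow> nat \<Rightarrow> complex mat list \<Rightarrow> nat set \<Rightarrow> nat set \<Rightarrow> bool" where
  "echelon_violation m n Bs I J \<longleftrightarrow> (\<exists>v u.
     (\<forall>i\<in>I. v i i = 1 \<and> (\<forall>s. i < s \<and> s < m \<longrightarrow> v i s = 0)) \<and>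
     (\<forall>j\<in>J. u j j = 1 \<and> (\<forall>s. j < s \<and> s < n \<longrightarrow> u j s = 0)) \<and>
     (\<forall>A\<in>set Bs. \<forall>i\<in>I. \<forall>j\<in>J. form m n A (v i) (u j) = 0))"

lemma scaled_kraus_index:
  assumes As: "set As \<subseteq> carrier_mat m n" and l: "l < length As" and ad: "a < m" "d < n"
  shows "scaled_kraus m n As x ! l $$ (a, d)
    = (\<Sum>c<n. (\<Sum>b<m. x (Inl (a, b)) * As ! l $$ (b, c)) * x (Inr (c, d)))"
proof -
  have A: "As ! l \<in> carrier_mat m n" using As l by auto
  have "scaled_kraus m n As x ! l = left_mat m x * As ! l * right_mat n x"
    using l by (simp add: scaled_kraus_def cp_scale_def)
  then show ?thesis
    using A ad by (simp add: left_mat_def right_mat_def scalar_prod_def lessThan_atLeast0)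
qed

lemma length_scaled_kraus [simp]: "length (scaled_kraus m n As x) = length As"
  by (simp add: scaled_kraus_def)

lemma scaled_kraus_carrier:
  assumes "set As \<subseteq> carrier_mat m n"
  shows "set (scaled_kraus m n As x) \<subseteq> carrier_mat m n"
  unfolding scaled_kraus_def
  by (rule cp_scale_carrier[OF assms]) (simp_all add: left_mat_def right_mat_def)

text \<open>The entries of the echelon vectors become additional variables, which
  \<open>constructible_Ex\<close> projects away. \<open>Inl\<close> marks the coordinates of
  \<open>(M, h)\<close> and \<open>Inr\<close> the auxiliary ones, set to the default 0 after
  elimination.\<close>

lemma echelon_violation_constructible:
  assumes As: "set As \<subseteq> carrier_mat m n" and I: "I \<subseteq> {..<m}" and J: "J \<subseteq> {..<n}"
  shows "\<exists>P. constructible (Inl ` pair_index m n :: (pair_coord + pair_coord) set) P \<and>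
    (\<forall>x. P (case_sum x (\<lambda>_. 0)) \<longleftrightarrow> echelon_violation m n (scaled_kraus m n As x) I J)"
proof -
  have finIJ: "finite I" "finite J" using I J finite_subset by blast+
  \<comment> \<open>The variables \<open>?w\<close> stand for the conjugates of the entries of
    \<open>v\<close>, since \<open>form\<close> is conjugate-linear in its first argument.\<close>
  let ?w = "\<lambda>z i s. z (Inr (Inl (i, s))) :: complex" and ?u = "\<lambda>z j s. z (Inr (Inr (j, s))) :: complex"
  define V :: "(pair_coord + pair_coord) set" where "V = Inr ` ((I \<times> {..<m}) <+> (J \<times> {..<n}))"
  define B where "B l i j z = (\<Sum>a<m. \<Sum>d<n. ?w z i a * (\<Sum>c<n. (\<Sum>b<m. z (Inl (Inl (a, b))) * As ! l $$ (b, c)) * z (Inl (Inr (c, d)))) * ?u z j d)"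
    for l i j and z :: "pair_coord + pair_coord \<Rightarrow> complex"
  define P where "P z \<longleftrightarrow>
     ((\<forall>i\<in>I. ?w z i i - 1 = 0 \<and> (\<forall>s\<in>{i<..<m}. ?w z i s = 0)) \<and>
      (\<forall>j\<in>J. ?u z j j - 1 = 0 \<and> (\<forall>s\<in>{j<..<n}. ?u z j s = 0))) \<and>
      (\<forall>l\<in>{..<length As}. \<forall>i\<in>I. \<forall>j\<in>J. B l i j z = 0)" for z :: "pair_coord + pair_coord \<Rightarrow> complex"
  have "constructible (Inl ` pair_index m n \<union> V) P"
    unfolding P_def B_def
    by (intro constructible_conj constructible_ball constructible_zero polyfun_sum polyfun_mult polyfun_diff
        polyfun_const polyfun_var finIJ) (use I J in \<open>auto simp: V_def pair_index_def\<close>)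
  moreover have "finite V" using finIJ by (auto simp: V_def)
  ultimately have con: "constructible (Inl ` pair_index m n) (\<lambda>z. \<exists>y. P (\<lambda>v. if v \<in> V then y v else z v))"
    by (rule constructible_Ex[rotated])
  have iff: "(\<exists>y. P (\<lambda>v. if v \<in> V then y v else case_sum x (\<lambda>_. 0) v)) \<longleftrightarrow> echelon_violation m n (scaled_kraus m n As x) I J" for x
  proof -
    let ?Bs = "scaled_kraus m n As x"
    have VI: "Inr (Inl (i, s)) \<in> V" if "i \<in> I" "s < m" for i s using that by (auto simp: V_def)
    have VJ: "Inr (Inr (j, s)) \<in> V" if "j \<in> J" "s < n" for j s using that by (auto simp: V_def)
    have VL: "Inl c \<notin> V" for c by (auto simp: V_def)
    let ?z = "\<lambda>y v. if v \<in> V then y v else case_sum x (\<lambda>_. 0) v"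
    have Bform: "B l i j (?z y) = form m n (?Bs ! l) (\<lambda>s. cnj (?w y i s)) (?u y j)"
      if "l < length As" "i \<in> I" "j \<in> J" for l i j and y :: "pair_coord + pair_coord \<Rightarrow> complex"
      unfolding B_def form_def using that VI VJ VL
      by (intro sum.cong refl) (simp add: scaled_kraus_index[OF As])
    have PP: "P (?z y) \<longleftrightarrow> (\<forall>i\<in>I. ?w y i i = 1 \<and> (\<forall>s. i < s \<and> s < m \<longrightarrow> ?w y i s = 0)) \<and>
      (\<forall>j\<in>J. ?u y j j = 1 \<and> (\<forall>s. j < s \<and> s < n \<longrightarrow> ?u y j s = 0)) \<and>
      (\<forall>l<length As. \<forall>i\<in>I. \<forall>j\<in>J. form m n (?Bs ! l) (\<lambda>s. cnj (?w y i s)) (?u y j) = 0)" for y :: "pair_coord + pair_coord \<Rightarrow> complex"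
    proof -
      have "(\<forall>i\<in>I. ?w (?z y) i i - 1 = 0 \<and> (\<forall>s\<in>{i<..<m}. ?w (?z y) i s = 0)) \<longleftrightarrow>
          (\<forall>i\<in>I. ?w y i i = 1 \<and> (\<forall>s. i < s \<and> s < m \<longrightarrow> ?w y i s = 0))"
      proof (rule ball_cong[OF refl])
        fix i assume i: "i \<in> I"
        then have "i < m" using I by auto
        then show "(?w (?z y) i i - 1 = 0 \<and> (\<forall>s\<in>{i<..<m}. ?w (?z y) i s = 0)) \<longleftrightarrow>
          (?w y i i = 1 \<and> (\<forall>s. i < s \<and> s < m \<longrightarrow> ?w y i s = 0))" using VI[OF i] by auto
      qed
      moreover have "(\<forall>j\<in>J. ?u (?z y) j j - 1 = 0 \<and> (\<forall>s\<in>{j<..<n}. ?u (?z y) j s = 0)) \<longleftrightarrow>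
          (\<forall>j\<in>J. ?u y j j = 1 \<and> (\<forall>s. j < s \<and> s < n \<longrightarrow> ?u y j s = 0))"
      proof (rule ball_cong[OF refl])
        fix j assume j: "j \<in> J"
        then have "j < n" using J by auto
        then show "(?u (?z y) j j - 1 = 0 \<and> (\<forall>s\<in>{j<..<n}. ?u (?z y) j s = 0)) \<longleftrightarrow>
          (?u y j j = 1 \<and> (\<forall>s. j < s \<and> s < n \<longrightarrow> ?u y j s = 0))" using VJ[OF j] by auto
      qed
      moreover have "(\<forall>l\<in>{..<length As}. \<forall>i\<in>I. \<forall>j\<in>J. B l i j (?z y) = 0) \<longleftrightarrow>
         (\<forall>l<length As. \<forall>i\<in>I. \<forall>j\<in>J. form m n (?Bs ! l) (\<lambda>s. cnj (?w y i s)) (?u y j) = 0)"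
        using Bform by auto
      ultimately show ?thesis unfolding P_def by blast
    qed
    have all_nth: "(\<forall>A\<in>set ?Bs. Q A) \<longleftrightarrow> (\<forall>l<length As. Q (?Bs ! l))" for Q
      by (simp add: all_set_conv_all_nth)
    show ?thesis
    proof
      assume "\<exists>y. P (?z y)"
      then obtain y where "P (?z y)" by blast
      note Py = this[unfolded PP]
      show "echelon_violation m n ?Bs I J"
        unfolding echelon_violation_def all_nth
        by (rule exI[of _ "\<lambda>i s. cnj (?w y i s)"], rule exI[of _ "?u y"]) (use Py in simp)
    next
      assume "echelon_violation m n ?Bs I J"
      then obtain v u where vu: "(\<forall>i\<in>I. v i i = 1 \<and> (\<forall>s. i < s \<and> s < m \<longrightarrow> v i s = 0)) \<and>
         (\<forall>j\<in>J. u j j = 1 \<and> (\<forall>s. j < s \<and> s < n \<longrightarrow> u j s = 0)) \<and>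
         (\<forall>l<length As. \<forall>i\<in>I. \<forall>j\<in>J. form m n (?Bs ! l) (v i) (u j) = 0)"
        unfolding echelon_violation_def all_nth by blast
      define y :: "pair_coord + pair_coord \<Rightarrow> complex" where "y = case_sum (\<lambda>_. 0) (case_sum (\<lambda>(i, s). cnj (v i s)) (\<lambda>(j, s). u j s))"
      have "P (?z y)" unfolding PP using vu by (simp add: y_def)
      then show "\<exists>y. P (?z y)" by blast
    qed
  qed
  show ?thesis using con iff by blast
qed

lemma polyfun_restrict_Inl:
  "polyfun (Inl ` I) F \<Longrightarrow> polyfun I (\<lambda>x. F (case_sum x (\<lambda>_. 0)))"
proof (induction rule: polyfun.induct)
  case (polyfun_var v)
  then obtain u where "v = Inl u" "u \<in> I" by auto
  then show ?case by (simp add: polyfun.polyfun_var)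
qed (auto intro: polyfun.intros)

lemma violation_generically_constant:
  assumes As: "set As \<subseteq> carrier_mat m n" and X: "X \<subseteq> Pow {..<m} \<times> Pow {..<n}"
  shows "\<exists>f. polyfun (pair_index m n) f \<and> (\<exists>x. f x \<noteq> 0) \<and>
    ((\<forall>x. f x \<noteq> 0 \<longrightarrow> (\<exists>(I, J)\<in>X. echelon_violation m n (scaled_kraus m n As x) I J)) \<or>
     (\<forall>x. f x \<noteq> 0 \<longrightarrow> \<not> (\<exists>(I, J)\<in>X. echelon_violation m n (scaled_kraus m n As x) I J)))"
proof -
  have "finite X" using X by (rule finite_subset) auto
  have "\<exists>P. constructible (Inl ` pair_index m n :: (pair_coord + pair_coord) set) P \<and>
    (\<forall>x. P (case_sum x (\<lambda>_. 0)) \<longleftrightarrow> echelon_violation m n (scaled_kraus m n As x) (fst IJ) (snd IJ))"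
    if "IJ \<in> X" for IJ
    using subsetD[OF X that] by (intro echelon_violation_constructible[OF As]) (auto simp: mem_Times_iff)
  then obtain P where P: "\<And>IJ. IJ \<in> X \<Longrightarrow> constructible (Inl ` pair_index m n :: (pair_coord + pair_coord) set) (P IJ)"
    "\<And>IJ x. IJ \<in> X \<Longrightarrow> P IJ (case_sum x (\<lambda>_. 0)) \<longleftrightarrow> echelon_violation m n (scaled_kraus m n As x) (fst IJ) (snd IJ)"
    by metis
  have "constructible (Inl ` pair_index m n :: (pair_coord + pair_coord) set) (\<lambda>z. \<exists>IJ\<in>X. P IJ z)"
    using P(1) \<open>finite X\<close> by (intro constructible_bex) auto
  from constructible_generically_constant[OF this]
  obtain F z where F: "polyfun (Inl ` pair_index m n :: (pair_coord + pair_coord) set) F" "F z \<noteq> 0"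
    and dich: "(\<forall>z. F z \<noteq> 0 \<longrightarrow> (\<exists>IJ\<in>X. P IJ z)) \<or> (\<forall>z. F z \<noteq> 0 \<longrightarrow> \<not> (\<exists>IJ\<in>X. P IJ z))"
    by blast
  let ?e = "\<lambda>x. case_sum x (\<lambda>_. 0) :: pair_coord + pair_coord \<Rightarrow> complex"
  \<comment> \<open>\<open>F\<close> reads the \<open>Inl\<close> coordinates only, so its nonzero
    value persists when the others are set to 0.\<close>
  have "F (?e (\<lambda>c. z (Inl c))) = F z" by (rule polyfun_cong[OF F(1)]) auto
  then have "\<exists>x. F (?e x) \<noteq> 0" using F(2) by metis
  moreover have "(\<exists>IJ\<in>X. P IJ (?e x)) \<longleftrightarrow> (\<exists>(I, J)\<in>X. echelon_violation m n (scaled_kraus m n As x) I J)" for x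
    using P(2) by (auto simp: split_beta)
  ultimately show ?thesis
    using polyfun_restrict_Inl[OF F(1)] dich by (intro exI[of _ "\<lambda>x. F (?e x)"]) blast
qed

section \<open>Tools for perturbing a scaling along a line\<close>

lemma polyfun_det:
  assumes "\<And>i j. i < k \<Longrightarrow> j < k \<Longrightarrow> polyfun I (\<lambda>x. M x i j)"
  shows "polyfun I (\<lambda>x. det (mat k k (\<lambda>(i, j). M x i j)))"
proof -
  have "det (mat k k (\<lambda>(i, j). M x i j)) = (\<Sum>p\<in>{p. p permutes {0..<k}}. signof p * (\<Prod>i=0..<k. M x i (p i)))" for x
  proof -
    have "det (mat k k (\<lambda>(i, j). M x i j)) = (\<Sum>p\<in>{p. p permutes {0..<k}}. signof p * (\<Prod>i=0..<k. mat k k (\<lambda>(i, j). M x i j) $$ (i, p i)))"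
      by (simp add: det_def)
    also have "\<dots> = (\<Sum>p\<in>{p. p permutes {0..<k}}. signof p * (\<Prod>i=0..<k. M x i (p i)))"
    proof (intro sum.cong refl arg_cong2[of _ _ _ _ "(*)"] prod.cong)
      fix p i assume "p \<in> {p. p permutes {0..<k}}" "i \<in> {0..<k}"
      then have "i < k" "p i < k" using permutes_in_image[of p "{0..<k}" i] by auto
      then show "mat k k (\<lambda>(i, j). M x i j) $$ (i, p i) = M x i (p i)" by simp
    qed
    finally show ?thesis .
  qed
  moreover have "polyfun I (\<lambda>x. M x i (p i))" if "p permutes {0..<k}" "i \<in> {0..<k}" for p i
    using that assms permutes_in_image[of p "{0..<k}" i] by auto
  ultimately show ?thesis
    by (simp only:) (intro polyfun_sum polyfun_mult polyfun_const polyfun_prod, auto)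
qed

lemma frobenius_norm_tendsto:
  assumes "\<And>k. M k \<in> carrier_mat r c" "L \<in> carrier_mat r c"
    and "\<And>i j. i < r \<Longrightarrow> j < c \<Longrightarrow> (\<lambda>k. M k $$ (i, j)) \<longlonglongrightarrow> L $$ (i, j)"
  shows "(\<lambda>k. frobenius_norm (M k)) \<longlonglongrightarrow> frobenius_norm L"
proof -
  have "(\<lambda>k. sqrt (\<Sum>i<r. \<Sum>j<c. (cmod (M k $$ (i, j)))\<^sup>2)) \<longlonglongrightarrow> sqrt (\<Sum>i<r. \<Sum>j<c. (cmod (L $$ (i, j)))\<^sup>2)"
    using assms(3) by (intro tendsto_real_sqrt tendsto_sum tendsto_power tendsto_norm) auto
  moreover have "dim_row (M k) = r" "dim_col (M k) = c" for k using assms(1)[of k] by auto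
  ultimately show ?thesis using assms(2) by (simp add: frobenius_norm_def)
qed

lemma cp_map_one_tendsto:
  assumes Bs: "\<And>k. set (Bs k) \<subseteq> carrier_mat m n" "set B \<subseteq> carrier_mat m n" "\<And>k. length (Bs k) = length B"
    and lim: "\<And>l a c. l < length B \<Longrightarrow> a < m \<Longrightarrow> c < n \<Longrightarrow> (\<lambda>k. Bs k ! l $$ (a, c)) \<longlonglongrightarrow> B ! l $$ (a, c)"
    and D: "D \<in> carrier_mat m m"
  shows "(\<lambda>k. frobenius_norm (cp_map m (Bs k) (1\<^sub>m n) - D)) \<longlonglongrightarrow> frobenius_norm (cp_map m B (1\<^sub>m n) - D)"
proof (rule frobenius_norm_tendsto)
  have c: "cp_map m (Bs k) (1\<^sub>m n) \<in> carrier_mat m m" "cp_map m B (1\<^sub>m n) \<in> carrier_mat m m" for k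
    using Bs by (auto intro: cp_map_carrier)
  show "cp_map m (Bs k) (1\<^sub>m n) - D \<in> carrier_mat m m" "cp_map m B (1\<^sub>m n) - D \<in> carrier_mat m m" for k
    using D by auto
  fix i j assume ij: "i < m" "j < m"
  have "(\<lambda>k. (\<Sum>l<length B. \<Sum>c<n. Bs k ! l $$ (i, c) * cnj (Bs k ! l $$ (j, c))) - D $$ (i, j))
    \<longlonglongrightarrow> (\<Sum>l<length B. \<Sum>c<n. B ! l $$ (i, c) * cnj (B ! l $$ (j, c))) - D $$ (i, j)"
    using ij by (intro tendsto_diff tendsto_sum tendsto_mult tendsto_cnj tendsto_const lim) auto
  then show "(\<lambda>k. (cp_map m (Bs k) (1\<^sub>m n) - D) $$ (i, j)) \<longlonglongrightarrow> (cp_map m B (1\<^sub>m n) - D) $$ (i, j)"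
    using ij c D Bs by (simp add: cp_map_one_index)
qed

lemma eventually_poly_nonzero_inverse_nat:
  fixes p :: "complex poly"
  assumes "p \<noteq> 0"
  shows "eventually (\<lambda>k. poly p (of_real (1 / real (Suc k))) \<noteq> 0) sequentially"
proof -
  have inj: "inj (\<lambda>k. complex_of_real (1 / real (Suc k)))"
    by (rule injI) (simp only: of_real_eq_iff, simp)
  have "finite ((\<lambda>k. complex_of_real (1 / real (Suc k))) -` {x. poly p x = 0})"
    using poly_roots_finite[OF assms] inj by (rule finite_vimageI)
  then obtain N where "\<forall>k\<in>(\<lambda>k. complex_of_real (1 / real (Suc k))) -` {x. poly p x = 0}. k < N"
    using finite_nat_set_iff_bounded by blast
  then show ?thesis unfolding eventually_sequentially by (intro exI[of _ N]) (auto simp: not_less[symmetric])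
qed

lemma pair_coords_mats:
  assumes "M \<in> carrier_mat m m" "h \<in> carrier_mat n n"
  shows "left_mat m (pair_coords m n (M, h)) = M" "right_mat n (pair_coords m n (M, h)) = h"
  using assms by (auto intro!: eq_matI simp: left_mat_def right_mat_def pair_coords_def pair_index_def)

text \<open>\<open>X\<close> collects the pivot pairs whose weight exceeds the trace. Near an
  accurate enough scaling none of them admits echelon vectors; since the occurrence of such vectors
  is generically constant, none does wherever the polynomial \<open>f\<close> is nonzero, and
  \<open>rank_violation_echelon\<close> gives the rank condition there.\<close>

theorem scalable_imp_generic_rank_nondecreasing:
  assumes kraus: "set As \<subseteq> carrier_mat m n"
    and p: "antimono_on {1..n} p" "\<forall>j\<in>{1..n}. 0 \<le> p j"
    and q: "antimono_on {1..m} q" "\<forall>i\<in>{1..m}. 0 \<le> q i"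
    and traces: "(\<Sum>j=1..n. p j) = (\<Sum>i=1..m. q i)"
    and scal: "approx_scalable m n (GL m) (GL n) As (1\<^sub>m n) (diag_of m q) (1\<^sub>m m) (diag_of n p)"
  shows "for_generic_adjoint_pair m n (\<lambda>g h. rank_nondecreasing m n (cp_scale g h As) p q)"
proof -
  define \<tau> where "\<tau> = (\<Sum>i=1..m. q i)"
  define wt where "wt = (\<lambda>(I, J). (\<Sum>i\<in>I. q (Suc i)) + (\<Sum>j\<in>J. p (Suc j)))"
  define X where "X = {IJ \<in> Pow {..<m} \<times> Pow {..<n}. \<tau> < wt IJ}"
  have Xsub: "X \<subseteq> Pow {..<m} \<times> Pow {..<n}" by (auto simp: X_def)
  then have finX: "finite X" by (rule finite_subset) auto
  define N where "N = real m + real m ^ 3 + real n ^ 3"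
  have N0: "0 \<le> N" by (simp add: N_def)
  \<comment> \<open>Finitely many weights exceed \<open>\<tau>\<close>, so they do so by a fixed
    amount, which determines the precision required of the scaling.\<close>
  have "\<exists>gap>0. \<forall>IJ\<in>X. \<tau> + gap \<le> wt IJ"
  proof (cases "X = {}")
    case True
    then show ?thesis by (intro exI[of _ 1]) simp
  next
    case False
    have "\<tau> < Min (wt ` X)" using finX False by (simp add: X_def)
    then show ?thesis using finX by (intro exI[of _ "Min (wt ` X) - \<tau>"]) auto
  qed
  then obtain gap where gap: "0 < gap" "\<And>IJ. IJ \<in> X \<Longrightarrow> \<tau> + gap \<le> wt IJ" by blast
  \<comment> \<open>\<open>N\<close> is the constant of \<open>echelon_sum_bound\<close>. The
    divisor makes its error term at precision \<open>2 * \<epsilon>\<close> smaller than the gap;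
    the factor 2 leaves room for perturbing a scaling of precision
    \<open>\<epsilon>\<close>.\<close>
  define \<epsilon> where "\<epsilon> = gap / (3 * (N + 1))"
  have \<epsilon>: "0 < \<epsilon>" "N * (2 * \<epsilon>) < gap"
  proof -
    show "0 < \<epsilon>" using gap(1) N0 by (simp add: \<epsilon>_def)
    have "N * (2 * \<epsilon>) = gap * (2 * N / (3 * (N + 1)))" by (simp add: \<epsilon>_def)
    also have "\<dots> < gap * 1" using gap(1) N0 by (intro mult_strict_left_mono) (auto simp: field_simps)
    finally show "N * (2 * \<epsilon>) < gap" by simp
  qed
  have noviol: "\<not> (\<exists>(I, J)\<in>X. echelon_violation m n Bs I J)"
    if Bs: "set Bs \<subseteq> carrier_mat m n"
      and "frobenius_norm (cp_map m Bs (1\<^sub>m n) - diag_of m q) \<le> 2 * \<epsilon>"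
      and "frobenius_norm (cp_dual n Bs (1\<^sub>m m) - diag_of n p) \<le> 2 * \<epsilon>" for Bs
  proof
    assume "\<exists>(I, J)\<in>X. echelon_violation m n Bs I J"
    then obtain I J where IJ: "(I, J) \<in> X" and "echelon_violation m n Bs I J" by auto
    then obtain v u where vu: "(\<forall>i\<in>I. v i i = 1 \<and> (\<forall>s. i < s \<and> s < m \<longrightarrow> v i s = 0)) \<and>
      (\<forall>j\<in>J. u j j = 1 \<and> (\<forall>s. j < s \<and> s < n \<longrightarrow> u j s = 0)) \<and>
      (\<forall>A\<in>set Bs. \<forall>i\<in>I. \<forall>j\<in>J. form m n A (v i) (u j) = 0)"
      unfolding echelon_violation_def by blast
    have sub: "I \<subseteq> {..<m}" "J \<subseteq> {..<n}" using IJ Xsub by auto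
    have "(\<Sum>i\<in>I. q (Suc i)) + (\<Sum>j\<in>J. p (Suc j)) \<le> (\<Sum>i=1..m. q i) + (real m + real m ^ 3 + real n ^ 3) * (2 * \<epsilon>)"
      by (rule echelon_sum_bound[OF Bs p(1) q(1) that(2,3) sub, of v u]) (use vu in \<open>simp_all\<close>)
    then have "wt (I, J) \<le> \<tau> + N * (2 * \<epsilon>)"
      unfolding wt_def \<tau>_def N_def prod.case .
    then show False using gap(2)[OF IJ] \<epsilon>(2) by linarith
  qed
  obtain f x1 where f: "polyfun (pair_index m n) f" "f x1 \<noteq> 0"
    and dich: "(\<forall>x. f x \<noteq> 0 \<longrightarrow> (\<exists>(I, J)\<in>X. echelon_violation m n (scaled_kraus m n As x) I J)) \<or>
     (\<forall>x. f x \<noteq> 0 \<longrightarrow> \<not> (\<exists>(I, J)\<in>X. echelon_violation m n (scaled_kraus m n As x) I J))"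
    using violation_generically_constant[OF kraus Xsub] by blast
  obtain g0 h0 where g0: "g0 \<in> GL m" and h0: "h0 \<in> GL n"
    and T0: "frobenius_norm (cp_map m (cp_scale g0 h0 As) (1\<^sub>m n) - diag_of m q) \<le> \<epsilon>"
    and D0: "frobenius_norm (cp_dual n (cp_scale g0 h0 As) (1\<^sub>m m) - diag_of n p) \<le> \<epsilon>"
    using scal \<epsilon>(1) unfolding approx_scalable_def by blast
  have g0c: "g0 \<in> carrier_mat m m" and h0c: "h0 \<in> carrier_mat n n" using g0 h0 by (auto simp: GL_iff)
  define x0 where "x0 = pair_coords m n (mat_adjoint g0, h0)"
  have x0: "left_mat m x0 = mat_adjoint g0" "right_mat n x0 = h0"
    unfolding x0_def using pair_coords_mats[of "mat_adjoint g0" m h0 n] g0c h0c by auto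
  have B0: "scaled_kraus m n As x0 = cp_scale g0 h0 As" by (simp add: scaled_kraus_def x0)
  define dt where "dt x = det (left_mat m x) * det (right_mat n x)" for x
  have dt: "polyfun (pair_index m n) dt"
  proof -
    have "polyfun (pair_index m n) (\<lambda>x. det (mat m m (\<lambda>(i, j). x (Inl (i, j)))))"
      by (intro polyfun_det polyfun_var) (auto simp: pair_index_def)
    moreover have "polyfun (pair_index m n) (\<lambda>x. det (mat n n (\<lambda>(i, j). x (Inr (i, j)))))"
      by (intro polyfun_det polyfun_var) (auto simp: pair_index_def)
    ultimately show ?thesis
      unfolding dt_def left_mat_def right_mat_def by (auto intro: polyfun_mult simp: case_prod_beta')
  qed
  have dt0: "dt x0 \<noteq> 0"
    using g0 h0 det_mat_adjoint[OF g0c] by (simp add: dt_def x0 GL_iff)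
  \<comment> \<open>The scaling \<open>x0\<close> may lie on the hypersurface \<open>f = 0\<close>.
    On the line from \<open>x0\<close> to a point \<open>z\<close> with \<open>f\<close> and
    \<open>dt\<close> nonzero, the product of both vanishes for finitely many parameters only, so
    points arbitrarily close to \<open>x0\<close> avoid both hypersurfaces.\<close>
  obtain z where z: "f z * dt z \<noteq> 0" using polyfun_mult_nonzero[OF f dt dt0] by blast
  obtain P where P: "\<And>t. f (\<lambda>v. x0 v + t * (z v - x0 v)) * dt (\<lambda>v. x0 v + t * (z v - x0 v)) = poly P t"
    using polyfun_on_line[OF polyfun_mult[OF f(1) dt], of x0 "\<lambda>v. z v - x0 v"] by blast
  have "P \<noteq> 0" using P[of 1] z by auto
  define xt where "xt k v = x0 v + of_real (1 / real (Suc k)) * (z v - x0 v)" for k v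
  have lim_xt: "(\<lambda>k. xt k v) \<longlonglongrightarrow> x0 v" for v
  proof -
    have "(\<lambda>k. complex_of_real (1 / real (Suc k))) \<longlonglongrightarrow> of_real 0"
      by (intro tendsto_of_real LIMSEQ_Suc[OF lim_1_over_n])
    then have "(\<lambda>k. x0 v + complex_of_real (1 / real (Suc k)) * (z v - x0 v)) \<longlonglongrightarrow> x0 v + of_real 0 * (z v - x0 v)"
      by (intro tendsto_add tendsto_mult tendsto_const)
    then show ?thesis by (simp add: xt_def)
  qed
  have kc: "set (scaled_kraus m n As x) \<subseteq> carrier_mat m n" for x by (rule scaled_kraus_carrier[OF kraus])
  have entry: "(\<lambda>k. scaled_kraus m n As (xt k) ! l $$ (a, c)) \<longlonglongrightarrow> scaled_kraus m n As x0 ! l $$ (a, c)"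
    if "l < length As" "a < m" "c < n" for l a c
    unfolding scaled_kraus_index[OF kraus that]
    by (intro tendsto_sum tendsto_mult tendsto_const lim_xt)
  have dc: "diag_of k w \<in> carrier_mat k k" for k w by (simp add: diag_of_def mat_diag_def)
  have limT: "(\<lambda>k. frobenius_norm (cp_map m (scaled_kraus m n As (xt k)) (1\<^sub>m n) - diag_of m q))
     \<longlonglongrightarrow> frobenius_norm (cp_map m (scaled_kraus m n As x0) (1\<^sub>m n) - diag_of m q)"
    by (rule cp_map_one_tendsto) (use kc entry dc in auto)
  have limD: "(\<lambda>k. frobenius_norm (cp_dual n (scaled_kraus m n As (xt k)) (1\<^sub>m m) - diag_of n p))
     \<longlonglongrightarrow> frobenius_norm (cp_dual n (scaled_kraus m n As x0) (1\<^sub>m m) - diag_of n p)"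
    unfolding cp_dual_eq_cp_map
  proof (rule cp_map_one_tendsto)
    show "set (map mat_adjoint (scaled_kraus m n As (xt k))) \<subseteq> carrier_mat n m"
      "set (map mat_adjoint (scaled_kraus m n As x0)) \<subseteq> carrier_mat n m" for k
      using kc by (auto intro: mat_adjoint_carrier)
    fix l a c assume l: "l < length (map mat_adjoint (scaled_kraus m n As x0))" and ac: "a < n" "c < m"
    have adj: "map mat_adjoint (scaled_kraus m n As x) ! l $$ (a, c) = cnj (scaled_kraus m n As x ! l $$ (c, a))" for x
    proof -
      have "scaled_kraus m n As x ! l \<in> carrier_mat m n" using kc[of x] l by (auto simp: subset_iff)
      then show ?thesis using l ac by simp
    qed
    show "(\<lambda>k. map mat_adjoint (scaled_kraus m n As (xt k)) ! l $$ (a, c)) \<longlonglongrightarrow> map mat_adjoint (scaled_kraus m n As x0) ! l $$ (a, c)"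
      unfolding adj using l ac by (intro tendsto_cnj entry) auto
  qed (use dc in auto)
  have "eventually (\<lambda>k. frobenius_norm (cp_map m (scaled_kraus m n As (xt k)) (1\<^sub>m n) - diag_of m q) < 2 * \<epsilon>) sequentially"
    using T0 \<epsilon>(1) B0 by (intro order_tendstoD(2)[OF limT]) simp
  moreover have "eventually (\<lambda>k. frobenius_norm (cp_dual n (scaled_kraus m n As (xt k)) (1\<^sub>m m) - diag_of n p) < 2 * \<epsilon>) sequentially"
    using D0 \<epsilon>(1) B0 by (intro order_tendstoD(2)[OF limD]) simp
  moreover note eventually_poly_nonzero_inverse_nat[OF \<open>P \<noteq> 0\<close>]
  ultimately have "eventually (\<lambda>k. frobenius_norm (cp_map m (scaled_kraus m n As (xt k)) (1\<^sub>m n) - diag_of m q) < 2 * \<epsilon> \<and>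
      frobenius_norm (cp_dual n (scaled_kraus m n As (xt k)) (1\<^sub>m m) - diag_of n p) < 2 * \<epsilon> \<and>
      poly P (of_real (1 / real (Suc k))) \<noteq> 0) sequentially"
    by eventually_elim blast
  then obtain k where k: "frobenius_norm (cp_map m (scaled_kraus m n As (xt k)) (1\<^sub>m n) - diag_of m q) < 2 * \<epsilon>"
      "frobenius_norm (cp_dual n (scaled_kraus m n As (xt k)) (1\<^sub>m m) - diag_of n p) < 2 * \<epsilon>"
      "poly P (of_real (1 / real (Suc k))) \<noteq> 0"
    unfolding eventually_sequentially by blast
  have fdt: "f (xt k) * dt (xt k) \<noteq> 0"
    using k(3) P[of "of_real (1 / real (Suc k))"] unfolding xt_def by metis
  have "\<not> (\<exists>(I, J)\<in>X. echelon_violation m n (scaled_kraus m n As (xt k)) I J)"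
    by (rule noviol[OF kc]) (use k in auto)
  \<comment> \<open>One point with \<open>f\<close> nonzero and without violation rules out the
    first alternative of the dichotomy.\<close>
  then have generic: "\<not> (\<exists>(I, J)\<in>X. echelon_violation m n (scaled_kraus m n As x) I J)" if "f x \<noteq> 0" for x
    using dich fdt that by auto
  obtain \<phi> where \<phi>: "cpoly_vars \<phi> \<subseteq> pair_index m n" "\<And>x. cpoly_eval \<phi> x = f x"
    using polyfun_is_cpoly[OF f(1)] unfolding is_cpoly_def by blast
  define W where "W = {x \<in> pair_index m n \<rightarrow>\<^sub>E UNIV. \<forall>f\<in>{\<phi>}. cpoly_eval f x = 0}"
  have "affine_variety (pair_index m n) W" unfolding affine_variety_def W_def using \<phi>(1) by blast
  moreover have "\<not> pair_coords m n ` (GL m \<times> GL n) \<subseteq> W"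
  proof
    assume sub: "pair_coords m n ` (GL m \<times> GL n) \<subseteq> W"
    \<comment> \<open>The perturbed point has invertible factors, as \<open>dt\<close> is nonzero
      there, and \<open>f\<close> is nonzero at it; so it witnesses that \<open>W\<close> does not
      contain the whole group.\<close>
    let ?M = "left_mat m (xt k)" and ?h = "right_mat n (xt k)"
    have "?M \<in> GL m" "?h \<in> GL n" using fdt by (auto simp: GL_iff dt_def left_mat_def right_mat_def)
    then have "pair_coords m n (?M, ?h) \<in> W" using sub by auto
    then have "f (pair_coords m n (?M, ?h)) = 0" by (simp add: W_def \<phi>(2))
    moreover have "f (pair_coords m n (?M, ?h)) = f (xt k)"
      by (rule polyfun_cong[OF f(1)]) (auto simp: pair_coords_def pair_index_def left_mat_def right_mat_def)
    ultimately show False using fdt by simp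
  qed
  moreover have "rank_nondecreasing m n (cp_scale (mat_adjoint M) h As) p q"
    if Mh: "M \<in> GL m" "h \<in> GL n" and notW: "pair_coords m n (M, h) \<notin> W" for M h
  proof (rule ccontr)
    assume viol: "\<not> rank_nondecreasing m n (cp_scale (mat_adjoint M) h As) p q"
    let ?x = "pair_coords m n (M, h)"
    have Mc: "M \<in> carrier_mat m m" and hc: "h \<in> carrier_mat n n" using Mh by (auto simp: GL_iff)
    have Bs: "scaled_kraus m n As ?x = cp_scale (mat_adjoint M) h As"
      by (simp add: scaled_kraus_def pair_coords_mats[OF Mc hc])
    have "?x \<in> pair_index m n \<rightarrow>\<^sub>E UNIV" by (auto simp: pair_coords_def)
    then have "f ?x \<noteq> 0" using notW by (simp add: W_def \<phi>(2))
    from generic[OF this] have no: "\<not> (\<exists>(I, J)\<in>X. echelon_violation m n (cp_scale (mat_adjoint M) h As) I J)"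
      unfolding Bs .
    have "set (cp_scale (mat_adjoint M) h As) \<subseteq> carrier_mat m n" using kc[of ?x] by (simp only: Bs)
    note Bsc = this
    obtain I J v u where IJ: "I \<subseteq> {..<m}" "J \<subseteq> {..<n}"
      and v: "\<And>i. i \<in> I \<Longrightarrow> v i i = 1 \<and> (\<forall>s. i < s \<and> s < m \<longrightarrow> v i s = 0)"
      and u: "\<And>j. j \<in> J \<Longrightarrow> u j j = 1 \<and> (\<forall>s. j < s \<and> s < n \<longrightarrow> u j s = 0)"
      and zero: "\<And>A i j. A \<in> set (cp_scale (mat_adjoint M) h As) \<Longrightarrow> i \<in> I \<Longrightarrow> j \<in> J \<Longrightarrow> form m n A (v i) (u j) = 0"
      and gt: "(\<Sum>j=1..n. p j) < (\<Sum>i\<in>I. q (Suc i)) + (\<Sum>j\<in>J. p (Suc j))"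
      by (rule rank_violation_echelon[OF Bsc p q viol]) (rule that; assumption)
    have "(I, J) \<in> X" using IJ gt traces by (simp add: X_def wt_def \<tau>_def)
    moreover have "echelon_violation m n (cp_scale (mat_adjoint M) h As) I J"
      unfolding echelon_violation_def using v u zero by blast
    ultimately show False using no by blast
  qed
  ultimately show ?thesis
    unfolding for_generic_adjoint_pair_def holds_generically_def by (intro exI[of _ W]) auto
qed

section \<open>Generic pairs and the equivalence\<close>

lemma for_generic_adjoint_pair_mono:
  assumes "for_generic_adjoint_pair m n \<phi>"
    and "\<And>g h. g \<in> GL m \<Longrightarrow> h \<in> GL n \<Longrightarrow> \<phi> g h \<Longrightarrow> \<psi> g h"
  shows "for_generic_adjoint_pair m n \<psi>"
proof -
  obtain V where V: "affine_variety (pair_index m n) V" "\<not> pair_coords m n ` (GL m \<times> GL n) \<subseteq> V"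
    and \<phi>: "\<And>M h. M \<in> GL m \<Longrightarrow> h \<in> GL n \<Longrightarrow> pair_coords m n (M, h) \<notin> V \<Longrightarrow> \<phi> (mat_adjoint M) h"
    using assms(1) unfolding for_generic_adjoint_pair_def holds_generically_def by auto
  have "\<psi> (mat_adjoint M) h" if "M \<in> GL m" "h \<in> GL n" "pair_coords m n (M, h) \<notin> V" for M h
    using that by (intro assms(2) \<phi>) (auto simp: GL_iff det_mat_adjoint)
  then have "\<forall>x\<in>GL m \<times> GL n. pair_coords m n x \<notin> V \<longrightarrow> (case x of (M, h) \<Rightarrow> \<psi> (mat_adjoint M) h)"
    by auto
  with V show ?thesis unfolding for_generic_adjoint_pair_def holds_generically_def by blast
qed

lemma for_generic_adjoint_pair_exists:
  assumes "for_generic_adjoint_pair m n \<phi>"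
  shows "\<exists>g\<in>GL m. \<exists>h\<in>GL n. \<phi> g h"
proof -
  obtain V where V: "\<not> pair_coords m n ` (GL m \<times> GL n) \<subseteq> V"
    and \<phi>: "\<And>M h. M \<in> GL m \<Longrightarrow> h \<in> GL n \<Longrightarrow> pair_coords m n (M, h) \<notin> V \<Longrightarrow> \<phi> (mat_adjoint M) h"
    using assms unfolding for_generic_adjoint_pair_def holds_generically_def by auto
  obtain M h where "M \<in> GL m" "h \<in> GL n" "pair_coords m n (M, h) \<notin> V" using V by auto
  then have "M \<in> GL m" "h \<in> GL n" "\<phi> (mat_adjoint M) h" using \<phi> by auto
  then show ?thesis by (intro bexI[of _ "mat_adjoint M"] bexI[of _ h]) (auto simp: GL_iff det_mat_adjoint)
qed

theorem mainTheorem2: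
  fixes m n :: nat and As :: "complex mat list" and p q :: "nat \<Rightarrow> real"
  assumes kraus: "set As \<subseteq> carrier_mat m n"
    and p_decreasing: "antimono_on {1..n} p" and p_nonneg: "\<forall>j\<in>{1..n}. 0 \<le> p j"
    and q_decreasing: "antimono_on {1..m} q" and q_nonneg: "\<forall>i\<in>{1..m}. 0 \<le> q i"
    and traces: "(\<Sum>j=1..n. p j) = (\<Sum>i=1..m. q i)"
  shows "(for_generic_adjoint_pair m n (\<lambda>g h. rank_nondecreasing m n (cp_scale g h As) p q)
          \<longleftrightarrow> for_generic_adjoint_pair m n (\<lambda>g h. 0 < capacity m n (cp_scale g h As) p q))
       \<and> (for_generic_adjoint_pair m n (\<lambda>g h. 0 < capacity m n (cp_scale g h As) p q)
          \<longleftrightarrow> approx_scalable m n (GL m) (GL n) As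
                (1\<^sub>m n) (diag_of m q) (1\<^sub>m m) (diag_of n p))"
proof -
  let ?rank = "for_generic_adjoint_pair m n (\<lambda>g h. rank_nondecreasing m n (cp_scale g h As) p q)"
  let ?cap = "for_generic_adjoint_pair m n (\<lambda>g h. 0 < capacity m n (cp_scale g h As) p q)"
  let ?scal = "approx_scalable m n (GL m) (GL n) As (1\<^sub>m n) (diag_of m q) (1\<^sub>m m) (diag_of n p)"
  have "?cap" if "?rank"
    using that
  proof (rule for_generic_adjoint_pair_mono)
    fix g h assume gh: "g \<in> GL m" "h \<in> GL n" and rank: "rank_nondecreasing m n (cp_scale g h As) p q"
    have "set (cp_scale g h As) \<subseteq> carrier_mat m n"
      using gh by (intro cp_scale_carrier[OF kraus]) (auto simp: GL_iff)
    then show "0 < capacity m n (cp_scale g h As) p q"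
      by (rule rank_nondecreasing_imp_capacity_pos[OF rank _ p_decreasing p_nonneg q_decreasing q_nonneg traces])
  qed
  moreover have "?scal" if cap_gen: "?cap"
    unfolding approx_scalable_def
  proof (intro allI impI)
    fix \<epsilon> :: real assume \<epsilon>: "0 < \<epsilon>"
    \<comment> \<open>One pair of positive capacity suffices: a triangular scaling of
      \<open>T_{g,h}\<close> by \<open>(a, b)\<close> is the scaling of \<open>T\<close> by
      \<open>(g a, h b)\<close>.\<close>
    obtain g h where g: "g \<in> GL m" and h: "h \<in> GL n" and cap: "0 < capacity m n (cp_scale g h As) p q"
      using for_generic_adjoint_pair_exists[OF cap_gen] by blast
    have gc: "g \<in> carrier_mat m m" and hc: "h \<in> carrier_mat n n" using g h by (auto simp: GL_iff)
    obtain a b where a: "a \<in> GL_flag m" and b: "b \<in> GL_flag n"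
      and T: "frobenius_norm (cp_map m (cp_scale a b (cp_scale g h As)) (1\<^sub>m n) - diag_of m q) \<le> \<epsilon>"
      and D: "frobenius_norm (cp_dual n (cp_scale a b (cp_scale g h As)) (1\<^sub>m m) - diag_of n p) \<le> \<epsilon>"
      using capacity_pos_imp_scalable[OF cp_scale_carrier[OF kraus gc hc] p_nonneg q_decreasing q_nonneg cap \<epsilon>]
      by blast
    have ab: "a \<in> GL m" "b \<in> GL n" using a b by (auto simp: GL_flag_def)
    have "cp_scale a b (cp_scale g h As) = cp_scale (g * a) (h * b) As"
      using ab by (intro cp_scale_cp_scale[OF kraus gc hc]) (auto simp: GL_iff)
    with T D show "\<exists>g\<in>GL m. \<exists>h\<in>GL n.
        frobenius_norm (cp_map m (cp_scale g h As) (1\<^sub>m n) - diag_of m q) \<le> \<epsilon> \<and>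
        frobenius_norm (cp_dual n (cp_scale g h As) (1\<^sub>m m) - diag_of n p) \<le> \<epsilon>"
      using GL_mult[OF g ab(1)] GL_mult[OF h ab(2)] by (intro bexI[of _ "g * a"] bexI[of _ "h * b"]) simp_all
  qed
  moreover have "?rank" if "?scal"
    by (rule scalable_imp_generic_rank_nondecreasing[OF kraus p_decreasing p_nonneg q_decreasing q_nonneg traces that])
  ultimately show ?thesis by blast
qed

end
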